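(* Let $X\subset\mathbb{R}^N$ be a bounded open set and let $\Theta$ be a uniformly continuous proper elliptic map on $X$. If $u,\tilde u\in\mathrm{USC}(\overline{X})$, $u$ is $\Theta$-subharmonic in $X$ and $\tilde u$ is $\tilde\Theta$-subharmonic in $X$, then $u+\tilde u$ is $\tilde{\mathcal{Q}}$-subharmonic in $X$.
   Context: $\mathcal{S}(N)$ is the space of real symmetric $N\times N$ matrices with the usual partial order; $\lambda_1(A)\le\dots\le\lambda_N(A)$ are the ordered eigenvalues; $I$ is the identity. $\mathcal{Q}:=\{(s,P): s\le 0,\ P\ge 0\}\subset\mathbb{R}\times\mathcal{S}(N)$ and $\tilde{\mathcal{Q}}:=\{(r,A)\in\mathbb{R}\times\mathcal{S}(N): r\le 0\text{ or }\lambda_N(A)\ge 0\}$. A map $\Theta$ from $X$ to subsets of $\mathbb{R}\times\mathcal{S}(N)$ is a proper elliptic map if each $\Theta(x)$ is closed, nonempty, not all of $\mathbb{R}\times\mathcal{S}(N)$, and $\Theta(x)+\mathcal{Q}\subset\Theta(x)$. Its dual map is $\tilde\Theta(x):=-\big[(\mathbb{R}\times\mathcal{S}(N))\setminus(\Theta(x))^\circ\big]$. For $u$ defined near $x_0$, $J^+_{x_0}u:=\{(\varphi(x_0),D^2\varphi(x_0)):\varphi$ is $C^2$ near $x_0$, $u\le\varphi$ near $x_0$, $u(x_0)=\varphi(x_0)\}$. For a map $\Psi$ (possibly constant, e.g. $\Psi\equiv\tilde{\mathcal Q}$), $w\in\mathrm{USC}(X)$ is $\Psi$-subharmonic in $X$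 if $J^+_{x_0}w\subset\Psi(x_0)$ for all $x_0\in X$. With the norm $\|(r,A)\|=\max\{|r|,\max_i|\lambda_i(A)|\}$ and the associated Hausdorff distance $d_{\mathcal H}$ on closed subsets of $\mathbb{R}\times\mathcal{S}(N)$ (possibly $+\infty$), $\Theta$ is uniformly continuous on $X$ if for every $\eta>0$ there is $\delta>0$ such that $d_{\mathcal H}(\Theta(x),\Theta(y))<\eta$ for all $x,y\in X$ with $|x-y|<\delta$. *)

theory Defs
  imports "HOL-Analysis.Analysis"
begin

definition symmetric_mat :: "real^'n^'n \<Rightarrow> bool" where
  "symmetric_mat A \<longleftrightarrow> transpose A = A"

definition SymSpace :: "(real \<times> (real^'n^'n)) set" where
  "SymSpace = {(r, A). symmetric_mat A}"

definition psd :: "real^'n^'n \<Rightarrow> bool" where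
  "psd P \<longleftrightarrow> (\<forall>v. v \<bullet> (P *v v) \<ge> 0)"

definition eigvals :: "real^'n^'n \<Rightarrow> real set" where
  "eigvals A = {c. \<exists>v. v \<noteq> 0 \<and> A *v v = c *s v}"

definition lam_max :: "real^'n^'n \<Rightarrow> real" where
  "lam_max A = Max (eigvals A)"

definition jnorm :: "real \<times> (real^'n^'n) \<Rightarrow> real" where
  "jnorm p = max \<bar>fst p\<bar> (Max (abs ` eigvals (snd p)))"

definition hdist :: "(real \<times> (real^'n^'n)) set \<Rightarrow> (real \<times> (real^'n^'n)) set \<Rightarrow> ereal" where
  "hdist S T = max (SUP a\<in>S. INF b\<in>T. ereal (jnorm (a - b)))
                   (SUP b\<in>T. INF a\<in>S. ereal (jnorm (a - b)))"

definition Qcone :: "(real \<times> (real^'n^'n)) set" where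
  "Qcone = {(s, P). s \<le> 0 \<and> symmetric_mat P \<and> psd P}"

definition Qtilde :: "(real \<times> (real^'n^'n)) set" where
  "Qtilde = {(r, A). symmetric_mat A \<and> (r \<le> 0 \<or> lam_max A \<ge> 0)}"

definition proper_elliptic_map ::
  "(real^'n) set \<Rightarrow> (real^'n \<Rightarrow> (real \<times> (real^'n^'n)) set) \<Rightarrow> bool" where
  "proper_elliptic_map X \<Theta> \<longleftrightarrow>
     (\<forall>x\<in>X. \<Theta> x \<subseteq> SymSpace \<and> closed (\<Theta> x) \<and> \<Theta> x \<noteq> {} \<and> \<Theta> x \<noteq> SymSpace
            \<and> (\<forall>p\<in>\<Theta> x. \<forall>q\<in>Qcone. p + q \<in> \<Theta> x))"

definition dual_map ::
  "(real^'n \<Rightarrow> (real \<times> (real^'n^'n)) set) \<Rightarrow> real^'n \<Rightarrow> (real \<times> (real^'n^'n)) set" where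
  "dual_map \<Theta> x = uminus ` (SymSpace - ((subtopology euclidean SymSpace) interior_of (\<Theta> x)))"

definition unif_cont_map ::
  "(real^'n) set \<Rightarrow> (real^'n \<Rightarrow> (real \<times> (real^'n^'n)) set) \<Rightarrow> bool" where
  "unif_cont_map X \<Theta> \<longleftrightarrow>
     (\<forall>\<eta>>0. \<exists>\<delta>>0. \<forall>x\<in>X. \<forall>y\<in>X. dist x y < \<delta> \<longrightarrow> hdist (\<Theta> x) (\<Theta> y) < ereal \<eta>)"

definition usc_on :: "(real^'n) set \<Rightarrow> (real^'n \<Rightarrow> ereal) \<Rightarrow> bool" where
  "usc_on S u \<longleftrightarrow> (\<forall>x\<in>S. u x < \<infinity> \<and>
      (\<forall>c. u x < c \<longrightarrow> (\<exists>e>0. \<forall>y\<in>S. dist y x < e \<longrightarrow> u y < c)))"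

definition C2_near :: "(real^'n \<Rightarrow> real) \<Rightarrow> real^'n \<Rightarrow> (real^'n \<Rightarrow> real^'n) \<Rightarrow> (real^'n \<Rightarrow> real^'n^'n) \<Rightarrow> bool" where
  "C2_near \<phi> x0 g H \<longleftrightarrow> (\<exists>e>0.
      (\<forall>x\<in>ball x0 e. (\<phi> has_derivative (\<lambda>h. g x \<bullet> h)) (at x)
                     \<and> (g has_derivative (\<lambda>h. H x *v h)) (at x))
      \<and> continuous_on (ball x0 e) H)"

definition upper_jets :: "(real^'n \<Rightarrow> ereal) \<Rightarrow> real^'n \<Rightarrow> (real \<times> (real^'n^'n)) set" where
  "upper_jets u x0 = {(\<phi> x0, H x0) | \<phi> g H. C2_near \<phi> x0 g H \<and>
      (\<exists>e>0. \<forall>x\<in>ball x0 e. u x \<le> ereal (\<phi> x)) \<and> u x0 = ereal (\<phi> x0)}"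

definition subharmonic ::
  "(real^'n \<Rightarrow> (real \<times> (real^'n^'n)) set) \<Rightarrow> (real^'n) set \<Rightarrow> (real^'n \<Rightarrow> ereal) \<Rightarrow> bool" where
  "subharmonic \<Psi> X w \<longleftrightarrow> usc_on X w \<and> (\<forall>x0\<in>X. upper_jets w x0 \<subseteq> \<Psi> x0)"

end

theory Submission
  imports Defs "HOL-Real_Asymp.Real_Asymp"
begin

text \<open>
  Suppose a test function with positive value and negative definite Hessian touches u + ut from
  above at a point. Sup-convolution makes both summands semiconvex, and it moves the base point of
  a jet (value, Hessian) only by a small amount and its value only upwards. On the set of points at
  which the sum of the two convolutions is touched from above by a concave paraboloid, both have
  second-order expansions almost everywhere (Rademacher's theorem for the proximal map of a convex
  function), and by Jensen's argument this set is not negligible. At such a point the two Hessians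
  have negative definite sum. As jets carry no gradient, uniform continuity compares the two fibres
  of the map at the two nearby base points, and the definition of the dual map is contradicted.
\<close>

section \<open>Lipschitz functions of one variable are differentiable almost everywhere\<close>

text \<open>The obstacle is that a jet of the sum does not split into jets of the summands, which
  are merely upper semicontinuous and may take the value -infinity. Convexity is what allows the
  splitting: for functions that are convex up to a quadratic, an upper paraboloid of the sum,
  combined with a subgradient of one summand, is an upper paraboloid of the other. Two base points
  appear because each convolution attains its supremum at a point of its own. Continuity of \<Theta>
  has to be uniform here, since the tolerance is fixed before these points are known. No limit in
  the convolution parameter is taken; one small parameter suffices because the contradiction has
  margins. A Hessian at most -4c gives contact with a paraboloid of the form -c|x - x0|^2; the
  regularized Hessians then sum to at most -c/2, and exchanging the fibre leaves -c/4. The positive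
  value \<phi> x0 loses at most a quarter to the change of base points and a quarter to the exchange
  of fibres.\<close>

lemma Lipschitz_mono_Stieltjes_measure:
  fixes g :: "real \<Rightarrow> real"
  assumes mono: "\<And>x y. x \<le> y \<Longrightarrow> g x \<le> g y"
    and lip: "\<And>x y. x \<le> y \<Longrightarrow> g y - g x \<le> y - x"
  obtains \<mu> :: "real measure" where "sets \<mu> = sets borel"
    "\<And>a b. a \<le> b \<Longrightarrow> emeasure \<mu> {a..b} = ennreal (g b - g a)"
    "\<And>A. A \<in> sets borel \<Longrightarrow> emeasure \<mu> A \<le> emeasure lborel A"
proof -
  have cont: "continuous_on UNIV g"
  proof -
    have "1-lipschitz_on UNIV g"
      unfolding lipschitz_on_def dist_real_def
      using mono lip by (smt (verit) UNIV_I)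
    then show ?thesis by (rule lipschitz_on_continuous_on)
  qed
  \<comment> \<open>Both g and x - g x are nondecreasing, so each has a Stieltjes measure. The two
    add up to u - l on every interval from l to u, so their sum is Lebesgue measure and \<mu> lies
    below it.\<close>
  define \<mu> where "\<mu> = interval_measure g"
  define \<nu> where "\<nu> = interval_measure (\<lambda>x. x - g x)"
  have \<mu>: "emeasure \<mu> {a..b} = ennreal (g b - g a)" if "a \<le> b" for a b
    unfolding \<mu>_def using that mono cont by (rule emeasure_interval_measure_Icc)
  have \<nu>: "emeasure \<nu> {a..b} = ennreal ((b - g b) - (a - g a))" if "a \<le> b" for a b
    unfolding \<nu>_def using that
    by (rule emeasure_interval_measure_Icc) (use lip cont in \<open>force intro: continuous_intros\<close>)+
  have sets[simp]: "sets \<mu> = sets borel" "sets \<nu> = sets borel" by (simp_all add: \<mu>_def \<nu>_def)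
  define M where "M = measure_of UNIV (sets borel) (\<lambda>A. emeasure \<mu> A + emeasure \<nu> A)"
  have eM: "emeasure M A = emeasure \<mu> A + emeasure \<nu> A" if "A \<in> sets borel" for A
    unfolding M_def
  proof (rule emeasure_measure_of_sigma)
    show "sigma_algebra UNIV (sets borel)" by (metis sets.sigma_algebra_axioms space_borel)
    show "positive (sets borel) (\<lambda>A. emeasure \<mu> A + emeasure \<nu> A)" by (simp add: positive_def)
    show "countably_additive (sets borel) (\<lambda>A. emeasure \<mu> A + emeasure \<nu> A)"
      unfolding countably_additive_def
    proof (intro allI impI)
      fix A :: "nat \<Rightarrow> real set"
      assume "range A \<subseteq> sets borel" "disjoint_family A" "\<Union> (range A) \<in> sets borel"
      then show "(\<Sum>i. emeasure \<mu> (A i) + emeasure \<nu> (A i)) = emeasure \<mu> (\<Union> (range A)) + emeasure \<nu> (\<Union> (range A))"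
        by (subst suminf_add[symmetric]) (simp_all add: suminf_emeasure)
    qed
  qed (use that in auto)
  have "lborel = M"
  proof (rule lborel_eqI)
    have "sigma_sets UNIV (sets (borel::real measure)) = sets borel"
      by (metis sets.sigma_sets_eq space_borel)
    then show "sets M = sets borel" by (simp add: M_def sets_measure_of_conv)
    fix l u :: real assume "\<And>b. b \<in> Basis \<Longrightarrow> l \<bullet> b \<le> u \<bullet> b"
    then have lu: "l \<le> u" by simp
    have eq: "emeasure M {a..b} = ennreal (b - a)" if "a \<le> b" for a b
      using that mono[OF that] lip[OF that] by (simp add: eM \<mu> \<nu> flip: ennreal_plus)
    have "emeasure M {l<..<u} = emeasure M {l..u}"
    proof -
      have z: "emeasure M {x} = 0" for x using eq[of x x] by simp
      have "{l..u} = {l<..<u} \<union> {l,u}" using lu by auto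
      moreover have "{l,u} \<in> null_sets M"
        using null_sets.Un[of "{l}" M "{u}"] z[of l] z[of u] \<open>sets M = sets borel\<close>
        by (simp add: null_sets_def insert_commute)
      ultimately show ?thesis
        using emeasure_Un_null_set[of "{l<..<u}" M "{l,u}"] \<open>sets M = sets borel\<close> by simp
    qed
    then show "emeasure M (box l u) = (\<Prod>b\<in>Basis. (u - l) \<bullet> b)"
      using eq[OF lu] by (simp add: box_real)
  qed
  then have "emeasure \<mu> A \<le> emeasure lborel A" if "A \<in> sets borel" for A
    using eM[OF that] by simp
  then show thesis using that[of \<mu>] \<mu> by simp
qed

text \<open>An interval is a ball about its midpoint, so this is the Vitali theorem for balls. The
  intervals need only contain x and not be centred at it, because the slope intervals covered with
  later have x as an endpoint. Staying inside U bounds the measure of the cover by that of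
  U.\<close>

lemma Vitali_covering_intervals:
  fixes E U :: "real set"
  assumes "open U" "E \<subseteq> U"
    and cov: "\<And>x e. x \<in> E \<Longrightarrow> e > 0 \<Longrightarrow> \<exists>a b. a < b \<and> a \<le> x \<and> x \<le> b \<and> b - a < e \<and> P a b"
  obtains C where "countable C" "\<And>a b. (a,b) \<in> C \<Longrightarrow> a < b \<and> P a b \<and> {a..b} \<subseteq> U"
    "disjoint_family_on (\<lambda>(a,b). {a..b}) C" "negligible (E - (\<Union>(a,b)\<in>C. {a..b}))"
proof -
  define K where "K = {(a,b). a < b \<and> P a b \<and> {a..b} \<subseteq> U}"
  define m where "m = (\<lambda>(a::real,b). (a+b)/2)"
  define r where "r = (\<lambda>(a::real,b). (b-a)/2)"
  have cb: "cball (m i) (r i) = (\<lambda>(a,b). {a..b}) i" for i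
    by (cases i) (simp add: m_def r_def cball_eq_atLeastAtMost field_simps)
  obtain C where C: "countable C" "C \<subseteq> K"
     "pairwise (\<lambda>i j. disjnt (cball (m i) (r i)) (cball (m j) (r j))) C"
     "negligible(E - (\<Union>i \<in> C. cball (m i) (r i)))"
  proof (rule Vitali_covering_theorem_cballs[of K r E m])
    show "\<And>i. i \<in> K \<Longrightarrow> 0 < r i" by (auto simp: K_def r_def)
    fix x d :: real assume "x \<in> E" "0 < d"
    then obtain e where e: "e > 0" "ball x e \<subseteq> U" using assms(1,2) by (meson openE subsetD)
    obtain a b where ab: "a < b" "a \<le> x" "x \<le> b" "b - a < min d e" "P a b"
      using cov[OF \<open>x \<in> E\<close>, of "min d e"] \<open>d > 0\<close> e by auto
    have "{a..b} \<subseteq> ball x e" using ab by (auto simp: ball_def dist_real_def)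
    then have "(a,b) \<in> K" using ab e by (auto simp: K_def)
    moreover have "x \<in> cball (m (a,b)) (r (a,b))" unfolding cb using ab by simp
    moreover have "r (a,b) < d" using ab by (simp add: r_def field_simps)
    ultimately show "\<exists>i. i \<in> K \<and> x \<in> cball (m i) (r i) \<and> r i < d" by blast
  qed blast
  show thesis
  proof (rule that[of C])
    show "disjoint_family_on (\<lambda>(a,b). {a..b}) C"
      using C(3) unfolding cb disjoint_family_on_def pairwise_def disjnt_def by blast
    show "negligible (E - (\<Union>(a,b)\<in>C. {a..b}))" using C(4) unfolding cb by simp
    show "\<And>a b. (a,b) \<in> C \<Longrightarrow> a < b \<and> P a b \<and> {a..b} \<subseteq> U" using C(2) by (auto simp: K_def)
  qed (use C in auto)
qed

lemma negligible_iff_null_sets_lborel: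
  assumes "E \<in> sets borel"
  shows "negligible E \<longleftrightarrow> E \<in> null_sets lborel"
  using assms by (simp add: negligible_iff_null_sets null_sets_completion_iff)

definition slope :: "(real \<Rightarrow> real) \<Rightarrow> real \<Rightarrow> real \<Rightarrow> real" where
  "slope g x y = (g y - g x) / (y - x)"

lemma slope_commute: "slope g x y = slope g y x"
  unfolding slope_def by (metis minus_diff_eq minus_divide_divide)

text \<open>For a fixed e the set is a union over y of open sets, and countably many values of e are
  enough.\<close>

lemma borel_slopes:
  fixes g :: "real \<Rightarrow> real"
  assumes "continuous_on UNIV g" "open S"
  shows "{x. \<forall>e>0. \<exists>y. y \<noteq> x \<and> \<bar>y - x\<bar> < e \<and> slope g x y \<in> S} \<in> sets borel"
proof -
  have op: "open {x. \<exists>y. y \<noteq> x \<and> \<bar>y - x\<bar> < e \<and> slope g x y \<in> S}" for e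
  proof -
    have "open {x. y \<noteq> x \<and> \<bar>y - x\<bar> < e \<and> slope g x y \<in> S}" for y
    proof -
      have "continuous_on {x. x \<noteq> y} (\<lambda>x. slope g x y)"
        unfolding slope_def
        by (intro continuous_intros continuous_on_subset[OF assms(1)]) auto
      then have "open ({x. x \<noteq> y} \<inter> (\<lambda>x. slope g x y) -` S)"
        using assms(2) by (intro continuous_open_preimage) (auto intro: open_Collect_neq continuous_intros)
      moreover have "open {x. \<bar>y - x\<bar> < e}" by (intro open_Collect_less continuous_intros)
      moreover have "{x. y \<noteq> x \<and> \<bar>y - x\<bar> < e \<and> slope g x y \<in> S}
         = ({x. x \<noteq> y} \<inter> (\<lambda>x. slope g x y) -` S) \<inter> {x. \<bar>y - x\<bar> < e}" by auto
      ultimately show ?thesis by auto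
    qed
    then have "open (\<Union>y. {x. y \<noteq> x \<and> \<bar>y - x\<bar> < e \<and> slope g x y \<in> S})" by blast
    moreover have "(\<Union>y. {x. y \<noteq> x \<and> \<bar>y - x\<bar> < e \<and> slope g x y \<in> S}) = {x. \<exists>y. y \<noteq> x \<and> \<bar>y - x\<bar> < e \<and> slope g x y \<in> S}"
      by auto
    ultimately show ?thesis by simp
  qed
  have "{x. \<forall>e>0. \<exists>y. y \<noteq> x \<and> \<bar>y - x\<bar> < e \<and> slope g x y \<in> S}
      = (\<Inter>n::nat. {x. \<exists>y. y \<noteq> x \<and> \<bar>y - x\<bar> < inverse (real (Suc n)) \<and> slope g x y \<in> S})"
  proof safe
    fix x and e :: real
    assume h: "x \<in> (\<Inter>n. {x. \<exists>y. y \<noteq> x \<and> \<bar>y - x\<bar> < inverse (real (Suc n)) \<and> slope g x y \<in> S})" and "e > 0"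
    obtain n where n: "inverse (real (Suc n)) < e" using reals_Archimedean[OF \<open>e>0\<close>] by blast
    from h obtain y where "y \<noteq> x" "\<bar>y - x\<bar> < inverse (real (Suc n))" "slope g x y \<in> S" by blast
    with n show "\<exists>y. y \<noteq> x \<and> \<bar>y - x\<bar> < e \<and> slope g x y \<in> S" by (meson order_less_trans)
  next
    fix x and n :: nat assume "\<forall>e>0. \<exists>y. y \<noteq> x \<and> \<bar>y - x\<bar> < e \<and> slope g x y \<in> S"
    then show "\<exists>y. y \<noteq> x \<and> \<bar>y - x\<bar> < inverse (real (Suc n)) \<and> slope g x y \<in> S"
      by simp
  qed
  also have "\<dots> \<in> sets borel" using op by (intro sets.countable_INT'') (auto intro: borel_open)
  finally show ?thesis .
qed

text \<open>
  Vitali-cover E by intervals of slope below p and again by intervals of slope above q: the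
  Stieltjes measure of E is then at most p and at least q times its Lebesgue measure.
\<close>
lemma slope_gap_null:
  fixes g :: "real \<Rightarrow> real"
  assumes mono: "\<And>x y. x \<le> y \<Longrightarrow> g x \<le> g y"
    and lip: "\<And>x y. x \<le> y \<Longrightarrow> g y - g x \<le> y - x"
    and "p < q"
    and E: "E \<in> sets borel" "bounded E"
    and lo: "\<And>x e. x \<in> E \<Longrightarrow> e > 0 \<Longrightarrow> \<exists>y. y \<noteq> x \<and> \<bar>y - x\<bar> < e \<and> slope g x y < p"
    and hi: "\<And>x e. x \<in> E \<Longrightarrow> e > 0 \<Longrightarrow> \<exists>y. y \<noteq> x \<and> \<bar>y - x\<bar> < e \<and> q < slope g x y"
  shows "E \<in> null_sets lborel"
proof (cases "E = {}")
  case False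
  have sl: "0 \<le> slope g x y" "slope g x y \<le> 1" for x y
  proof -
    have "0 \<le> slope g x y \<and> slope g x y \<le> 1" if "x \<le> y" for x y
      using mono[OF that] lip[OF that] that by (cases "x = y") (auto simp: slope_def field_simps)
    then show "0 \<le> slope g x y" "slope g x y \<le> 1" by (metis slope_commute linear)+
  qed
  have "p > 0" using False lo sl(1) by (metis all_not_in_conv zero_less_one order_le_less_trans)
  have "q > 0" using \<open>p > 0\<close> \<open>p < q\<close> by simp
  obtain \<mu> :: "real measure" where \<mu>: "sets \<mu> = sets borel"
    "\<And>a b. a \<le> b \<Longrightarrow> emeasure \<mu> {a..b} = ennreal (g b - g a)"
    "\<And>A. A \<in> sets borel \<Longrightarrow> emeasure \<mu> A \<le> emeasure lborel A"
    using Lipschitz_mono_Stieltjes_measure[OF mono lip] by blast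
  have interval: "\<exists>a b. a < b \<and> a \<le> x \<and> x \<le> b \<and> b - a < e \<and> slope g a b \<in> S"
    if "\<exists>y. y \<noteq> x \<and> \<bar>y - x\<bar> < e \<and> slope g x y \<in> S" for x e S
  proof -
    from that obtain y where y: "y \<noteq> x" "\<bar>y - x\<bar> < e" "slope g x y \<in> S" by blast
    show ?thesis
    proof (cases "x < y")
      case True then show ?thesis using y by (intro exI[of _ x] exI[of _ y]) auto
    next
      case False then show ?thesis using y slope_commute[of g x y] by (intro exI[of _ y] exI[of _ x]) auto
    qed
  qed
  have sum_eq: "emeasure M (\<Union>(a,b)\<in>C. {a..b}) = (\<integral>\<^sup>+i. emeasure M {fst i..snd i} \<partial>count_space C)"
    if "sets M = sets borel" "countable C" "disjoint_family_on (\<lambda>(a,b). {a..b}) C" for M :: "real measure" and C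
    using emeasure_UN_countable[of C "\<lambda>(a,b). {a..b}" M] that
    by (auto simp: case_prod_unfold)
  have meas: "(\<Union>(a,b)\<in>C. {a..b}) \<in> sets borel" if "countable C" for C :: "(real\<times>real) set"
    using that by (intro sets.countable_UN') auto
  have fin: "emeasure lborel E < \<infinity>" using E(2) emeasure_bounded_finite by blast
  then obtain m where m: "emeasure lborel E = ennreal m" "m \<ge> 0"
    by (metis ennreal_cases infinity_ennreal_def less_irrefl)
  have main: "q * m \<le> p * (m + e) + e" if "e > 0" for e :: real
  proof -
    obtain U where U: "open U" "E \<subseteq> U" "emeasure lborel (U - E) \<le> ennreal e"
      using outer_regular_lborel_le[OF E(1) \<open>e > 0\<close>] by blast
    have Ub: "U \<in> sets borel" using U by auto
    have split: "emeasure M U \<le> emeasure M E + emeasure M (U - E)" if "sets M = sets borel" for M :: "real measure"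
      using emeasure_subadditive[of E M "U - E"] E(1) Ub U(2) that by (simp add: Un_absorb1 sets.Diff)
    \<comment> \<open>The part of E that the Vitali intervals miss is Lebesgue null, hence null for
      every measure below Lebesgue measure. This is where the domination of \<mu> by Lebesgue
      measure is decisive.\<close>
    have cover: "emeasure M E \<le> emeasure M (\<Union>(a,b)\<in>C. {a..b})"
      if "sets M = sets borel" "\<And>A. A \<in> sets borel \<Longrightarrow> emeasure M A \<le> emeasure lborel A"
         "countable C" "negligible (E - (\<Union>(a,b)\<in>C. {a..b}))" for M :: "real measure" and C
    proof -
      let ?V = "\<Union>(a,b)\<in>C. {a..b}"
      have V: "?V \<in> sets borel" using meas that by blast
      have "E - ?V \<in> null_sets lborel" using that(4) negligible_iff_null_sets_lborel[of "E - ?V"] E(1) V by blast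
      then have "emeasure M (E - ?V) = 0" using that(2)[of "E - ?V"] E(1) V
        by (metis emeasure_lborel_countable le_zero_eq null_setsD1 sets.Diff)
      moreover have "emeasure M E \<le> emeasure M (?V \<union> (E - ?V))" using E(1) V that(1) by (intro emeasure_mono) auto
      ultimately show ?thesis
        using emeasure_subadditive[of ?V M "E - ?V"] E(1) V that(1) by (simp add: sets.Diff)
    qed
    obtain C where C: "countable C" "\<And>a b. (a,b) \<in> C \<Longrightarrow> a < b \<and> slope g a b \<in> {..<p} \<and> {a..b} \<subseteq> U"
      "disjoint_family_on (\<lambda>(a,b). {a..b}) C" "negligible (E - (\<Union>(a,b)\<in>C. {a..b}))"
      using Vitali_covering_intervals[OF U(1,2), of "\<lambda>a b. slope g a b \<in> {..<p}"] interval lo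
      by (metis lessThan_iff)
    obtain D where D: "countable D" "\<And>a b. (a,b) \<in> D \<Longrightarrow> a < b \<and> slope g a b \<in> {q<..} \<and> {a..b} \<subseteq> U"
      "disjoint_family_on (\<lambda>(a,b). {a..b}) D" "negligible (E - (\<Union>(a,b)\<in>D. {a..b}))"
      using Vitali_covering_intervals[OF U(1,2), of "\<lambda>a b. slope g a b \<in> {q<..}"] interval hi
      by (metis greaterThan_iff)
    let ?V = "\<Union>(a,b)\<in>C. {a..b}" and ?W = "\<Union>(a,b)\<in>D. {a..b}"
    have "emeasure \<mu> E \<le> emeasure \<mu> ?V" using cover \<mu> C by blast
    also have "\<dots> \<le> (\<integral>\<^sup>+i. ennreal p * emeasure lborel {fst i..snd i} \<partial>count_space C)"
      unfolding sum_eq[OF \<mu>(1) C(1,3)]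
    proof (intro nn_integral_mono, clarsimp)
      fix a b assume "(a,b) \<in> C"
      then have "a < b" "slope g a b < p" using C(2) by auto
      then have "g b - g a \<le> p * (b - a)" by (simp add: slope_def field_simps)
      then show "emeasure \<mu> {a..b} \<le> ennreal p * emeasure lborel {a..b}"
        using \<open>a < b\<close> \<open>p > 0\<close> by (simp add: \<mu>(2) flip: ennreal_mult)
    qed
    also have "\<dots> = ennreal p * emeasure lborel ?V"
      unfolding sum_eq[OF sets_lborel C(1,3)] by (simp add: nn_integral_cmult)
    also have "\<dots> \<le> ennreal p * emeasure lborel U"
      using C(2) Ub by (intro mult_left_mono emeasure_mono) auto
    also have "\<dots> \<le> ennreal p * (ennreal m + ennreal e)"
      using split[OF sets_lborel] U(3) m(1) by (intro mult_left_mono) (auto intro: order_trans add_left_mono)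
    finally have 1: "emeasure \<mu> E \<le> ennreal p * (ennreal m + ennreal e)" .
    have "ennreal q * ennreal m \<le> ennreal q * emeasure lborel ?W"
      unfolding m(1)[symmetric] using cover[of lborel] D by (intro mult_left_mono) auto
    also have "\<dots> = (\<integral>\<^sup>+i. ennreal q * emeasure lborel {fst i..snd i} \<partial>count_space D)"
      unfolding sum_eq[OF sets_lborel D(1,3)] by (simp add: nn_integral_cmult)
    also have "\<dots> \<le> emeasure \<mu> ?W"
      unfolding sum_eq[OF \<mu>(1) D(1,3)]
    proof (intro nn_integral_mono, clarsimp)
      fix a b assume "(a,b) \<in> D"
      then have "a < b" "q < slope g a b" using D(2) by auto
      then have "q * (b - a) \<le> g b - g a" by (simp add: slope_def field_simps)
      then show "ennreal q * emeasure lborel {a..b} \<le> emeasure \<mu> {a..b}"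
        using \<open>a < b\<close> \<open>q > 0\<close> by (simp add: \<mu>(2) ennreal_leI flip: ennreal_mult)
    qed
    also have "\<dots> \<le> emeasure \<mu> U" using D(2) Ub \<mu>(1) by (intro emeasure_mono) auto
    also have "\<dots> \<le> emeasure \<mu> E + ennreal e"
      using split[OF \<mu>(1)] \<mu>(3)[of "U - E"] U(3) Ub E(1) by (meson add_left_mono order_trans sets.Diff)
    also have "\<dots> \<le> ennreal p * (ennreal m + ennreal e) + ennreal e" using 1 by (rule add_right_mono)
    also have "\<dots> = ennreal (p * (m + e) + e)"
      using \<open>p > 0\<close> \<open>e > 0\<close> m by (simp flip: ennreal_plus ennreal_mult)
    finally have "ennreal (q * m) \<le> ennreal (p * (m + e) + e)"
      using \<open>q > 0\<close> m by (simp add: ennreal_mult)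
    then show ?thesis using \<open>p > 0\<close> \<open>e > 0\<close> m by (simp del: ennreal_plus)
  qed
  have "m = 0"
  proof (rule ccontr)
    assume "m \<noteq> 0"
    with m have "m > 0" by simp
    \<comment> \<open>With this e the total error (p + 1) * e is exactly half of the gap (q - p) * m
      that it would have to exceed.\<close>
    define e where "e = (q - p) * m / (2 * (p + 1))"
    have "e > 0" using \<open>m > 0\<close> \<open>p < q\<close> \<open>p > 0\<close> by (simp add: e_def)
    have "q * m - p * m \<le> (p + 1) * e" using main[OF \<open>e > 0\<close>] by (simp add: algebra_simps)
    also have "\<dots> = (q - p) * m / 2" using \<open>p > 0\<close> by (simp add: e_def field_simps)
    finally have "(q - p) * m \<le> (q - p) * m / 2" by (simp add: algebra_simps)
    moreover have "(q - p) * m > 0" using \<open>m > 0\<close> \<open>p < q\<close> by simp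
    ultimately show False by linarith
  qed
  then show ?thesis using m E(1) by (simp add: null_sets_def)
qed simp

text \<open>The limit is the supremum of the eventual lower bounds. Testing only rational p and q is
  what later makes the exceptional set a countable union.\<close>

lemma real_limit_exists_if_no_gap:
  fixes s :: "'a \<Rightarrow> real"
  assumes F: "F \<noteq> bot" and bd: "\<And>y. lb \<le> s y" "\<And>y. s y \<le> ub"
    and gap: "\<And>p q. p \<in> \<rat> \<Longrightarrow> q \<in> \<rat> \<Longrightarrow> p < q \<Longrightarrow> eventually (\<lambda>y. p \<le> s y) F \<or> eventually (\<lambda>y. s y \<le> q) F"
  shows "\<exists>l. (s \<longlongrightarrow> l) F"
proof -
  define A where "A = {p. eventually (\<lambda>y. p \<le> s y) F}"
  have A: "lb \<in> A" "\<And>p. p \<in> A \<Longrightarrow> p \<le> ub"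
  proof -
    show "lb \<in> A" using bd by (simp add: A_def)
    fix p assume "p \<in> A"
    then have "eventually (\<lambda>y. p \<le> s y) F" by (simp add: A_def)
    then have "eventually (\<lambda>y. p \<le> ub) F" by (rule eventually_mono) (use bd(2) order_trans in blast)
    then show "p \<le> ub" using F by simp
  qed
  have bdd: "bdd_above A" using A(2) by (meson bdd_aboveI)
  have "(s \<longlongrightarrow> Sup A) F"
  proof (rule order_tendstoI)
    fix a assume "a < Sup A"
    then obtain p where "p \<in> A" "a < p" using less_cSup_iff[of A a] A bdd by auto
    then show "eventually (\<lambda>y. a < s y) F" unfolding A_def by (auto elim: eventually_mono)
  next
    fix a assume "Sup A < a"
    obtain p where p: "p \<in> \<rat>" "Sup A < p" "p < a" using Rats_dense_in_real[OF \<open>Sup A < a\<close>] by blast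
    obtain q where q: "q \<in> \<rat>" "p < q" "q < a" using Rats_dense_in_real[OF p(3)] by blast
    have "p \<notin> A" using p bdd cSup_upper[of p A] by auto
    then have "eventually (\<lambda>y. s y \<le> q) F" using gap[OF p(1) q(1,2)] by (auto simp: A_def)
    then show "eventually (\<lambda>y. s y < a) F" using q by (auto elim: eventually_mono)
  qed
  then show ?thesis ..
qed

theorem Lipschitz_differentiable_AE_real:
  fixes g :: "real \<Rightarrow> real"
  assumes lip: "\<And>x y. \<bar>g x - g y\<bar> \<le> L * \<bar>x - y\<bar>"
  obtains N where "N \<in> null_sets lborel" "\<And>x. x \<notin> N \<Longrightarrow> \<exists>D. (g has_real_derivative D) (at x)"
proof -
  define K where "K = \<bar>L\<bar> + 1"
  have K: "K > 0" "\<And>x y. \<bar>g x - g y\<bar> \<le> K * \<bar>x - y\<bar>"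
  proof -
    fix x y
    have "L * \<bar>x - y\<bar> \<le> K * \<bar>x - y\<bar>" unfolding K_def by (intro mult_right_mono) auto
    then show "\<bar>g x - g y\<bar> \<le> K * \<bar>x - y\<bar>" using lip[of x y] by simp
  qed (auto simp: K_def)
  \<comment> \<open>An affine change turns g into a nondecreasing function with slopes between 0 and
    1, as \<open>slope_gap_null\<close> requires. The summand 1 in K only keeps the denominator
    positive.\<close>
  define h where "h x = (g x + K * x) / (2 * K)" for x
  have mono: "h x \<le> h y" if "x \<le> y" for x y
    using K(2)[of x y] that K(1) by (auto simp: h_def algebra_simps intro!: divide_right_mono)
  have hl: "h y - h x \<le> y - x" if "x \<le> y" for x y
  proof -
    have "g y - g x + K * (y - x) \<le> 2 * K * (y - x)" using K(2)[of y x] that by (simp add: algebra_simps)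
    then have "(g y - g x + K * (y - x)) / (2 * K) \<le> y - x" using K(1) by (simp add: field_simps)
    then show ?thesis by (simp add: h_def diff_divide_distrib algebra_simps add_divide_distrib)
  qed
  have cont: "continuous_on UNIV h"
  proof -
    have "1-lipschitz_on UNIV h"
      unfolding lipschitz_on_def dist_real_def using mono hl by (smt (verit) UNIV_I)
    then show ?thesis by (rule lipschitz_on_continuous_on)
  qed
  define S where "S A = {x. \<forall>e>0. \<exists>y. y \<noteq> x \<and> \<bar>y - x\<bar> < e \<and> slope h x y \<in> A}" for A
  \<comment> \<open>Points near which the slopes keep falling below p and rising above q. The ball
    is there because \<open>slope_gap_null\<close> treats bounded sets.\<close>
  define E where "E = (\<lambda>(p,q,n::nat). S {..<p} \<inter> S {q<..} \<inter> ball 0 (real n))"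
  define I where "I = {(p::real,q::real,n::nat). p \<in> \<rat> \<and> q \<in> \<rat> \<and> p < q}"
  have E: "E i \<in> null_sets lborel" if iI: "i \<in> I" for i
  proof -
    obtain p q n where i: "i = (p,q,n)" "p < q" using iI unfolding I_def by (cases i) auto
    have "S {..<p} \<inter> S {q<..} \<inter> ball 0 (real n) \<in> null_sets lborel"
    proof (rule slope_gap_null[OF mono hl i(2)])
      show "S {..<p} \<inter> S {q<..} \<inter> ball 0 (real n) \<in> sets borel"
        unfolding S_def by (intro sets.Int borel_slopes cont) auto
      show "bounded (S {..<p} \<inter> S {q<..} \<inter> ball 0 (real n))" by (meson bounded_Int bounded_ball)
    qed (auto simp: S_def)
    then show ?thesis by (simp add: i E_def)
  qed
  have "countable (\<rat> \<times> \<rat> \<times> (UNIV::nat set) :: (real\<times>real\<times>nat) set)" by (simp add: countable_rat)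
  then have "countable I" by (rule countable_subset[rotated]) (auto simp: I_def)
  then have N: "(\<Union>i\<in>I. E i) \<in> null_sets lborel" using E by (intro null_sets_UN') auto
  have "\<exists>D. (g has_real_derivative D) (at x)" if x: "x \<notin> (\<Union>i\<in>I. E i)" for x
  proof -
    have sl: "0 \<le> slope h x y" "slope h x y \<le> 1" for y
    proof -
      have "0 \<le> slope h x y \<and> slope h x y \<le> 1" if "x \<le> y" for x y
        using mono[OF that] hl[OF that] that by (cases "x = y") (auto simp: slope_def field_simps)
      then show "0 \<le> slope h x y" "slope h x y \<le> 1" by (metis slope_commute linear)+
    qed
    have "\<exists>l. (slope h x \<longlongrightarrow> l) (at x)"
    proof (rule real_limit_exists_if_no_gap)
      fix p q :: real assume pq: "p \<in> \<rat>" "q \<in> \<rat>" "p < q"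
      obtain n where n: "\<bar>x\<bar> < real n" using reals_Archimedean2 by blast
      have "(p,q,n) \<in> I" using pq by (simp add: I_def)
      then have "x \<notin> S {..<p} \<or> x \<notin> S {q<..}" using x n by (force simp: E_def)
      then show "eventually (\<lambda>y. p \<le> slope h x y) (at x) \<or> eventually (\<lambda>y. slope h x y \<le> q) (at x)"
      proof
        assume "x \<notin> S {..<p}"
        then obtain e where "e > 0" "\<And>y. y \<noteq> x \<Longrightarrow> \<bar>y - x\<bar> < e \<Longrightarrow> \<not> slope h x y < p" unfolding S_def by auto
        then have "eventually (\<lambda>y. p \<le> slope h x y) (at x)"
          unfolding eventually_at dist_real_def by (intro exI[of _ e]) (auto simp: not_less)
        then show ?thesis ..
      next
        assume "x \<notin> S {q<..}"
        then obtain e where "e > 0" "\<And>y. y \<noteq> x \<Longrightarrow> \<bar>y - x\<bar> < e \<Longrightarrow> \<not> q < slope h x y" unfolding S_def by auto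
        then have "eventually (\<lambda>y. slope h x y \<le> q) (at x)"
          unfolding eventually_at dist_real_def by (intro exI[of _ e]) (auto simp: not_less)
        then show ?thesis ..
      qed
    qed (use sl in auto)
    then obtain l where "(slope h x \<longlongrightarrow> l) (at x)" ..
    then have "(h has_real_derivative l) (at x)" by (simp add: has_field_derivative_iff slope_def[abs_def])
    then have "((\<lambda>x. 2 * K * h x - K * x) has_real_derivative 2 * K * l - K) (at x)"
      by (auto intro!: derivative_eq_intros)
    moreover have "(\<lambda>x. 2 * K * h x - K * x) = g" using K(1) by (auto simp: h_def)
    ultimately show ?thesis by auto
  qed
  then show thesis using that[OF N] by blast
qed

section \<open>Rademacher's theorem\<close>

text \<open>The scales \<open>inverse (real (Suc n))\<close> stand for all small scales, so that for
  continuous f and open S this is visibly a countable intersection of open sets. Measurability is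
  needed for Fubini below.\<close>

definition ddgap :: "('a::euclidean_space \<Rightarrow> real) \<Rightarrow> 'a \<Rightarrow> real set \<Rightarrow> 'a set" where
  "ddgap f h S = {x. \<forall>n::nat. \<exists>t. t \<noteq> 0 \<and> \<bar>t\<bar> < inverse (real (Suc n)) \<and> (f (x + t *\<^sub>R h) - f x) / t \<in> S}"

lemma borel_ddgap:
  assumes "continuous_on UNIV f" "open S"
  shows "ddgap f h S \<in> sets borel"
proof -
  have "open {x. (f (x + t *\<^sub>R h) - f x) / t \<in> S}" for t
  proof -
    have "continuous_on UNIV (\<lambda>x. (f (x + t *\<^sub>R h) - f x) / t)"
      unfolding divide_inverse
      by (intro continuous_intros continuous_on_compose2[OF assms(1)] assms(1)) auto
    then have "open ((\<lambda>x. (f (x + t *\<^sub>R h) - f x) / t) -` S)"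
      using assms(2) by (rule open_vimage[rotated])
    then show ?thesis by (simp add: vimage_def)
  qed
  then have "open (\<Union>t\<in>{t. t \<noteq> 0 \<and> \<bar>t\<bar> < inverse (real (Suc n))}. {x. (f (x + t *\<^sub>R h) - f x) / t \<in> S})" for n :: nat
    by (intro open_UN) auto
  moreover have "ddgap f h S = (\<Inter>n::nat. \<Union>t\<in>{t. t \<noteq> 0 \<and> \<bar>t\<bar> < inverse (real (Suc n))}. {x. (f (x + t *\<^sub>R h) - f x) / t \<in> S})"
    unfolding ddgap_def by auto
  ultimately show ?thesis by (auto intro!: sets.countable_INT'' borel_open)
qed

lemma nn_integral_lborel_translate:
  fixes f :: "'a::euclidean_space \<Rightarrow> ennreal"
  assumes [measurable]: "f \<in> borel_measurable borel"
  shows "(\<integral>\<^sup>+x. f (c + x) \<partial>lborel) = (\<integral>\<^sup>+x. f x \<partial>lborel)"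
proof -
  have "(\<integral>\<^sup>+x. f x \<partial>lborel) = (\<integral>\<^sup>+x. f x \<partial>distr lborel borel ((+) c))" by (simp add: lborel_distr_plus)
  also have "\<dots> = (\<integral>\<^sup>+x. f (c + x) \<partial>lborel)" by (subst nn_integral_distr) auto
  finally show ?thesis by simp
qed

text \<open>Fubini applied to the points x + s h with s in [0,1]. By translation invariance the
  integral over x is the measure of A for every such s, so no rotation of coordinates towards h is
  required.\<close>

lemma null_set_if_lines_null:
  fixes A :: "'a::euclidean_space set"
  assumes A[measurable]: "A \<in> sets borel"
    and null: "\<And>x. {s::real. x + s *\<^sub>R h \<in> A} \<in> null_sets lborel"
  shows "A \<in> null_sets lborel"
proof -
  let ?F = "\<lambda>x (s::real). indicator A (x + s *\<^sub>R h) * indicator {0..1} s :: ennreal"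
  have [measurable]: "(\<lambda>p. fst p + snd p *\<^sub>R h) \<in> borel_measurable (borel \<Otimes>\<^sub>M (borel::real measure))"
    by simp
  have Fub: "(\<integral>\<^sup>+s. (\<integral>\<^sup>+x. ?F x s \<partial>lborel) \<partial>lborel) = (\<integral>\<^sup>+x. (\<integral>\<^sup>+s. ?F x s \<partial>lborel) \<partial>lborel)"
    by (rule lborel_pair.Fubini') (simp add: case_prod_unfold)
  have "(\<integral>\<^sup>+s. ?F x s \<partial>lborel) = 0" for x
  proof -
    have "AE s in lborel. s \<notin> {s. x + s *\<^sub>R h \<in> A}" using null[of x] by (rule AE_not_in)
    then have "AE s in lborel. ?F x s = 0" by eventually_elim (auto simp: indicator_def)
    then show ?thesis by (subst nn_integral_0_iff_AE) auto
  qed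
  then have "(\<integral>\<^sup>+s. (\<integral>\<^sup>+x. ?F x s \<partial>lborel) \<partial>lborel) = 0" unfolding Fub by simp
  moreover have "(\<integral>\<^sup>+x. ?F x s \<partial>lborel) = emeasure lborel A * indicator {0..1} s" for s
  proof -
    have "(\<integral>\<^sup>+x. ?F x s \<partial>lborel) = (\<integral>\<^sup>+x. indicator A (s *\<^sub>R h + x) \<partial>lborel) * indicator {0..1} s"
      by (subst nn_integral_multc) (auto simp: add.commute)
    also have "(\<integral>\<^sup>+x. indicator A (s *\<^sub>R h + x) \<partial>lborel) = (\<integral>\<^sup>+x. indicator A x \<partial>lborel)"
      by (rule nn_integral_lborel_translate) simp
    finally show ?thesis by simp
  qed
  ultimately have "emeasure lborel A = 0" by (simp add: nn_integral_cmult)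
  then show ?thesis using A by (simp add: null_sets_def)
qed

text \<open>The one-dimensional theorem applies on every line parallel to h, and Fubini assembles
  the lines. The exceptional set is written with \<open>ddgap\<close> over rational pairs because it
  has to be Borel.\<close>

lemma directional_derivative_AE:
  fixes f :: "'a::euclidean_space \<Rightarrow> real"
  assumes "L-lipschitz_on UNIV f"
  obtains N where "N \<in> null_sets lborel"
    "\<And>x. x \<notin> N \<Longrightarrow> \<exists>D. ((\<lambda>t. (f (x + t *\<^sub>R h) - f x) / t) \<longlongrightarrow> D) (at 0)"
proof -
  have cont: "continuous_on UNIV f" using assms by (rule lipschitz_on_continuous_on)
  have L: "L \<ge> 0" using assms by (rule lipschitz_on_nonneg)
  have lip: "\<bar>f x - f y\<bar> \<le> L * norm (x - y)" for x y
    using lipschitz_onD[OF assms, of x y] by (simp add: dist_norm)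
  define I where "I = {(p::real,q::real). p \<in> \<rat> \<and> q \<in> \<rat> \<and> p < q}"
  have "countable (\<rat> \<times> \<rat> :: (real\<times>real) set)" by (simp add: countable_rat)
  then have I: "countable I" by (rule countable_subset[rotated]) (auto simp: I_def)
  define N where "N = (\<Union>(p,q)\<in>I. ddgap f h {..<p} \<inter> ddgap f h {q<..})"
  have Nb: "N \<in> sets borel"
    unfolding N_def using I borel_ddgap[OF cont] by (intro sets.countable_UN') (auto simp: case_prod_unfold)
  have limit: "\<exists>D. ((\<lambda>t. (f (x + t *\<^sub>R h) - f x) / t) \<longlongrightarrow> D) (at 0)" if x: "x \<notin> N" for x
  proof (rule real_limit_exists_if_no_gap)
    have bd: "\<bar>(f (x + t *\<^sub>R h) - f x) / t\<bar> \<le> L * norm h" for t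
    proof (cases "t = 0")
      case False
      have "\<bar>f (x + t *\<^sub>R h) - f x\<bar> \<le> L * (\<bar>t\<bar> * norm h)"
        using lip[of "x + t *\<^sub>R h" x] by simp
      then show ?thesis using False by (simp add: abs_divide field_simps)
    qed (use L in simp)
    show "- (L * norm h) \<le> (f (x + t *\<^sub>R h) - f x) / t" "(f (x + t *\<^sub>R h) - f x) / t \<le> L * norm h" for t
      using bd[of t] by linarith+
    fix p q :: real assume pq: "p \<in> \<rat>" "q \<in> \<rat>" "p < q"
    then have "x \<notin> ddgap f h {..<p} \<or> x \<notin> ddgap f h {q<..}" using x unfolding N_def I_def by blast
    moreover have ev: "eventually (\<lambda>t. (f (x + t *\<^sub>R h) - f x) / t \<notin> S) (at 0)" if "x \<notin> ddgap f h S" for S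
    proof -
      from that obtain n :: nat where "\<And>t. t \<noteq> 0 \<Longrightarrow> \<bar>t\<bar> < inverse (real (Suc n)) \<Longrightarrow> (f (x + t *\<^sub>R h) - f x) / t \<notin> S"
        unfolding ddgap_def by auto
      then show ?thesis unfolding eventually_at by (intro exI[of _ "inverse (real (Suc n))"]) simp
    qed
    ultimately show "eventually (\<lambda>t. p \<le> (f (x + t *\<^sub>R h) - f x) / t) (at 0) \<or> eventually (\<lambda>t. (f (x + t *\<^sub>R h) - f x) / t \<le> q) (at 0)"
      using ev[of "{..<p}"] ev[of "{q<..}"] by (auto simp: not_less)
  qed simp
  \<comment> \<open>The converse of \<open>limit\<close>. It shows that a point of N on a line is a
    point where the restriction of f to that line has no derivative, so that N meets each line in a
    null set.\<close>
  have nolim: "x \<notin> N" if "((\<lambda>t. (f (x + t *\<^sub>R h) - f x) / t) \<longlongrightarrow> D) (at 0)" for x D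
  proof
    assume "x \<in> N"
    then obtain p q where pq: "p < q" "x \<in> ddgap f h {..<p}" "x \<in> ddgap f h {q<..}" unfolding N_def I_def by auto
    have fr: "\<not> eventually (\<lambda>t. (f (x + t *\<^sub>R h) - f x) / t \<notin> S) (at 0)" if "x \<in> ddgap f h S" for S
    proof
      assume "eventually (\<lambda>t. (f (x + t *\<^sub>R h) - f x) / t \<notin> S) (at 0)"
      then obtain d where d: "d > 0" "\<And>t. t \<noteq> 0 \<Longrightarrow> \<bar>t\<bar> < d \<Longrightarrow> (f (x + t *\<^sub>R h) - f x) / t \<notin> S"
        unfolding eventually_at by auto
      obtain n where n: "inverse (real (Suc n)) < d" using reals_Archimedean[OF d(1)] by blast
      have "\<exists>t. t \<noteq> 0 \<and> \<bar>t\<bar> < inverse (real (Suc n)) \<and> (f (x + t *\<^sub>R h) - f x) / t \<in> S"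
        using that unfolding ddgap_def mem_Collect_eq by (rule spec)
      then obtain t where "t \<noteq> 0" "\<bar>t\<bar> < inverse (real (Suc n))" "(f (x + t *\<^sub>R h) - f x) / t \<in> S"
        by (elim exE conjE)
      then show False using d(2)[of t] n by simp
    qed
    show False
    proof (cases "D < q")
      case True
      have "eventually (\<lambda>t. (f (x + t *\<^sub>R h) - f x) / t \<notin> {q<..}) (at 0)"
        using order_tendstoD(2)[OF that True] by (rule eventually_mono) simp
      then show False using fr pq by blast
    next
      case False
      then have "p < D" using pq by simp
      have "eventually (\<lambda>t. (f (x + t *\<^sub>R h) - f x) / t \<notin> {..<p}) (at 0)"
        using order_tendstoD(1)[OF that \<open>p < D\<close>] by (rule eventually_mono) simp
      then show False using fr pq by blast
    qed
  qed
  have "N \<in> null_sets lborel"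
  proof (rule null_set_if_lines_null[OF Nb])
    fix x
    define g where "g s = f (x + s *\<^sub>R h)" for s
    have g: "\<bar>g s - g t\<bar> \<le> (L * norm h) * \<bar>s - t\<bar>" for s t
      using lip[of "x + s *\<^sub>R h" "x + t *\<^sub>R h"] by (simp add: g_def mult_ac flip: scaleR_diff_left)
    obtain M where M: "M \<in> null_sets lborel" "\<And>s. s \<notin> M \<Longrightarrow> \<exists>D. (g has_real_derivative D) (at s)"
      by (rule Lipschitz_differentiable_AE_real[OF g]) (rule that)
    have "{s. x + s *\<^sub>R h \<in> N} \<subseteq> M"
    proof (rule ccontr)
      assume "\<not> ?thesis"
      then obtain s where s: "x + s *\<^sub>R h \<in> N" "s \<notin> M" by blast
      then obtain D where "(g has_real_derivative D) (at s)" using M by blast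
      then have "((\<lambda>t. (f ((x + s *\<^sub>R h) + t *\<^sub>R h) - f (x + s *\<^sub>R h)) / t) \<longlongrightarrow> D) (at 0)"
        by (simp add: DERIV_def g_def scaleR_add_left add.assoc)
      then show False using nolim s by blast
    qed
    moreover have "{s. x + s *\<^sub>R h \<in> N} \<in> sets lborel"
    proof -
      have "(\<lambda>s::real. x + s *\<^sub>R h) \<in> borel_measurable borel" by simp
      then have "(\<lambda>s::real. x + s *\<^sub>R h) -` N \<inter> space borel \<in> sets borel" using Nb by (rule measurable_sets)
      then show ?thesis by (simp add: vimage_def)
    qed
    ultimately show "{s. x + s *\<^sub>R h \<in> N} \<in> null_sets lborel" 
      by (intro null_sets_subset[OF M(1)])
  qed
  then show thesis using limit by (rule that)
qed

section \<open>Differentiable cut-off functions for boxes\<close>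

definition bump :: "real \<Rightarrow> real" where
  "bump s = (if s \<le> 0 then 0 else s\<^sup>2 / (1 + s\<^sup>2))"

lemma bump_nonneg: "0 \<le> bump s" and bump_le_1: "bump s \<le> 1"
  by (auto simp: bump_def divide_le_eq add_pos_nonneg)

lemma bump_lipschitz: "\<bar>bump s - bump t\<bar> \<le> \<bar>s - t\<bar>"
proof -
  have *: "\<bar>bump s - bump t\<bar> \<le> \<bar>s - t\<bar>" if "t \<le> s" for s t
  proof -
    consider "s \<le> 0" | "t \<le> 0" "0 < s" | "0 < t" using that by linarith
    then show ?thesis
    proof cases
      case 1 then show ?thesis using that by (simp add: bump_def)
    next
      case 2
      have "s * s \<le> s * (1 + s\<^sup>2)"
      proof (rule mult_left_mono)
        have "0 \<le> (s - 1)\<^sup>2" by simp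
        then show "s \<le> 1 + s\<^sup>2" using 2 by (simp add: power2_eq_square algebra_simps)
      qed (use 2 in simp)
      moreover have "1 + s\<^sup>2 > 0" by (simp add: add_pos_nonneg)
      ultimately have "s\<^sup>2 / (1 + s\<^sup>2) \<le> s" by (simp add: power2_eq_square divide_le_eq)
      then show ?thesis using 2 by (simp add: bump_def)
    next
      case 3
      have p: "1 + s\<^sup>2 > 0" "1 + t\<^sup>2 > 0" by (simp_all add: add_pos_nonneg)
      have "bump s - bump t = (s - t) * ((s + t) / ((1 + s\<^sup>2) * (1 + t\<^sup>2)))"
        using 3 that p by (simp add: bump_def field_simps power2_eq_square)
      moreover have "(s + t) / ((1 + s\<^sup>2) * (1 + t\<^sup>2)) \<le> 1"
      proof -
        have "0 \<le> (s - 1)\<^sup>2 + (t - 1)\<^sup>2 + s\<^sup>2 + t\<^sup>2" by simp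
        then have "s + t \<le> 1 + s\<^sup>2 + t\<^sup>2" by (simp add: power2_eq_square algebra_simps)
        also have "\<dots> \<le> (1 + s\<^sup>2) * (1 + t\<^sup>2)" by (simp add: algebra_simps)
        finally show ?thesis using p by (simp add: divide_le_eq)
      qed
      moreover have "0 \<le> (s + t) / ((1 + s\<^sup>2) * (1 + t\<^sup>2))" using 3 that p by simp
      ultimately show ?thesis using that mult_left_mono[of "(s + t) / ((1 + s\<^sup>2) * (1 + t\<^sup>2))" 1 "s - t"]
        by (simp only: abs_mult abs_of_nonneg diff_ge_0_iff_ge) simp
    qed
  qed
  show ?thesis using *[of s t] *[of t s] by (cases "t \<le> s") (auto simp: abs_minus_commute)
qed

lemma bump_differentiable: "bump differentiable (at s)"
proof -
  have *: "1 + x\<^sup>2 \<noteq> 0" for x :: real by (metis add_pos_nonneg less_irrefl zero_le_power2 zero_less_one)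
  consider "s < 0" | "s = 0" | "s > 0" by linarith
  then show ?thesis
  proof cases
    case 1
    have "((\<lambda>_. 0) has_real_derivative 0) (at s)" by simp
    then have "(bump has_real_derivative 0) (at s)"
      by (rule DERIV_cong_ev[OF refl _ refl, THEN iffD1, rotated])
         (use 1 in \<open>auto simp: eventually_nhds bump_def intro!: exI[of _ "{..<0}"]\<close>)
    then show ?thesis using real_differentiable_def by blast
  next
    case 3
    have "((\<lambda>s. s\<^sup>2 / (1 + s\<^sup>2)) has_real_derivative ((2 * s) * (1 + s\<^sup>2) - s\<^sup>2 * (2 * s)) / ((1 + s\<^sup>2) * (1 + s\<^sup>2))) (at s)"
      using * by (auto intro!: derivative_eq_intros)
    then have "(bump has_real_derivative ((2 * s) * (1 + s\<^sup>2) - s\<^sup>2 * (2 * s)) / ((1 + s\<^sup>2) * (1 + s\<^sup>2))) (at s)"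
      by (rule DERIV_cong_ev[OF refl _ refl, THEN iffD1, rotated])
         (use 3 in \<open>auto simp: eventually_nhds bump_def intro!: exI[of _ "{0<..}"]\<close>)
    then show ?thesis using real_differentiable_def by blast
  next
    case 2
    have "((\<lambda>h. (bump (0 + h) - bump 0) / h) \<longlongrightarrow> 0) (at 0)"
    proof (rule Lim_null_comparison)
      show "\<forall>\<^sub>F h in at 0. norm ((bump (0 + h) - bump 0) / h) \<le> \<bar>h\<bar>"
        unfolding real_norm_def
      proof (intro always_eventually allI)
        fix h :: real
        have "bump h \<le> h\<^sup>2" using mult_left_mono[of 1 "1 + h\<^sup>2" "h\<^sup>2"]
          by (auto simp: bump_def divide_le_eq add_pos_nonneg)
        then have "\<bar>bump h\<bar> \<le> \<bar>h\<bar> * \<bar>h\<bar>" using bump_nonneg[of h] by (simp add: power2_eq_square)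
        then show "\<bar>(bump (0 + h) - bump 0) / h\<bar> \<le> \<bar>h\<bar>"
          by (cases "h = 0") (simp_all add: bump_def[of 0] abs_divide divide_le_eq)
      qed
      show "((\<lambda>h. \<bar>h\<bar>) \<longlongrightarrow> 0) (at (0::real))" by (rule tendsto_rabs_zero) (rule tendsto_ident_at)
    qed
    then have "(bump has_real_derivative 0) (at 0)" by (simp add: DERIV_def)
    then show ?thesis using 2 real_differentiable_def by blast
  qed
qed

lemma bump_tendsto_1: "s > 0 \<Longrightarrow> (\<lambda>k. bump (real k * s)) \<longlonglongrightarrow> 1"
proof -
  assume s: "s > 0"
  have lim: "((\<lambda>t::real. t\<^sup>2 / (1 + t\<^sup>2)) \<longlongrightarrow> 1) at_top" by real_asymp
  have top: "filterlim (\<lambda>k. real k * s) at_top sequentially"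
    using s by (intro filterlim_at_top_mult_tendsto_pos[OF tendsto_const] filterlim_real_sequentially)
  have "(\<lambda>k. (real k * s)\<^sup>2 / (1 + (real k * s)\<^sup>2)) \<longlonglongrightarrow> 1"
    using filterlim_compose[OF lim top] by simp
  moreover have "bump (real k * s) = (real k * s)\<^sup>2 / (1 + (real k * s)\<^sup>2)" for k
    using s by (cases k) (auto simp: bump_def mult_le_0_iff)
  ultimately show ?thesis by simp
qed

text \<open>The test functions of the weak identity: differentiable, Lipschitz, zero off the box,
  and converging pointwise to its indicator as k grows, since inside the box all arguments of
  \<open>bump\<close> tend to infinity.\<close>

definition box_bump :: "'a::euclidean_space \<Rightarrow> 'a \<Rightarrow> nat \<Rightarrow> 'a \<Rightarrow> real" where
  "box_bump l u k x = (\<Prod>b\<in>Basis. bump (real k * (x \<bullet> b - l \<bullet> b)) * bump (real k * (u \<bullet> b - x \<bullet> b)))"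

lemma box_bump_nonneg: "0 \<le> box_bump l u k x" and box_bump_le_1: "box_bump l u k x \<le> 1"
  unfolding box_bump_def
  by (auto intro!: prod_nonneg prod_le_1 mult_le_one simp: bump_nonneg bump_le_1)

lemma box_bump_outside: "x \<notin> box l u \<Longrightarrow> box_bump l u k x = 0"
proof -
  assume "x \<notin> box l u"
  then obtain b where b: "b \<in> Basis" "x \<bullet> b \<le> l \<bullet> b \<or> u \<bullet> b \<le> x \<bullet> b" by (auto simp: mem_box not_less)
  then have "bump (real k * (x \<bullet> b - l \<bullet> b)) * bump (real k * (u \<bullet> b - x \<bullet> b)) = 0"
    by (auto simp: bump_def mult_le_0_iff)
  then show ?thesis unfolding box_bump_def using b by (auto simp: prod_zero_iff)
qed

lemma box_bump_tendsto: "(\<lambda>k. box_bump l u k x) \<longlonglongrightarrow> indicator (box l u) x"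
  for x :: "'a::euclidean_space"
proof (cases "x \<in> box l u")
  case True
  have "(\<lambda>k. bump (real k * (x \<bullet> b - l \<bullet> b)) * bump (real k * (u \<bullet> b - x \<bullet> b))) \<longlonglongrightarrow> 1 * 1"
    if "b \<in> Basis" for b
    using True that by (intro tendsto_mult bump_tendsto_1) (auto simp: mem_box)
  then have "(\<lambda>k. box_bump l u k x) \<longlonglongrightarrow> (\<Prod>b\<in>(Basis::'a set). 1 * 1)"
    unfolding box_bump_def by (rule tendsto_prod)
  then show ?thesis using True by simp
qed (simp add: box_bump_outside)

lemma box_bump_lipschitz: "\<exists>C. C-lipschitz_on UNIV (box_bump l u k)"
proof -
  have 1: "\<bar>bump (real k * (x \<bullet> b - l \<bullet> b)) - bump (real k * (y \<bullet> b - l \<bullet> b))\<bar> \<le> real k * norm (x - y)"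
     "\<bar>bump (real k * (u \<bullet> b - x \<bullet> b)) - bump (real k * (u \<bullet> b - y \<bullet> b))\<bar> \<le> real k * norm (x - y)"
    if "b \<in> Basis" for x y b :: 'a
  proof -
    have "real k * \<bar>(x - y) \<bullet> b\<bar> \<le> real k * norm (x - y)"
      using that by (intro mult_left_mono Basis_le_norm) auto
    moreover have "\<bar>real k * (x \<bullet> b - l \<bullet> b) - real k * (y \<bullet> b - l \<bullet> b)\<bar> = real k * \<bar>(x - y) \<bullet> b\<bar>"
      "\<bar>real k * (u \<bullet> b - x \<bullet> b) - real k * (u \<bullet> b - y \<bullet> b)\<bar> = real k * \<bar>(x - y) \<bullet> b\<bar>"
      by (simp_all add: inner_diff_left abs_mult abs_minus_commute flip: right_diff_distrib)
    ultimately show "\<bar>bump (real k * (x \<bullet> b - l \<bullet> b)) - bump (real k * (y \<bullet> b - l \<bullet> b))\<bar> \<le> real k * norm (x - y)"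
     "\<bar>bump (real k * (u \<bullet> b - x \<bullet> b)) - bump (real k * (u \<bullet> b - y \<bullet> b))\<bar> \<le> real k * norm (x - y)"
      using bump_lipschitz order_trans by metis+
  qed
  have 2: "\<bar>a * b - c * d\<bar> \<le> \<bar>a - c\<bar> + \<bar>b - d\<bar>" if "\<bar>b\<bar> \<le> 1" "\<bar>c\<bar> \<le> 1" for a b c d :: real
  proof -
    have "a * b - c * d = (a - c) * b + c * (b - d)" by (simp add: algebra_simps)
    then have "\<bar>a * b - c * d\<bar> \<le> \<bar>a - c\<bar> * \<bar>b\<bar> + \<bar>c\<bar> * \<bar>b - d\<bar>" by (metis abs_mult abs_triangle_ineq)
    also have "\<dots> \<le> \<bar>a - c\<bar> * 1 + 1 * \<bar>b - d\<bar>" using that by (intro add_mono mult_mono) auto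
    finally show ?thesis by simp
  qed
  have "(2 * real k * real DIM('a))-lipschitz_on UNIV (box_bump l u k)"
  proof (rule lipschitz_onI)
    fix x y :: 'a
    have "norm (box_bump l u k x - box_bump l u k y) \<le>
      (\<Sum>b\<in>Basis. norm (bump (real k * (x \<bullet> b - l \<bullet> b)) * bump (real k * (u \<bullet> b - x \<bullet> b))
         - bump (real k * (y \<bullet> b - l \<bullet> b)) * bump (real k * (u \<bullet> b - y \<bullet> b))))"
      unfolding box_bump_def
      by (intro norm_prod_diff) (auto simp: abs_mult bump_nonneg bump_le_1 intro!: mult_le_one)
    also have "\<dots> \<le> (\<Sum>b\<in>(Basis::'a set). real k * norm (x - y) + real k * norm (x - y))"
    proof (intro sum_mono)
      fix b :: 'a assume "b \<in> Basis"
      then show "norm (bump (real k * (x \<bullet> b - l \<bullet> b)) * bump (real k * (u \<bullet> b - x \<bullet> b))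
         - bump (real k * (y \<bullet> b - l \<bullet> b)) * bump (real k * (u \<bullet> b - y \<bullet> b))) \<le> real k * norm (x - y) + real k * norm (x - y)"
        unfolding real_norm_def
        by (intro order_trans[OF 2 add_mono] 1) (auto simp: bump_nonneg bump_le_1)
    qed
    also have "\<dots> = 2 * real k * real DIM('a) * norm (x - y)" by simp
    finally show "dist (box_bump l u k x) (box_bump l u k y) \<le> 2 * real k * real DIM('a) * dist x y"
      by (simp add: dist_norm)
  qed simp
  then show ?thesis ..
qed

lemma box_bump_differentiable: "box_bump l u k differentiable (at x)"
proof -
  have d: "(\<lambda>x. bump (real k * (x \<bullet> b - l \<bullet> b)) * bump (real k * (u \<bullet> b - x \<bullet> b))) differentiable (at x)" for b
  proof (rule differentiable_mult)
    show "(\<lambda>x. bump (real k * (x \<bullet> b - l \<bullet> b))) differentiable (at x)"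
      by (rule differentiable_compose[of bump]) (auto simp: bump_differentiable intro!: derivative_intros)
    show "(\<lambda>x. bump (real k * (u \<bullet> b - x \<bullet> b))) differentiable (at x)"
      by (rule differentiable_compose[of bump]) (auto simp: bump_differentiable intro!: derivative_intros)
  qed
  have "(\<lambda>x. \<Prod>b\<in>B. bump (real k * (x \<bullet> b - l \<bullet> b)) * bump (real k * (u \<bullet> b - x \<bullet> b))) differentiable (at x)"
    if "finite B" for B
    using that
  proof (induction B rule: finite_induct)
    case (insert b B)
    then show ?case using d[of b] by (simp add: differentiable_mult)
  qed simp
  then show ?thesis unfolding box_bump_def[abs_def] by simp
qed

text \<open>After scaling, 1 + G/K is a nonnegative density whose measure agrees with Lebesgue
  measure on boxes. Uniqueness of Lebesgue measure and of densities then gives 1 + G/K = 1 almost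
  everywhere.\<close>

lemma AE_zero_if_box_integrals_zero:
  fixes G :: "'a::euclidean_space \<Rightarrow> real"
  assumes [measurable]: "G \<in> borel_measurable borel" and bd: "\<And>x. \<bar>G x\<bar> \<le> M"
    and zero: "\<And>l u. (\<integral>x. G x * indicator (box l u) x \<partial>lborel) = 0"
  shows "AE x in lborel. G x = 0"
proof -
  define K where "K = \<bar>M\<bar> + 1"
  have K: "K > 0" "\<And>x. \<bar>G x / K\<bar> \<le> 1"
  proof -
    show "K > 0" by (simp add: K_def)
    fix x show "\<bar>G x / K\<bar> \<le> 1" using bd[of x] by (auto simp: K_def abs_divide divide_le_eq)
  qed
  have w: "0 \<le> 1 + G x / K" for x using K(2)[of x] by linarith
  define P where "P = density lborel (\<lambda>x. ennreal (1 + G x / K))"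
  have "lborel = P"
  proof (rule lborel_eqI)
    show "sets P = sets borel" by (simp add: P_def)
    fix l u :: 'a assume lu: "\<And>b. b \<in> Basis \<Longrightarrow> l \<bullet> b \<le> u \<bullet> b"
    have i1: "integrable lborel (indicator (box l u) :: 'a \<Rightarrow> real)"
      using emeasure_bounded_finite[OF bounded_box, of l u] by (simp add: integrable_indicator_iff)
    have i2: "integrable lborel (\<lambda>x. G x * indicator (box l u) x)"
    proof (rule Bochner_Integration.integrable_bound[OF integrable_mult_right[OF i1, of M]])
      show "AE x in lborel. norm (G x * indicator (box l u) x) \<le> norm (M * indicator (box l u) x)"
        using order_trans[OF bd abs_ge_self] by (intro AE_I2) (simp add: indicator_def)
    qed simp
    have int: "integrable lborel (\<lambda>x. indicator (box l u) x + (G x * indicator (box l u) x) / K)"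
      using i1 i2 by auto
    have "emeasure P (box l u) = (\<integral>\<^sup>+x. ennreal (1 + G x / K) * indicator (box l u) x \<partial>lborel)"
      unfolding P_def by (subst emeasure_density) auto
    also have "\<dots> = (\<integral>\<^sup>+x. ennreal (indicator (box l u) x + (G x * indicator (box l u) x) / K) \<partial>lborel)"
      by (intro nn_integral_cong) (auto simp: indicator_def)
    also have "\<dots> = ennreal (\<integral>x. (indicator (box l u) x + (G x * indicator (box l u) x) / K) \<partial>lborel)"
      using int w by (intro nn_integral_eq_integral) (auto simp: indicator_def)
    also have "(\<integral>x. (indicator (box l u) x + (G x * indicator (box l u) x) / K) \<partial>lborel) = measure lborel (box l u)"
      using i1 i2 zero[of l u] by (subst Bochner_Integration.integral_add) auto
    also have "ennreal (measure lborel (box l u)) = (\<Prod>b\<in>Basis. (u - l) \<bullet> b)"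
      using lu by (simp add: measure_lborel_box_eq)
    finally show "emeasure P (box l u) = (\<Prod>b\<in>Basis. (u - l) \<bullet> b)" .
  qed
  then have "density lborel (\<lambda>x. ennreal (1 + G x / K)) = density lborel (\<lambda>x. 1)"
    by (simp add: P_def density_1)
  then have "AE x in lborel. ennreal (1 + G x / K) = 1"
    by (intro sigma_finite_measure.density_unique[OF lborel.sigma_finite_measure_axioms]) auto
  then show ?thesis
  proof eventually_elim
    case (elim x)
    then have "1 + G x / K = 1" by simp
    then show "G x = 0" using K by simp
  qed
qed

section \<open>Weak directional derivatives of Lipschitz functions\<close>

lemma integral_lborel_translate:
  fixes f :: "'a::euclidean_space \<Rightarrow> real"
  assumes [measurable]: "f \<in> borel_measurable borel"
  shows "(\<integral>x. f (c + x) \<partial>lborel) = (\<integral>x. f x \<partial>lborel)"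
    and "integrable lborel (\<lambda>x. f (c + x)) \<longleftrightarrow> integrable lborel f"
proof -
  have "(\<integral>x. f x \<partial>lborel) = (\<integral>x. f x \<partial>distr lborel borel ((+) c))" by (simp add: lborel_distr_plus)
  also have "\<dots> = (\<integral>x. f (c + x) \<partial>lborel)" by (subst integral_distr) auto
  finally show "(\<integral>x. f (c + x) \<partial>lborel) = (\<integral>x. f x \<partial>lborel)" by simp
  have "integrable lborel f \<longleftrightarrow> integrable (distr lborel borel ((+) c)) f" by (simp add: lborel_distr_plus)
  also have "\<dots> \<longleftrightarrow> integrable lborel (\<lambda>x. f (c + x))" by (subst integrable_distr_eq) auto
  finally show "integrable lborel (\<lambda>x. f (c + x)) \<longleftrightarrow> integrable lborel f" by simp
qed

lemma integrable_continuous_compact_support: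
  fixes f :: "'a::euclidean_space \<Rightarrow> real"
  assumes "continuous_on UNIV f" "\<And>x. x \<notin> cball 0 r \<Longrightarrow> f x = 0"
  shows "integrable lborel f"
proof -
  have "integrable lborel (\<lambda>x. indicator (cball 0 r) x *\<^sub>R f x)"
    by (rule borel_integrable_compact) (use assms(1) continuous_on_subset in auto)
  moreover have "(\<lambda>x. indicator (cball 0 r) x *\<^sub>R f x) = f"
    using assms(2) by (force simp: indicator_def fun_eq_iff)
  ultimately show ?thesis by simp
qed

text \<open>The minus sign is that of integration by parts: translating the variable moves the
  difference quotient of f in direction h onto the test function in direction -h.\<close>

lemma tendsto_difference_quotient_sequentially:
  fixes g :: "'a::real_normed_vector \<Rightarrow> real"
  assumes "(g has_derivative D) (at x)"
  shows "(\<lambda>k. (g (x - inverse (real (Suc k)) *\<^sub>R h) - g x) / inverse (real (Suc k))) \<longlonglongrightarrow> - D h"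
proof -
  have lin: "linear D" using assms has_derivative_linear by blast
  have "((\<lambda>t. g (x + t *\<^sub>R (-h))) has_derivative (\<lambda>t. D (t *\<^sub>R (-h)))) (at 0)"
    by (rule has_derivative_compose[of "\<lambda>t. x + t *\<^sub>R (-h)" _ 0 UNIV g])
       (use assms in \<open>auto intro!: derivative_eq_intros\<close>)
  moreover have "(\<lambda>t. D (t *\<^sub>R (-h))) = (\<lambda>t. t * (- D h))"
    using lin by (simp add: linear_scale linear_neg)
  ultimately have "((\<lambda>t. g (x + t *\<^sub>R (-h))) has_real_derivative (- D h)) (at 0)"
    by (simp only: has_field_derivative_def mult_commute_abs)
  then have "((\<lambda>t. (g (x - t *\<^sub>R h) - g x) / t) \<longlongrightarrow> - D h) (at 0)"
    by (simp add: DERIV_def)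
  moreover have "filterlim (\<lambda>k. inverse (real (Suc k))) (at 0) sequentially"
    using LIMSEQ_inverse_real_of_nat by (auto simp: filterlim_at)
  ultimately show ?thesis by (rule filterlim_compose)
qed

text \<open>
  The clamping to the interval from -L |h| to L |h| only matters where the limit does not exist:
  it keeps the function bounded there.
\<close>
definition dirderiv :: "('a::euclidean_space \<Rightarrow> real) \<Rightarrow> real \<Rightarrow> 'a \<Rightarrow> 'a \<Rightarrow> real" where
  "dirderiv f L h x = max (- (L * norm h)) (min (L * norm h)
     (lim (\<lambda>k. (f (x + inverse (real (Suc k)) *\<^sub>R h) - f x) / inverse (real (Suc k)))))"

lemma dirderiv_bound: "0 \<le> L \<Longrightarrow> \<bar>dirderiv f L h x\<bar> \<le> L * norm h"
  unfolding dirderiv_def by (auto simp: abs_le_iff)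

lemma dirderiv_measurable:
  assumes [measurable]: "f \<in> borel_measurable borel"
  shows "dirderiv f L h \<in> borel_measurable borel"
  unfolding dirderiv_def[abs_def] by measurable

lemma dirderiv_eq:
  fixes f :: "'a::euclidean_space \<Rightarrow> real"
  assumes lip: "L-lipschitz_on UNIV f"
    and lim: "((\<lambda>t. (f (x + t *\<^sub>R h) - f x) / t) \<longlongrightarrow> D) (at 0)"
  shows "dirderiv f L h x = D"
    and "(\<lambda>k. (f (x + inverse (real (Suc k)) *\<^sub>R h) - f x) / inverse (real (Suc k))) \<longlonglongrightarrow> D"
proof -
  have fl: "filterlim (\<lambda>k. inverse (real (Suc k))) (at 0) sequentially"
    using LIMSEQ_inverse_real_of_nat by (auto simp: filterlim_at)
  show seq: "(\<lambda>k. (f (x + inverse (real (Suc k)) *\<^sub>R h) - f x) / inverse (real (Suc k))) \<longlonglongrightarrow> D"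
    using lim fl by (rule filterlim_compose)
  have bd: "\<bar>(f (x + inverse (real (Suc k)) *\<^sub>R h) - f x) / inverse (real (Suc k))\<bar> \<le> L * norm h" for k
  proof -
    define t where "t = inverse (real (Suc k))"
    have t: "t > 0" by (simp add: t_def)
    have "\<bar>f (x + t *\<^sub>R h) - f x\<bar> \<le> L * norm h * t"
      using lipschitz_onD[OF lip, of "x + t *\<^sub>R h" x] t by (simp add: dist_norm mult_ac)
    then show ?thesis using t unfolding t_def[symmetric] by (simp add: abs_divide divide_le_eq)
  qed
  \<comment> \<open>Hence the clamping in \<open>dirderiv\<close> changes nothing at a point where
    the limit exists.\<close>
  have "\<bar>D\<bar> \<le> L * norm h"
    using tendsto_rabs[OF seq] by (rule LIMSEQ_le_const2) (use bd in blast)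
  then show "dirderiv f L h x = D" unfolding dirderiv_def limI[OF seq] by (auto simp: abs_le_iff max_def min_def)
qed

text \<open>Integration by parts for difference quotients, which is translation invariance, followed
  by a limit on both sides. The quotients of f converge almost everywhere by
  \<open>directional_derivative_AE\<close>, those of \<psi> everywhere, and the Lipschitz bounds
  dominate both.\<close>

lemma weak_directional_derivative:
  fixes f :: "'a::euclidean_space \<Rightarrow> real"
  assumes lip: "L-lipschitz_on UNIV f" and psi: "C-lipschitz_on UNIV \<psi>"
    and supp: "\<And>x. x \<notin> cball 0 r \<Longrightarrow> \<psi> x = 0"
    and der: "\<And>x. (\<psi> has_derivative D x) (at x)"
  shows "(\<integral>x. dirderiv f L h x * \<psi> x \<partial>lborel) = (\<integral>x. f x * - D x h \<partial>lborel)"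
    and "integrable lborel (\<lambda>x. f x * - D x h)"
    and "integrable lborel (\<lambda>x. dirderiv f L h x * \<psi> x)"
proof -
  define t where "t k = inverse (real (Suc k))" for k
  have t: "t k > 0" "t k \<le> 1" for k by (simp_all add: t_def inverse_le_1_iff)
  have L: "L \<ge> 0" and C: "C \<ge> 0" using lip psi lipschitz_on_nonneg by blast+
  have cf: "continuous_on UNIV f" and cp: "continuous_on UNIV \<psi>"
    using lip psi lipschitz_on_continuous_on by blast+
  have [measurable]: "f \<in> borel_measurable borel" "\<psi> \<in> borel_measurable borel"
    using cf cp by (simp_all add: borel_measurable_continuous_onI)
  note dirderiv_measurable[measurable]
  have ipsi: "integrable lborel (\<lambda>x. L * norm h * \<bar>\<psi> x\<bar>)"
    by (rule integrable_continuous_compact_support[of _ r]) (auto intro!: continuous_intros cp simp: supp)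
  have flip: "\<bar>f x - f y\<bar> \<le> L * norm (x - y)" for x y
    using lipschitz_onD[OF lip, of x y] by (simp add: dist_norm)
  have plip: "\<bar>\<psi> x - \<psi> y\<bar> \<le> C * norm (x - y)" for x y
    using lipschitz_onD[OF psi, of x y] by (simp add: dist_norm)
  define S where "S k = (\<integral>x. (f (x + t k *\<^sub>R h) - f x) / t k * \<psi> x \<partial>lborel)" for k
  obtain N where N: "N \<in> null_sets lborel"
    "\<And>x. x \<notin> N \<Longrightarrow> \<exists>D. ((\<lambda>t. (f (x + t *\<^sub>R h) - f x) / t) \<longlongrightarrow> D) (at 0)"
    using directional_derivative_AE[OF lip] by blast
  have AEl: "AE x in lborel. (\<lambda>k. (f (x + t k *\<^sub>R h) - f x) / t k * \<psi> x) \<longlonglongrightarrow> dirderiv f L h x * \<psi> x"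
    using AE_not_in[OF N(1)]
  proof eventually_elim
    case (elim x)
    then obtain E where "((\<lambda>t. (f (x + t *\<^sub>R h) - f x) / t) \<longlongrightarrow> E) (at 0)" using N(2) by blast
    note * = dirderiv_eq[OF lip this]
    show ?case unfolding t_def *(1) using *(2) by (rule tendsto_mult_right)
  qed
  have qb: "\<bar>(f (x + t k *\<^sub>R h) - f x) / t k * \<psi> x\<bar> \<le> L * norm h * \<bar>\<psi> x\<bar>" for k x
  proof -
    have "\<bar>f (x + t k *\<^sub>R h) - f x\<bar> / t k \<le> L * norm h"
      using flip[of "x + t k *\<^sub>R h" x] t[of k] by (simp add: divide_le_eq mult_ac)
    then have "\<bar>f (x + t k *\<^sub>R h) - f x\<bar> / t k * \<bar>\<psi> x\<bar> \<le> L * norm h * \<bar>\<psi> x\<bar>"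
      by (intro mult_right_mono) auto
    then show ?thesis using t[of k] by (simp add: abs_mult abs_divide)
  qed
  have S1: "S \<longlonglongrightarrow> (\<integral>x. dirderiv f L h x * \<psi> x \<partial>lborel)"
    unfolding S_def by (rule integral_dominated_convergence[OF _ _ ipsi AEl]) (use qb in auto)
  show "integrable lborel (\<lambda>x. dirderiv f L h x * \<psi> x)"
    by (rule integrable_dominated_convergence[OF _ _ ipsi AEl]) (use qb in auto)
  \<comment> \<open>The steps \<open>t k\<close> are at most 1, so the shifted test function also
    vanishes outside this enlarged ball; one dominating function \<open>w\<close> then serves all
    k.\<close>
  define R where "R = r + norm h"
  have out: "\<psi> (x - t k *\<^sub>R h) - \<psi> x = 0" if "x \<notin> cball 0 R" for x k
  proof -
    have "norm x > r + norm h" using that by (simp add: R_def)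
    moreover have "norm (t k *\<^sub>R h) \<le> norm h" using t[of k] by (simp add: mult_left_le_one_le)
    moreover have "norm x \<le> norm (x - t k *\<^sub>R h) + norm (t k *\<^sub>R h)" by (metis diff_add_cancel norm_triangle_ineq)
    moreover have "norm h \<ge> 0" by simp
    ultimately have "x - t k *\<^sub>R h \<notin> cball 0 r" "x \<notin> cball 0 r" unfolding mem_cball_0 by linarith+
    then show ?thesis using supp by simp
  qed
  have S2eq: "S k = (\<integral>x. f x * ((\<psi> (x - t k *\<^sub>R h) - \<psi> x) / t k) \<partial>lborel)" for k
  proof -
    have i1: "integrable lborel (\<lambda>x. f (x + t k *\<^sub>R h) * \<psi> x)"
      by (rule integrable_continuous_compact_support[of _ r])
         (auto intro!: continuous_intros cp continuous_on_compose2[OF cf] simp: supp)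
    have i2: "integrable lborel (\<lambda>x. f x * \<psi> x)"
      by (rule integrable_continuous_compact_support[of _ r]) (auto intro!: continuous_intros cp cf simp: supp)
    have eq: "(\<lambda>x. f (x + t k *\<^sub>R h) * \<psi> x) = (\<lambda>x. (\<lambda>y. f y * \<psi> (y - t k *\<^sub>R h)) (t k *\<^sub>R h + x))"
      by (simp add: add.commute)
    have i3: "integrable lborel (\<lambda>y. f y * \<psi> (y - t k *\<^sub>R h))"
      using i1 unfolding eq by (subst (asm) integral_lborel_translate(2)) auto
    have e3: "(\<integral>x. f (x + t k *\<^sub>R h) * \<psi> x \<partial>lborel) = (\<integral>x. f x * \<psi> (x - t k *\<^sub>R h) \<partial>lborel)"
      unfolding eq by (subst integral_lborel_translate(1)) auto
    have "S k = (\<integral>x. (f (x + t k *\<^sub>R h) * \<psi> x - f x * \<psi> x) / t k \<partial>lborel)"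
      unfolding S_def by (intro Bochner_Integration.integral_cong) (auto simp: field_simps)
    also have "\<dots> = ((\<integral>x. f (x + t k *\<^sub>R h) * \<psi> x \<partial>lborel) - (\<integral>x. f x * \<psi> x \<partial>lborel)) / t k"
      using i1 i2 by simp
    also have "\<dots> = (\<integral>x. (f x * \<psi> (x - t k *\<^sub>R h) - f x * \<psi> x) / t k \<partial>lborel)"
      unfolding e3 using i2 i3 by simp
    also have "\<dots> = (\<integral>x. f x * ((\<psi> (x - t k *\<^sub>R h) - \<psi> x) / t k) \<partial>lborel)"
      by (intro Bochner_Integration.integral_cong) (auto simp: field_simps)
    finally show ?thesis .
  qed
  define w where "w x = indicator (cball 0 R) x *\<^sub>R (\<bar>f x\<bar> * (C * norm h))" for x
  have iw: "integrable lborel w"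
    unfolding w_def by (rule borel_integrable_compact) (auto intro!: continuous_intros continuous_on_subset[OF cf])
  have wb: "\<bar>f x * ((\<psi> (x - t k *\<^sub>R h) - \<psi> x) / t k)\<bar> \<le> w x" for x k
  proof (cases "x \<in> cball 0 R")
    case True
    have "\<bar>\<psi> (x - t k *\<^sub>R h) - \<psi> x\<bar> / t k \<le> C * norm h"
      using plip[of "x - t k *\<^sub>R h" x] t[of k] by (simp add: divide_le_eq mult_ac)
    then have "\<bar>f x\<bar> * (\<bar>\<psi> (x - t k *\<^sub>R h) - \<psi> x\<bar> / t k) \<le> \<bar>f x\<bar> * (C * norm h)"
      by (intro mult_left_mono) auto
    then show ?thesis using True t[of k] by (simp add: w_def abs_mult abs_divide)
  qed (simp add: out w_def)
  have lim2: "(\<lambda>k. f x * ((\<psi> (x - t k *\<^sub>R h) - \<psi> x) / t k)) \<longlonglongrightarrow> f x * - D x h" for x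
    unfolding t_def by (intro tendsto_mult_left tendsto_difference_quotient_sequentially der)
  have m: "(\<lambda>x. f x * - D x h) \<in> borel_measurable lborel"
    by (rule borel_measurable_LIMSEQ_metric[OF _ lim2]) measurable
  have "S \<longlonglongrightarrow> (\<integral>x. f x * - D x h \<partial>lborel)"
    unfolding S2eq by (rule integral_dominated_convergence[OF m _ iw]) (use wb lim2 in auto)
  then show "(\<integral>x. dirderiv f L h x * \<psi> x \<partial>lborel) = (\<integral>x. f x * - D x h \<partial>lborel)"
    using S1 LIMSEQ_unique by blast
  have lim3: "AE x in lborel. (\<lambda>k. f x * ((\<psi> (x - t k *\<^sub>R h) - \<psi> x) / t k)) \<longlonglongrightarrow> f x * - D x h"
    using lim2 by (intro AE_I2)
  show "integrable lborel (\<lambda>x. f x * - D x h)"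
    by (rule integrable_dominated_convergence[OF m _ iw lim3]) (use wb in auto)
qed

text \<open>In the weak identity h enters only through the derivative of the test function, which is
  linear in h. So the defect of linearity integrates to zero against every \<open>box_bump\<close>,
  hence over every box, hence vanishes almost everywhere.\<close>

lemma dirderiv_linear_AE:
  fixes f :: "'a::euclidean_space \<Rightarrow> real"
  assumes lip: "L-lipschitz_on UNIV f"
  shows "AE x in lborel. dirderiv f L h x = (\<Sum>b\<in>Basis. (h \<bullet> b) * dirderiv f L b x)"
proof -
  have L: "L \<ge> 0" using lip lipschitz_on_nonneg by blast
  have [measurable]: "f \<in> borel_measurable borel"
    using lipschitz_on_continuous_on[OF lip] by (simp add: borel_measurable_continuous_onI)
  note dirderiv_measurable[measurable]
  define G where "G x = dirderiv f L h x - (\<Sum>b\<in>Basis. (h \<bullet> b) * dirderiv f L b x)" for x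
  have [measurable]: "G \<in> borel_measurable borel" unfolding G_def by measurable
  define M where "M = L * norm h + (\<Sum>b\<in>(Basis::'a set). \<bar>h \<bullet> b\<bar> * (L * norm b))"
  have bd: "\<bar>G x\<bar> \<le> M" for x
  proof -
    have "\<bar>\<Sum>b\<in>Basis. (h \<bullet> b) * dirderiv f L b x\<bar> \<le> (\<Sum>b\<in>(Basis::'a set). \<bar>h \<bullet> b\<bar> * (L * norm b))"
      by (rule order_trans[OF sum_abs sum_mono]) (simp add: abs_mult mult_left_mono dirderiv_bound[OF L] del: norm_Basis)
    then show ?thesis using dirderiv_bound[OF L, of f h x] unfolding G_def M_def by linarith
  qed
  have zero: "(\<integral>x. G x * box_bump l u k x \<partial>lborel) = 0" for l u k
  proof -
    obtain C where C: "C-lipschitz_on UNIV (box_bump l u k)" using box_bump_lipschitz by blast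
    obtain r where r: "box l u \<subseteq> cball 0 r"
      using bounded_box bounded_subset_ballD by (metis ball_subset_cball order_trans)
    have supp: "box_bump l u k x = 0" if "x \<notin> cball 0 r" for x using that r box_bump_outside by blast
    define D where "D x = frechet_derivative (box_bump l u k) (at x)" for x
    have der: "(box_bump l u k has_derivative D x) (at x)" for x
      unfolding D_def using box_bump_differentiable frechet_derivative_works by blast
    note w = weak_directional_derivative[OF lip C supp der]
    have lin: "D x h = (\<Sum>b\<in>Basis. (h \<bullet> b) * D x b)" for x
    proof -
      have "linear (D x)" using der has_derivative_linear by blast
      then have "D x (\<Sum>b\<in>Basis. (h \<bullet> b) *\<^sub>R b) = (\<Sum>b\<in>Basis. (h \<bullet> b) * D x b)"
        by (simp add: linear_sum linear_scale)
      then show ?thesis by (simp add: euclidean_representation)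
    qed
    have "(\<integral>x. G x * box_bump l u k x \<partial>lborel) = (\<integral>x. dirderiv f L h x * box_bump l u k x
        - (\<Sum>b\<in>Basis. (h \<bullet> b) * (dirderiv f L b x * box_bump l u k x)) \<partial>lborel)"
      by (intro Bochner_Integration.integral_cong) (simp_all add: G_def left_diff_distrib sum_distrib_right mult.assoc)
    also have "\<dots> = (\<integral>x. dirderiv f L h x * box_bump l u k x \<partial>lborel)
        - (\<Sum>b\<in>Basis. (h \<bullet> b) * (\<integral>x. dirderiv f L b x * box_bump l u k x \<partial>lborel))"
      using w(3) by simp
    also have "\<dots> = (\<integral>x. f x * - D x h \<partial>lborel) - (\<Sum>b\<in>Basis. (h \<bullet> b) * (\<integral>x. f x * - D x b \<partial>lborel))"
      by (simp only: w(1))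
    also have "(\<Sum>b\<in>Basis. (h \<bullet> b) * (\<integral>x. f x * - D x b \<partial>lborel)) = (\<integral>x. (\<Sum>b\<in>Basis. (h \<bullet> b) * (f x * - D x b)) \<partial>lborel)"
      using w(2) by (subst Bochner_Integration.integral_sum) auto
    also have "(\<lambda>x. (\<Sum>b\<in>Basis. (h \<bullet> b) * (f x * - D x b))) = (\<lambda>x. f x * - D x h)"
      unfolding lin by (simp add: sum_distrib_left sum_negf mult_ac)
    finally show ?thesis by simp
  qed
  have "(\<integral>x. G x * indicator (box l u) x \<partial>lborel) = 0" for l u
  proof -
    have i: "integrable lborel (\<lambda>x. M * indicator (box l u) x :: real)"
      using emeasure_bounded_finite[OF bounded_box, of l u] by (simp add: integrable_indicator_iff)
    have [measurable]: "box_bump l u k \<in> borel_measurable borel" for k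
      using box_bump_lipschitz[of l u k] lipschitz_on_continuous_on by (auto intro!: borel_measurable_continuous_onI)
    have "(\<lambda>k. (\<integral>x. G x * box_bump l u k x \<partial>lborel)) \<longlonglongrightarrow> (\<integral>x. G x * indicator (box l u) x \<partial>lborel)"
    proof (rule integral_dominated_convergence[OF _ _ i])
      show "AE x in lborel. (\<lambda>k. G x * box_bump l u k x) \<longlonglongrightarrow> G x * indicator (box l u) x"
        by (intro AE_I2 tendsto_mult_left box_bump_tendsto)
      show "AE x in lborel. norm (G x * box_bump l u k x) \<le> M * indicator (box l u) x" for k
      proof (intro AE_I2)
        fix x
        show "norm (G x * box_bump l u k x) \<le> M * indicator (box l u) x"
        proof (cases "x \<in> box l u")
          case True
          have "\<bar>G x\<bar> * box_bump l u k x \<le> M * 1"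
            using bd[of x] by (intro mult_mono) (auto simp: box_bump_nonneg box_bump_le_1)
          then show ?thesis using True by (simp add: abs_mult box_bump_nonneg)
        qed (simp add: box_bump_outside)
      qed
    qed simp_all
    then show ?thesis unfolding zero using LIMSEQ_unique tendsto_const by metis
  qed
  then have "AE x in lborel. G x = 0" by (intro AE_zero_if_box_integrals_zero[OF _ bd]) simp
  then show ?thesis unfolding G_def by eventually_elim simp
qed

text \<open>Off one null set the derivatives in a countable dense set of directions exist and are
  linear in the direction. Compactness of the unit ball reduces these to finitely many directions at
  a given accuracy, and the Lipschitz bound passes from them to all others; this makes the expansion
  uniform in the direction.\<close>

theorem Rademacher:
  fixes f :: "'a::euclidean_space \<Rightarrow> real"
  assumes lip: "L-lipschitz_on UNIV f"
  shows "negligible {x. \<not> f differentiable (at x)}"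
proof -
  have L: "L \<ge> 0" using lip lipschitz_on_nonneg by blast
  have flip: "\<bar>f x - f y\<bar> \<le> L * norm (x - y)" for x y
    using lipschitz_onD[OF lip, of x y] by (simp add: dist_norm)
  obtain D :: "'a set" where D: "countable D" "\<And>X. open X \<Longrightarrow> X \<noteq> {} \<Longrightarrow> \<exists>d \<in> D. d \<in> X"
    using countable_dense_setE by blast
  have "AE x in lborel. ((\<lambda>t. (f (x + t *\<^sub>R h) - f x) / t) \<longlongrightarrow> (\<Sum>b\<in>Basis. (h \<bullet> b) * dirderiv f L b x)) (at 0)" for h
  proof -
    obtain N where N: "N \<in> null_sets lborel"
      "\<And>x. x \<notin> N \<Longrightarrow> \<exists>D. ((\<lambda>t. (f (x + t *\<^sub>R h) - f x) / t) \<longlongrightarrow> D) (at 0)"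
      using directional_derivative_AE[OF lip] by blast
    show ?thesis using AE_not_in[OF N(1)] dirderiv_linear_AE[OF lip, of h]
    proof eventually_elim
      case (elim x)
      then obtain E where E: "((\<lambda>t. (f (x + t *\<^sub>R h) - f x) / t) \<longlongrightarrow> E) (at 0)" using N(2) by blast
      then show ?case using dirderiv_eq(1)[OF lip E] elim(2) by simp
    qed
  qed
  then have "AE x in lborel. \<forall>h\<in>D. ((\<lambda>t. (f (x + t *\<^sub>R h) - f x) / t) \<longlongrightarrow> (\<Sum>b\<in>Basis. (h \<bullet> b) * dirderiv f L b x)) (at 0)"
    using D(1) by (simp add: AE_ball_countable)
  then have "AE x in lborel. f differentiable (at x)"
  proof eventually_elim
    case (elim x)
    define A where "A = (\<Sum>b\<in>Basis. dirderiv f L b x *\<^sub>R b)"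
    have A: "(\<Sum>b\<in>Basis. (h \<bullet> b) * dirderiv f L b x) = A \<bullet> h" for h
      unfolding A_def by (simp add: inner_sum_left inner_commute[of h] mult_ac)
    have "(f has_derivative (\<lambda>h. A \<bullet> h)) (at x)"
      unfolding has_derivative_at_alt
    proof (intro conjI allI impI)
      show "bounded_linear (\<lambda>h. A \<bullet> h)" by (rule bounded_linear_inner_right)
      fix e :: real assume "e > 0"
      \<comment> \<open>Relative to the increment t there are three errors: L * e' for replacing the
        direction in f, e' for the quotient in direction d, and norm A * e' for replacing the
        direction in the linear part.\<close>
      define e' where "e' = e / (L + 1 + norm A)"
      have e': "e' > 0" "(L + 1 + norm A) * e' = e" 
      proof -
        have "L + 1 + norm A > 0" using L by (simp add: add_nonneg_pos add_pos_nonneg)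
        then show "e' > 0" "(L + 1 + norm A) * e' = e" using \<open>e > 0\<close> by (simp_all add: e'_def)
      qed
      have "cball (0::'a) 1 \<subseteq> (\<Union>d\<in>D. ball d e')"
      proof
        fix v :: 'a
        obtain d where "d \<in> D" "d \<in> ball v e'" using D(2)[of "ball v e'"] e' by auto
        then show "v \<in> (\<Union>d\<in>D. ball d e')" by (auto simp: dist_commute)
      qed
      then obtain F where F: "F \<subseteq> D" "finite F" "cball (0::'a) 1 \<subseteq> (\<Union>d\<in>F. ball d e')"
        by (rule compactE_image[OF compact_cball, rotated]) auto
      have "\<exists>\<delta>>0. \<forall>t. t \<noteq> 0 \<and> \<bar>t\<bar> < \<delta> \<longrightarrow> \<bar>(f (x + t *\<^sub>R d) - f x) / t - A \<bullet> d\<bar> < e'" if "d \<in> D" for d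
        using elim that e'(1) unfolding A tendsto_iff eventually_at dist_real_def by simp
      then obtain \<delta> where \<delta>: "\<And>d. d \<in> D \<Longrightarrow> \<delta> d > 0"
        "\<And>d t. d \<in> D \<Longrightarrow> t \<noteq> 0 \<Longrightarrow> \<bar>t\<bar> < \<delta> d \<Longrightarrow> \<bar>(f (x + t *\<^sub>R d) - f x) / t - A \<bullet> d\<bar> < e'"
        by metis
      define m where "m = Min (insert 1 (\<delta> ` F))"
      have m: "m > 0" "\<And>d. d \<in> F \<Longrightarrow> m \<le> \<delta> d" using F(1,2) \<delta>(1) unfolding m_def by auto
      show "\<exists>d>0. \<forall>y. norm (y - x) < d \<longrightarrow> norm (f y - f x - A \<bullet> (y - x)) \<le> e * norm (y - x)"
      proof (intro exI[of _ m] conjI allI impI m)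
        fix y assume y: "norm (y - x) < m"
        show "norm (f y - f x - A \<bullet> (y - x)) \<le> e * norm (y - x)"
        proof (cases "y = x")
          case False
          define t where "t = norm (y - x)"
          define v where "v = (1/t) *\<^sub>R (y - x)"
          have t: "t > 0" using False by (simp add: t_def)
          have v: "norm v = 1" "y = x + t *\<^sub>R v" using t by (simp_all add: v_def t_def)
          obtain d where d: "d \<in> F" "dist d v < e'" using F(3) v(1) by (force simp: subset_iff)
          have "\<bar>(f (x + t *\<^sub>R d) - f x) / t - A \<bullet> d\<bar> < e'"
            using d y F(1) m(2)[OF d(1)] t by (intro \<delta>(2)) (auto simp: t_def)
          moreover have "f (x + t *\<^sub>R d) - f x - t * (A \<bullet> d) = t * ((f (x + t *\<^sub>R d) - f x) / t - A \<bullet> d)"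
            using t by (simp add: field_simps)
          ultimately have 1: "\<bar>f (x + t *\<^sub>R d) - f x - t * (A \<bullet> d)\<bar> \<le> t * e'"
            using t by (simp add: abs_mult)
          have 2: "\<bar>f y - f (x + t *\<^sub>R d)\<bar> \<le> L * (t * e')"
          proof -
            have "norm (y - (x + t *\<^sub>R d)) = t * norm (v - d)" using t unfolding v(2) by (simp flip: scaleR_diff_right)
            also have "\<dots> \<le> t * e'" using d(2) t by (intro mult_left_mono) (auto simp: dist_norm norm_minus_commute)
            finally show ?thesis using flip[of y "x + t *\<^sub>R d"] L by (meson mult_left_mono order_trans)
          qed
          have 3: "\<bar>t * (A \<bullet> d) - A \<bullet> (y - x)\<bar> \<le> norm A * (t * e')"
          proof -
            have "t * (A \<bullet> d) - A \<bullet> (y - x) = t * (A \<bullet> (d - v))" unfolding v(2) by (simp add: inner_diff_right algebra_simps)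
            also have "\<bar>\<dots>\<bar> \<le> t * (norm A * norm (d - v))"
              using t Cauchy_Schwarz_ineq2[of A "d - v"] by (simp add: abs_mult mult_left_mono)
            also have "\<dots> \<le> t * (norm A * e')" using d(2) t by (intro mult_left_mono) (auto simp: dist_norm)
            finally show ?thesis by (simp add: mult_ac)
          qed
          have "norm (f y - f x - A \<bullet> (y - x)) \<le> L * (t * e') + t * e' + norm A * (t * e')"
            using 1 2 3 unfolding real_norm_def by linarith
          also have "\<dots> = (L + 1 + norm A) * e' * t" by (simp add: algebra_simps)
          finally show ?thesis unfolding e'(2) t_def .
        qed simp
      qed
    qed
    then show ?case unfolding differentiable_def by blast
  qed
  then show ?thesis
  proof -
    assume "AE x in lborel. f differentiable (at x)"
    then obtain N where "N \<in> null_sets lborel" "{x. \<not> f differentiable (at x)} \<subseteq> N"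
      unfolding eventually_ae_filter by auto
    then show ?thesis using null_sets_completionI negligible_iff_null_sets negligible_subset by blast
  qed
qed

section \<open>Second-order expansion of convex functions\<close>

definition subgrad :: "('a::real_inner \<Rightarrow> real) \<Rightarrow> 'a \<Rightarrow> 'a set" where
  "subgrad f x = {s. \<forall>y. f x + s \<bullet> (y - x) \<le> f y}"

lemma subgradD: "s \<in> subgrad f x \<Longrightarrow> f x + s \<bullet> (y - x) \<le> f y"
  by (simp add: subgrad_def)

text \<open>Convexity and the Lipschitz bound in one condition, in the form in which sup-convolution
  delivers them and the arguments below consume them.\<close>

definition convex_lip :: "real \<Rightarrow> ('a::real_inner \<Rightarrow> real) \<Rightarrow> bool" where
  "convex_lip R f \<longleftrightarrow> (\<forall>x. \<exists>s\<in>subgrad f x. norm s \<le> R)"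

lemma convex_lip_lipschitz:
  assumes "convex_lip R f"
  shows "R-lipschitz_on UNIV f"
proof (rule lipschitz_onI)
  have *: "f x - f y \<le> R * norm (x - y)" for x y
  proof -
    obtain s where s: "s \<in> subgrad f x" "norm s \<le> R" using assms unfolding convex_lip_def by blast
    have "f x - f y \<le> s \<bullet> (x - y)" using subgradD[OF s(1), of y] by (simp add: inner_diff_right)
    also have "\<dots> \<le> norm s * norm (x - y)" by (rule norm_cauchy_schwarz)
    also have "\<dots> \<le> R * norm (x - y)" using s(2) by (intro mult_right_mono) auto
    finally show ?thesis .
  qed
  show "dist (f x) (f y) \<le> R * dist x y" for x y
    using *[of x y] *[of y x] by (simp add: dist_norm abs_le_iff norm_minus_commute)
  show "0 \<le> R" using assms unfolding convex_lip_def by (meson norm_ge_zero order_trans)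
qed

section \<open>The proximal map and its nonexpansiveness\<close>

lemma prox_exists:
  fixes f :: "'a::euclidean_space \<Rightarrow> real"
  assumes f: "convex_lip R f"
  shows "\<exists>x. z - x \<in> subgrad f x"
proof -
  define F where "F x = f x + (norm (x - z))\<^sup>2 / 2" for x
  have lip: "R-lipschitz_on UNIV f" using convex_lip_lipschitz[OF f] .
  have R: "R \<ge> 0" using lip lipschitz_on_nonneg by blast
  \<comment> \<open>At distance d > 2R from z the penalty d^2/2 exceeds the largest possible
    decrease R * d of f, so a minimum over this ball is a global one.\<close>
  have "continuous_on (cball z (2*R+1)) F" unfolding F_def
    by (intro continuous_intros continuous_on_subset[OF lipschitz_on_continuous_on[OF lip]]) auto
  moreover have "cball z (2*R+1) \<noteq> {}" using R by simp
  ultimately obtain x where x: "x \<in> cball z (2*R+1)" "\<And>y. y \<in> cball z (2*R+1) \<Longrightarrow> F x \<le> F y"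
    using continuous_attains_inf[OF compact_cball] by blast
  have min: "F x \<le> F y" for y
  proof (cases "y \<in> cball z (2*R+1)")
    case False
    define d where "d = norm (y - z)"
    have d: "d > 2*R+1" using False by (simp add: d_def dist_norm norm_minus_commute)
    have "\<bar>f y - f z\<bar> \<le> R * d" using lipschitz_onD[OF lip, of y z] by (simp add: dist_norm d_def)
    moreover have "R * d \<le> (d/2) * d" using d R by (intro mult_right_mono) auto
    ultimately have "F z \<le> F y" unfolding F_def d_def[symmetric] by (simp add: power2_eq_square)
    moreover have "F x \<le> F z" using x(2) R by simp
    ultimately show ?thesis by simp
  qed (use x in auto)
  have "f x + (z - x) \<bullet> (y - x) \<le> f y" for y
  proof -
    \<comment> \<open>A subgradient at the intermediate point w yields convexity of f along the
      segment from x to y. Minimality of x at w, divided by t, gives the subgradient inequality up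
      to a term that vanishes as t tends to 0.\<close>
    have "(z - x) \<bullet> (y - x) - t * ((norm (y - x))\<^sup>2 / 2) \<le> f y - f x" if t: "0 < t" "t \<le> 1" for t
    proof -
      define w where "w = x + t *\<^sub>R (y - x)"
      obtain s where s: "s \<in> subgrad f w" using f unfolding convex_lip_def by blast
      have "y - w = (1 - t) *\<^sub>R (y - x)" "x - w = (- t) *\<^sub>R (y - x)" by (simp_all add: w_def algebra_simps)
      then have "f w + (1 - t) * (s \<bullet> (y - x)) \<le> f y" "f w - t * (s \<bullet> (y - x)) \<le> f x"
        using subgradD[OF s, of y] subgradD[OF s, of x] by simp_all
      then have "t * (f w + (1 - t) * (s \<bullet> (y - x))) \<le> t * f y" "(1 - t) * (f w - t * (s \<bullet> (y - x))) \<le> (1 - t) * f x"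
        using t by (auto intro: mult_left_mono)
      then have 1: "f w \<le> f x + t * (f y - f x)" by (simp add: algebra_simps)
      have "w - z = (x - z) + t *\<^sub>R (y - x)" by (simp add: w_def)
      then have "(norm (w - z))\<^sup>2 = (norm (x - z))\<^sup>2 + 2 * t * ((x - z) \<bullet> (y - x)) + t\<^sup>2 * (norm (y - x))\<^sup>2"
        unfolding power2_norm_eq_inner by (simp only: inner_add_left inner_add_right inner_scaleR_left inner_scaleR_right)
          (simp add: inner_commute[of "y - x" "x - z"] power2_eq_square distrib_left)
      moreover have "(x - z) \<bullet> (y - x) = - ((z - x) \<bullet> (y - x))" by (metis inner_minus_left minus_diff_eq)
      ultimately have "0 \<le> t * (f y - f x) - t * ((z - x) \<bullet> (y - x)) + t\<^sup>2 * (norm (y - x))\<^sup>2 / 2"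
        using min[of w] 1 unfolding F_def by (simp add: algebra_simps)
      also have "\<dots> = t * ((f y - f x) - ((z - x) \<bullet> (y - x) - t * ((norm (y - x))\<^sup>2 / 2)))"
        by (simp add: algebra_simps power2_eq_square)
      finally show ?thesis using t by (simp add: zero_le_mult_iff)
    qed
    then have ev: "eventually (\<lambda>t. (z - x) \<bullet> (y - x) - t * ((norm (y - x))\<^sup>2 / 2) \<le> f y - f x) (at_right 0)"
      unfolding eventually_at_right_field by (intro exI[of _ 1]) auto
    have "((\<lambda>t. (z - x) \<bullet> (y - x) - t * ((norm (y - x))\<^sup>2 / 2)) \<longlongrightarrow> (z - x) \<bullet> (y - x) - 0 * ((norm (y - x))\<^sup>2 / 2)) (at_right 0)"
      by (intro tendsto_intros)
    from tendsto_upperbound[OF this ev] show ?thesis by simp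
  qed
  then show ?thesis unfolding subgrad_def by blast
qed

text \<open>Monotonicity of the subdifferential, obtained by adding the two subgradient
  inequalities, followed by Cauchy-Schwarz.\<close>

lemma prox_nonexpansive:
  assumes "z - x \<in> subgrad f x" "w - y \<in> subgrad f y"
  shows "norm (x - y) \<le> norm (z - w)"
proof -
  have "0 \<le> ((z - x) - (w - y)) \<bullet> (x - y)"
    using subgradD[OF assms(1), of y] subgradD[OF assms(2), of x]
    by (simp add: inner_diff_left inner_diff_right algebra_simps)
  then have "(norm (x - y))\<^sup>2 \<le> (z - w) \<bullet> (x - y)"
    by (simp add: power2_norm_eq_inner inner_diff_left inner_diff_right algebra_simps)
  also have "\<dots> \<le> norm (z - w) * norm (x - y)" by (rule norm_cauchy_schwarz)
  finally show ?thesis by (cases "norm (x - y) = 0") (auto simp: power2_eq_square)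
qed

text \<open>J is the inverse of the multivalued map sending x to x plus its subgradients. The last
  property says that every x is hit by J, and from each of its subgradients; this is how a null set
  of arguments of J becomes a null set of points x.\<close>

lemma prox_map:
  fixes f :: "'a::euclidean_space \<Rightarrow> real"
  assumes f: "convex_lip R f"
  obtains J where "1-lipschitz_on UNIV J" "\<And>z. z - J z \<in> subgrad f (J z)"
    "\<And>x s. s \<in> subgrad f x \<Longrightarrow> J (x + s) = x"
proof -
  obtain J where J: "\<And>z. z - J z \<in> subgrad f (J z)" using prox_exists[OF f] by metis
  show thesis
  proof (rule that[of J])
    show "1-lipschitz_on UNIV J"
      by (rule lipschitz_onI) (use prox_nonexpansive[OF J J] in \<open>auto simp: dist_norm\<close>)
    show "J (x + s) = x" if "s \<in> subgrad f x" for x s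
      using prox_nonexpansive[OF J[of "x + s"], of "x + s" x] that by simp
  qed (rule J)
qed

theorem Rademacher_vector:
  fixes f :: "'a::euclidean_space \<Rightarrow> 'b::euclidean_space"
  assumes lip: "L-lipschitz_on UNIV f"
  shows "negligible {x. \<not> f differentiable (at x)}"
proof -
  have "L-lipschitz_on UNIV (\<lambda>x. f x \<bullet> b)" if "b \<in> Basis" for b
  proof (rule lipschitz_onI)
    fix x y
    have "\<bar>f x \<bullet> b - f y \<bullet> b\<bar> \<le> norm (f x - f y)"
      using Basis_le_norm[OF that, of "f x - f y"] by (simp add: inner_diff_left)
    also have "\<dots> \<le> L * dist x y" using lipschitz_onD[OF lip, of x y] by (simp add: dist_norm)
    finally show "dist (f x \<bullet> b) (f y \<bullet> b) \<le> L * dist x y" by (simp add: dist_norm)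
  qed (use lip lipschitz_on_nonneg in blast)
  then have "negligible {x. \<not> (\<lambda>x. f x \<bullet> b) differentiable (at x)}" if "b \<in> Basis" for b
    using that Rademacher by blast
  then have "negligible (\<Union>b\<in>Basis. {x. \<not> (\<lambda>x. f x \<bullet> b) differentiable (at x)})"
    by (intro negligible_Union) auto
  moreover have "{x. \<not> f differentiable (at x)} = (\<Union>b\<in>Basis. {x. \<not> (\<lambda>x. f x \<bullet> b) differentiable (at x)})"
    using differentiable_componentwise_within[of f _ UNIV] by auto
  ultimately show ?thesis by simp
qed

text \<open>Over n + 1 equal steps the linear parts add up to c and the quadratic parts to b/(n +
  1). This replaces integration of a derivative, since \<psi> is not known to be
  differentiable.\<close>

lemma increment_bound_by_subdivision:
  fixes \<psi> :: "real \<Rightarrow> real"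
  assumes inc: "\<And>t t'. 0 \<le> t \<Longrightarrow> t \<le> t' \<Longrightarrow> t' \<le> 1 \<Longrightarrow> \<bar>\<psi> t' - \<psi> t\<bar> \<le> (t' - t) * c + (t' - t)\<^sup>2 * b"
  shows "\<bar>\<psi> 1 - \<psi> 0\<bar> \<le> c"
proof -
  have "\<bar>\<psi> 1 - \<psi> 0\<bar> \<le> c + b * inverse (real (Suc n))" for n
  proof -
    define N where "N = real (Suc n)"
    have N: "N > 0" by (simp add: N_def)
    have "\<bar>\<psi> (real k / N) - \<psi> 0\<bar> \<le> real k * (c / N + b / N\<^sup>2)" if "k \<le> Suc n" for k
      using that
    proof (induction k)
      case (Suc k)
      have "real (Suc k) / N - real k / N = 1 / N" using N by (simp add: field_simps)
      moreover have "real (Suc k) / N \<le> 1" using Suc.prems N by (simp add: N_def)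
      moreover have "real k / N \<le> real (Suc k) / N" using N by (simp add: divide_right_mono)
      ultimately have "\<bar>\<psi> (real (Suc k) / N) - \<psi> (real k / N)\<bar> \<le> (1/N) * c + (1/N)\<^sup>2 * b"
        using inc[of "real k / N" "real (Suc k) / N"] N by simp
      then have "\<bar>\<psi> (real (Suc k) / N) - \<psi> (real k / N)\<bar> \<le> c / N + b / N\<^sup>2" by (simp add: power_divide)
      then have "\<bar>\<psi> (real (Suc k) / N) - \<psi> 0\<bar> \<le> real k * (c / N + b / N\<^sup>2) + (c / N + b / N\<^sup>2)"
        using Suc by linarith
      then show ?case by (simp only: of_nat_Suc distrib_right mult_1_left add.commute)
    qed simp
    from this[of "Suc n"] have "\<bar>\<psi> 1 - \<psi> 0\<bar> \<le> N * (c / N + b / N\<^sup>2)" using N by (simp add: N_def)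
    also have "\<dots> = c + b * inverse N" using N by (simp add: field_simps power2_eq_square)
    finally show ?thesis by (simp add: N_def)
  qed
  moreover have "(\<lambda>n. c + b * inverse (real (Suc n))) \<longlonglongrightarrow> c + b * 0"
    by (intro tendsto_intros LIMSEQ_inverse_real_of_nat)
  ultimately show ?thesis using LIMSEQ_le_const[of _ "c + b * 0" "\<bar>\<psi> 1 - \<psi> 0\<bar>"] by auto
qed

text \<open>A first-order expansion of the subgradients integrates to a second-order expansion of f.
  On a piece of the segment the subgradients at its two ends bound the increment of f from below and
  above; apart from the \<eta> terms the bounds differ by a multiple of the squared step, which
  subdivision removes.\<close>

lemma second_order_expansion_of_subgrad_expansion:
  fixes f :: "'a::euclidean_space \<Rightarrow> real"
  assumes f: "convex_lip R f" and lin: "linear A"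
    and ex: "\<And>h s'. norm h < \<delta> \<Longrightarrow> s' \<in> subgrad f (x + h) \<Longrightarrow> norm (s' - s - A h) \<le> \<eta> * norm h"
    and h: "norm h < \<delta>" and "\<eta> \<ge> 0"
  shows "\<bar>f (x + h) - f x - s \<bullet> h - (h \<bullet> A h) / 2\<bar> \<le> \<eta> * (norm h)\<^sup>2"
proof -
  define a where "a = h \<bullet> A h"
  \<comment> \<open>The defect of the expansion at the point t h; the claim bounds its total change
    between t = 0 and t = 1.\<close>
  define \<psi> where "\<psi> t = f (x + t *\<^sub>R h) - t * (s \<bullet> h) - t\<^sup>2 * a / 2" for t
  have sb: "\<bar>s' \<bullet> h - s \<bullet> h - t * a\<bar> \<le> \<eta> * (norm h)\<^sup>2"
    if t: "0 \<le> t" "t \<le> 1" and s': "s' \<in> subgrad f (x + t *\<^sub>R h)" for t s'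
  proof -
    have "norm (t *\<^sub>R h) < \<delta>" using h t mult_left_le_one_le[of "norm h" t] by simp
    then have "norm (s' - s - A (t *\<^sub>R h)) \<le> \<eta> * norm (t *\<^sub>R h)" using ex s' by blast
    also have "\<dots> \<le> \<eta> * norm h" using t \<open>\<eta> \<ge> 0\<close> by (intro mult_left_mono) (auto simp: mult_left_le_one_le)
    finally have 1: "norm (s' - s - t *\<^sub>R A h) \<le> \<eta> * norm h" using lin by (simp add: linear_scale)
    have "s' \<bullet> h - s \<bullet> h - t * a = (s' - s - t *\<^sub>R A h) \<bullet> h"
      by (simp add: a_def inner_diff_left inner_commute[of h])
    also have "\<bar>\<dots>\<bar> \<le> norm (s' - s - t *\<^sub>R A h) * norm h" by (rule Cauchy_Schwarz_ineq2)
    also have "\<dots> \<le> \<eta> * norm h * norm h" using 1 by (intro mult_right_mono) auto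
    finally show ?thesis by (simp add: power2_eq_square mult_ac)
  qed
  have "\<bar>\<psi> 1 - \<psi> 0\<bar> \<le> \<eta> * (norm h)\<^sup>2"
  proof (rule increment_bound_by_subdivision)
    fix t t' :: real assume t: "0 \<le> t" "t \<le> t'" "t' \<le> 1"
    obtain p where p: "p \<in> subgrad f (x + t *\<^sub>R h)" using f unfolding convex_lip_def by blast
    obtain q where q: "q \<in> subgrad f (x + t' *\<^sub>R h)" using f unfolding convex_lip_def by blast
    let ?d = "t' - t" and ?e = "\<eta> * (norm h)\<^sup>2"
    have d: "?d \<ge> 0" using t by simp
    have "f (x + t *\<^sub>R h) + ?d * (p \<bullet> h) \<le> f (x + t' *\<^sub>R h)"
      using subgradD[OF p, of "x + t' *\<^sub>R h"] by (simp flip: scaleR_diff_left)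
    moreover have "f (x + t' *\<^sub>R h) - ?d * (q \<bullet> h) \<le> f (x + t *\<^sub>R h)"
      using subgradD[OF q, of "x + t *\<^sub>R h"] by (simp add: algebra_simps flip: scaleR_diff_left)
    moreover have "?d * (p \<bullet> h) \<ge> ?d * (s \<bullet> h + t * a - ?e)" "?d * (q \<bullet> h) \<le> ?d * (s \<bullet> h + t' * a + ?e)"
      using sb[OF _ _ p] sb[OF _ _ q] t d by (auto intro!: mult_left_mono)
    ultimately have
      "?d * (s \<bullet> h + t * a - ?e) \<le> f (x + t' *\<^sub>R h) - f (x + t *\<^sub>R h)"
      "f (x + t' *\<^sub>R h) - f (x + t *\<^sub>R h) \<le> ?d * (s \<bullet> h + t' * a + ?e)"
      by linarith+
    moreover have "\<psi> t' - \<psi> t = f (x + t' *\<^sub>R h) - f (x + t *\<^sub>R h) - ?d * (s \<bullet> h) - ?d * t * a - ?d\<^sup>2 * a / 2"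
      by (simp add: \<psi>_def power2_eq_square field_simps)
    moreover have "?d * t' * a = ?d * t * a + ?d\<^sup>2 * a" by (simp add: power2_eq_square algebra_simps)
    ultimately have "\<psi> t' - \<psi> t \<le> ?d * ?e + ?d\<^sup>2 * a / 2" "- (?d * ?e) - ?d\<^sup>2 * a / 2 \<le> \<psi> t' - \<psi> t"
      by (simp_all add: distrib_left right_diff_distrib mult.assoc)
    moreover have "\<bar>?d\<^sup>2 * a / 2\<bar> = ?d\<^sup>2 * (\<bar>a\<bar> / 2)" by (simp add: abs_mult)
    ultimately show "\<bar>\<psi> t' - \<psi> t\<bar> \<le> ?d * ?e + ?d\<^sup>2 * (\<bar>a\<bar> / 2)" by linarith
  qed
  then show ?thesis by (simp add: \<psi>_def a_def)
qed

text \<open>Along the direction s' - s the linear lower bound with slope s' would rise above the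
  paraboloid for small steps, because the gain is linear in the step and the quadratic term is
  not.\<close>

lemma upper_paraboloid_slope_eq_subgrad:
  fixes f :: "'a::real_inner \<Rightarrow> real"
  assumes s': "s' \<in> subgrad f x" and up: "\<And>h. norm h < \<rho> \<Longrightarrow> f (x + h) \<le> f x + s \<bullet> h + \<Lambda> * (norm h)\<^sup>2"
    and "\<Lambda> \<ge> 0" and rho: "\<rho> > 0"
  shows "s' = s"
proof (rule ccontr)
  assume "s' \<noteq> s"
  define e where "e = s' - s"
  have e: "norm e > 0" using \<open>s' \<noteq> s\<close> by (simp add: e_def)
  \<comment> \<open>The first entry keeps the step inside the radius \<rho>, the second gives t *
    \<Lambda> < 1.\<close>
  define t where "t = min (\<rho> / (2 * norm e)) (1 / (2 * (\<Lambda> + 1)))"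
  have t: "t > 0" "t * norm e < \<rho>" "t * \<Lambda> < 1"
  proof -
    show "t > 0" using rho e \<open>\<Lambda> \<ge> 0\<close> by (simp add: t_def)
    have "t * norm e \<le> \<rho> / (2 * norm e) * norm e" using e by (intro mult_right_mono) (auto simp: t_def)
    then show "t * norm e < \<rho>" using e rho by simp
    have "t * \<Lambda> \<le> 1 / (2 * (\<Lambda> + 1)) * \<Lambda>" using \<open>\<Lambda> \<ge> 0\<close> by (intro mult_right_mono) (auto simp: t_def)
    also have "\<dots> < 1" using \<open>\<Lambda> \<ge> 0\<close> by (simp add: divide_less_eq)
    finally show "t * \<Lambda> < 1" .
  qed
  have "norm (t *\<^sub>R e) < \<rho>" using t by simp
  then have "f (x + t *\<^sub>R e) \<le> f x + s \<bullet> (t *\<^sub>R e) + \<Lambda> * (norm (t *\<^sub>R e))\<^sup>2" by (rule up)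
  moreover have "f x + s' \<bullet> (t *\<^sub>R e) \<le> f (x + t *\<^sub>R e)" using subgradD[OF s', of "x + t *\<^sub>R e"] by simp
  ultimately have "(s' - s) \<bullet> (t *\<^sub>R e) \<le> \<Lambda> * (norm (t *\<^sub>R e))\<^sup>2" by (simp add: inner_diff_left algebra_simps)
  then have "t * (norm e)\<^sup>2 \<le> t * (t * \<Lambda> * (norm e)\<^sup>2)"
    by (simp add: power2_norm_eq_inner power_mult_distrib flip: e_def) (simp add: power2_eq_square mult_ac)
  then have "(norm e)\<^sup>2 \<le> t * \<Lambda> * (norm e)\<^sup>2" using t(1) by (simp only: mult_le_cancel_left_pos)
  moreover have "t * \<Lambda> * (norm e)\<^sup>2 < 1 * (norm e)\<^sup>2" using t(3) e by (intro mult_strict_right_mono) auto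
  ultimately show False by simp
qed

text \<open>From x + h go on by a vector k of length norm h in the direction s' - s. There the
  subgradient bound gains norm h times norm (s' - s), while the paraboloid allows at most \<Lambda>
  (2 norm h)^2; hence the factor 4, and the half radius, which keeps x + h + k in range.\<close>

lemma subgrad_near_upper_paraboloid:
  fixes f :: "'a::real_inner \<Rightarrow> real"
  assumes s: "s \<in> subgrad f x" and up: "\<And>h. norm h < \<rho> \<Longrightarrow> f (x + h) \<le> f x + s \<bullet> h + \<Lambda> * (norm h)\<^sup>2"
    and "\<Lambda> \<ge> 0" and h: "norm h < \<rho> / 2" and s': "s' \<in> subgrad f (x + h)"
  shows "norm (s' - s) \<le> 4 * \<Lambda> * norm h"
proof (cases "h = 0 \<or> s' = s")
  case True
  have "\<rho> > 0" using h norm_ge_zero[of h] by linarith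
  then have "s' = s" using True s' upper_paraboloid_slope_eq_subgrad[OF _ up \<open>\<Lambda> \<ge> 0\<close>] by auto
  then show ?thesis using \<open>\<Lambda> \<ge> 0\<close> by simp
next
  case False
  define d where "d = norm (s' - s)"
  have d: "d > 0" using False by (simp add: d_def)
  define k where "k = (norm h / d) *\<^sub>R (s' - s)"
  have k: "norm k = norm h" using d by (simp add: k_def d_def)
  have hk: "norm (h + k) \<le> 2 * norm h" using norm_triangle_ineq[of h k] k by simp
  then have "norm (h + k) < \<rho>" using h by simp
  then have "f (x + (h + k)) \<le> f x + s \<bullet> (h + k) + \<Lambda> * (norm (h + k))\<^sup>2" by (rule up)
  also have "\<Lambda> * (norm (h + k))\<^sup>2 \<le> \<Lambda> * (2 * norm h)\<^sup>2"
    using hk \<open>\<Lambda> \<ge> 0\<close> by (intro mult_left_mono power_mono) auto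
  finally have "f (x + (h + k)) \<le> f x + s \<bullet> (h + k) + \<Lambda> * (2 * norm h)\<^sup>2" by simp
  moreover have "f (x + h) + s' \<bullet> k \<le> f (x + (h + k))"
    using subgradD[OF s', of "x + (h + k)"] by simp
  moreover have "f x + s \<bullet> h \<le> f (x + h)" using subgradD[OF s, of "x + h"] by simp
  ultimately have "(s' - s) \<bullet> k \<le> \<Lambda> * (2 * norm h)\<^sup>2" by (simp add: inner_add_right inner_diff_left)
  moreover have "(s' - s) \<bullet> k = norm h * d"
    using d by (simp add: k_def d_def power2_norm_eq_inner[symmetric] power2_eq_square)
  ultimately have "norm h * d \<le> norm h * (4 * \<Lambda> * norm h)" by (simp add: power2_eq_square mult_ac)
  then show ?thesis using False by (simp add: d_def)
qed

text \<open>
  The resolvent J of the subdifferential is nonexpansive, so it is differentiable off a null set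
  whose image N is again null. At a point that also has an upper paraboloid, the inverse of J is
  Lipschitz, which makes the derivative of J invertible; thus no Sard-type argument is needed.
\<close>
theorem Alexandrov_at_upper_paraboloids:
  fixes f :: "'a::euclidean_space \<Rightarrow> real"
  assumes f: "convex_lip R f"
  obtains N where "negligible N"
    "\<And>x s \<rho> \<Lambda>. \<lbrakk>x \<notin> N; \<rho> > 0; \<Lambda> \<ge> 0; s \<in> subgrad f x;
        \<And>h. norm h < \<rho> \<Longrightarrow> f (x + h) \<le> f x + s \<bullet> h + \<Lambda> * (norm h)\<^sup>2\<rbrakk> \<Longrightarrow>
      \<exists>A. linear A \<and> (\<forall>\<eta>>0. \<exists>\<delta>>0. \<forall>h. norm h < \<delta> \<longrightarrow>
         \<bar>f (x + h) - f x - s \<bullet> h - (h \<bullet> A h) / 2\<bar> \<le> \<eta> * (norm h)\<^sup>2)"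
proof -
  obtain J where J: "1-lipschitz_on UNIV J" "\<And>z. z - J z \<in> subgrad f (J z)"
    "\<And>x s. s \<in> subgrad f x \<Longrightarrow> J (x + s) = x"
    using prox_map[OF f] by blast
  define N where "N = J ` {z. \<not> J differentiable (at z)}"
  have "negligible N"
    unfolding N_def
  proof (rule negligible_locally_Lipschitz_image)
    show "negligible {z. \<not> J differentiable (at z)}" using Rademacher_vector[OF J(1)] .
    show "\<exists>T B. open T \<and> x \<in> T \<and> (\<forall>y\<in>{z. \<not> J differentiable at z} \<inter> T. norm (J y - J x) \<le> B * norm (y - x))" for x
      using lipschitz_onD[OF J(1)] by (intro exI[of _ UNIV] exI[of _ 1]) (auto simp: dist_norm)
  qed simp
  moreover have "\<exists>A. linear A \<and> (\<forall>\<eta>>0. \<exists>\<delta>>0. \<forall>h. norm h < \<delta> \<longrightarrow>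
         \<bar>f (x + h) - f x - s \<bullet> h - (h \<bullet> A h) / 2\<bar> \<le> \<eta> * (norm h)\<^sup>2)"
    if x: "x \<notin> N" and rho: "\<rho> > 0" and Lam: "\<Lambda> \<ge> 0" and s: "s \<in> subgrad f x"
      and up: "\<And>h. norm h < \<rho> \<Longrightarrow> f (x + h) \<le> f x + s \<bullet> h + \<Lambda> * (norm h)\<^sup>2" for x s \<rho> \<Lambda>
  proof -
    define z where "z = x + s"
    define C where "C = 1 + 4 * \<Lambda>"
    have C: "C > 0" using Lam by (simp add: C_def)
    have Jz: "J z = x" using J(3)[OF s] by (simp add: z_def)
    have "J differentiable (at z)" using x Jz unfolding N_def by blast
    then obtain D where D: "(J has_derivative D) (at z)" unfolding differentiable_def by blast
    have linD: "linear D" using D has_derivative_linear by blast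
    have inv_lip: "norm (h + s' - s) \<le> C * norm h" if "norm h < \<rho> / 2" "s' \<in> subgrad f (x + h)" for h s'
    proof -
      have "norm (h + s' - s) \<le> norm h + norm (s' - s)" by (metis add_diff_eq norm_triangle_ineq)
      also have "\<dots> \<le> norm h + 4 * \<Lambda> * norm h"
        using subgrad_near_upper_paraboloid[OF s up Lam that] by simp
      finally show ?thesis by (simp add: C_def algebra_simps)
    qed
    have small: "\<exists>\<delta>>0. \<forall>k. norm k < \<delta> \<longrightarrow> norm (J (z + k) - x - D k) \<le> e * norm k" if "e > 0" for e
    proof -
      obtain \<delta> where "\<delta> > 0" "\<And>y. norm (y - z) < \<delta> \<Longrightarrow> norm (J y - J z - D (y - z)) \<le> e * norm (y - z)"
        using D \<open>e > 0\<close> unfolding has_derivative_at_alt by blast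
      then show ?thesis using Jz by (intro exI[of _ \<delta>]) (metis add_diff_cancel_left')
    qed
    \<comment> \<open>If D v = 0, then J moves z + t v only by o(t) away from x. But
      \<open>inv_lip\<close> bounds the displacement of the argument by C times that of the image,
      so J has to move by at least t norm v / C.\<close>
    have injD: "inj D"
    proof (rule ccontr)
      assume "\<not> inj D"
      then obtain v where v: "v \<noteq> 0" "D v = 0" using linear_injective_0[OF linD] by blast
      obtain \<delta> where \<delta>: "\<delta> > 0" "\<And>k. norm k < \<delta> \<Longrightarrow> norm (J (z + k) - x - D k) \<le> (1 / (2 * C)) * norm k"
        using small[of "1 / (2 * C)"] C by auto
      define t where "t = min \<delta> (\<rho> / 2) / (2 * norm v)"
      define k where "k = t *\<^sub>R v"
      have t: "t > 0" using \<delta>(1) rho v by (simp add: t_def)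
      have nk: "norm k = min \<delta> (\<rho> / 2) / 2" using v t by (simp add: k_def) (simp add: t_def)
      then have k: "norm k > 0" "norm k < \<delta>" "norm k < \<rho> / 2" using \<delta>(1) rho by auto
      define h where "h = J (z + k) - x"
      have "norm h \<le> norm k" using lipschitz_onD[OF J(1), of "z + k" z] Jz by (simp add: h_def dist_norm)
      then have "norm h < \<rho> / 2" using k by simp
      moreover have "z + k - (x + h) \<in> subgrad f (x + h)" using J(2)[of "z + k"] by (simp add: h_def)
      ultimately have "norm (h + (z + k - (x + h)) - s) \<le> C * norm h" by (rule inv_lip)
      then have "norm k \<le> C * norm h" by (simp add: z_def)
      moreover have "norm h \<le> (1 / (2 * C)) * norm k"
        using \<delta>(2)[OF k(2)] v linD by (simp add: h_def k_def linear_scale)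
      then have "C * norm h \<le> C * ((1 / (2 * C)) * norm k)" using C by (intro mult_left_mono) auto
      then have "C * norm h \<le> norm k / 2" using C by simp
      ultimately show False using k(1) by simp
    qed
    obtain Di where Di: "linear Di" "Di \<circ> D = id" using linear_injective_left_inverse[OF linD injD] by blast
    have DiD: "Di (D k) = k" for k using Di(2) by (metis comp_apply id_apply)
    obtain B where B: "B > 0" "\<And>y. norm (Di y) \<le> B * norm y"
      using linear_bounded_pos[OF Di(1)] by blast
    \<comment> \<open>J inverts the identity plus the subgradient map, so the derivative of the
      subgradients is the inverse of D minus the identity.\<close>
    define A where "A h = Di h - h" for h
    have linA: "linear A" unfolding A_def using Di(1) by (intro linear_compose_sub linear_ident)
    have "\<exists>\<delta>>0. \<forall>h. norm h < \<delta> \<longrightarrow> \<bar>f (x + h) - f x - s \<bullet> h - (h \<bullet> A h) / 2\<bar> \<le> \<eta> * (norm h)\<^sup>2"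
      if eta: "\<eta> > 0" for \<eta>
    proof -
      \<comment> \<open>The factors B, from applying Di, and C, from bounding k by h, turn the
        tolerance \<eta> / (B * C) into \<eta>.\<close>
      obtain \<delta> where \<delta>: "\<delta> > 0" "\<And>k. norm k < \<delta> \<Longrightarrow> norm (J (z + k) - x - D k) \<le> (\<eta> / (B * C)) * norm k"
        using small[of "\<eta> / (B * C)"] C B(1) eta by auto
      define d where "d = min (\<rho> / 2) (\<delta> / C)"
      have d: "d > 0" using rho \<delta>(1) C by (simp add: d_def)
      have "norm (s' - s - A h) \<le> \<eta> * norm h" if h: "norm h < d" and s': "s' \<in> subgrad f (x + h)" for h s'
      proof -
        define k where "k = h + s' - s"
        have k: "norm k \<le> C * norm h" unfolding k_def using h by (intro inv_lip s') (simp add: d_def)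
        also have "\<dots> < \<delta>" using h C by (simp add: d_def pos_less_divide_eq mult.commute)
        finally have k2: "norm k < \<delta>" .
        have "J (z + k) = x + h" using J(3)[OF s'] by (simp add: k_def z_def algebra_simps)
        then have r: "norm (h - D k) \<le> (\<eta> / (B * C)) * norm k" using \<delta>(2)[OF k2] by simp
        have "s' - s - A h = - Di (h - D k)"
          using Di(1) DiD[of k] by (simp add: linear_diff A_def k_def algebra_simps)
        then have "norm (s' - s - A h) = norm (Di (h - D k))" by simp
        also have "\<dots> \<le> B * norm (h - D k)" by (rule B)
        also have "\<dots> \<le> B * ((\<eta> / (B * C)) * norm k)" using r B(1) by (intro mult_left_mono) auto
        also have "\<dots> \<le> B * ((\<eta> / (B * C)) * (C * norm h))"
          using k B(1) C eta by (intro mult_left_mono) auto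
        also have "\<dots> = \<eta> * norm h" using B(1) C by simp
        finally show ?thesis .
      qed
      note second_order_expansion_of_subgrad_expansion[OF f linA this]
      then show ?thesis using d eta by (intro exI[of _ d]) auto
    qed
    then show ?thesis using linA by blast
  qed
  ultimately show thesis by (rule that)
qed

section \<open>Upper semicontinuous functions and sup-convolution\<close>

text \<open>An upper bound on a sum becomes two real bounds on the summands, so that semicontinuity
  can be applied to each. If a summand is -infinity, its bound is chosen low enough to absorb
  whatever the other one needs.\<close>

lemma ereal_sum_less_split:
  fixes u v c :: ereal
  assumes "u < \<infinity>" "v < \<infinity>" "u + v < c"
  obtains a b :: real where "u < ereal a" "v < ereal b" "ereal (a + b) \<le> c"
proof -
  have fin: "\<exists>r::real. w < ereal r" if "w < \<infinity>" for w :: ereal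
    using that by (metis ereal_dense2)
  show thesis
  proof (cases c)
    case (real C)
    show ?thesis
    proof (cases u)
      case (real p)
      show ?thesis
      proof (cases v)
        case (real q)
        define d where "d = (C - p - q) / 2"
        have "p + q < C" using assms(3) \<open>u = ereal p\<close> \<open>v = ereal q\<close> \<open>c = ereal C\<close> by simp
        then have "d > 0" "(p + d) + (q + d) = C" by (simp_all add: d_def field_simps)
        then show ?thesis using that[of "p + d" "q + d"] \<open>u = ereal p\<close> \<open>v = ereal q\<close> \<open>c = ereal C\<close> by simp
      next
        case MInf
        then show ?thesis using that[of "p + 1" "C - (p + 1)"] \<open>u = ereal p\<close> \<open>c = ereal C\<close> by simp
      qed (use assms in auto)
    next
      case MInf
      obtain b where "v < ereal b" using fin assms(2) by blast
      then show ?thesis using that[of "C - b" b] MInf \<open>c = ereal C\<close> by simp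
    qed (use assms in auto)
  next
    case PInf
    then show ?thesis using that fin assms by (metis ereal_less_eq(1))
  qed (use assms in auto)
qed

lemma usc_on_add:
  assumes "usc_on S u" "usc_on S v"
  shows "usc_on S (\<lambda>x. u x + v x)"
  unfolding usc_on_def
proof (intro ballI conjI allI impI)
  fix x assume x: "x \<in> S"
  then have fin: "u x < \<infinity>" "v x < \<infinity>" using assms unfolding usc_on_def by auto
  then show "u x + v x < \<infinity>" by (simp add: ereal_plus_eq_PInfty less_top)
  fix c assume "u x + v x < c"
  then obtain a b :: real where ab: "u x < ereal a" "v x < ereal b" "ereal (a + b) \<le> c"
    using ereal_sum_less_split[OF fin] by blast
  obtain e1 where e1: "e1 > 0" "\<And>y. y \<in> S \<Longrightarrow> dist y x < e1 \<Longrightarrow> u y < ereal a"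
    using assms(1) x ab unfolding usc_on_def by meson
  obtain e2 where e2: "e2 > 0" "\<And>y. y \<in> S \<Longrightarrow> dist y x < e2 \<Longrightarrow> v y < ereal b"
    using assms(2) x ab unfolding usc_on_def by meson
  show "\<exists>e>0. \<forall>y\<in>S. dist y x < e \<longrightarrow> u y + v y < c"
  proof (intro exI[of _ "min e1 e2"] conjI ballI impI)
    fix y assume "y \<in> S" "dist y x < min e1 e2"
    then have "u y < ereal a" "v y < ereal b" using e1 e2 by auto
    then have "u y + v y < ereal a + ereal b" by (rule ereal_add_strict_mono2)
    then show "u y + v y < c" using ab(3) by simp
  qed (use e1 e2 in simp)
qed

lemma usc_on_continuous:
  fixes g :: "real^'n \<Rightarrow> real"
  assumes "continuous_on S g"
  shows "usc_on S (\<lambda>x. ereal (g x))"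
  unfolding usc_on_def
proof (intro ballI conjI allI impI)
  fix x c assume x: "x \<in> S" and c: "ereal (g x) < c"
  have "continuous_on S (\<lambda>x. ereal (g x))" using assms by (simp add: continuous_on_ereal)
  then have "((\<lambda>x. ereal (g x)) \<longlongrightarrow> ereal (g x)) (at x within S)" using x by (simp add: continuous_on_def)
  then have "eventually (\<lambda>y. ereal (g y) < c) (at x within S)" using c by (rule order_tendstoD)
  then obtain e where e: "e > 0" "\<forall>y\<in>S. y \<noteq> x \<and> dist y x < e \<longrightarrow> ereal (g y) < c"
    unfolding eventually_at by auto
  then show "\<exists>e>0. \<forall>y\<in>S. dist y x < e \<longrightarrow> ereal (g y) < c" using c by metis
qed simp

lemma usc_on_subset: "usc_on S u \<Longrightarrow> T \<subseteq> S \<Longrightarrow> usc_on T u"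
  unfolding usc_on_def by (meson subsetD)

text \<open>If the supremum s were not attained, every point would have a neighbourhood on which u
  stays below some constant less than s. Finitely many of these neighbourhoods cover K and would
  bound the supremum below itself.\<close>

lemma usc_attains_max:
  assumes K: "compact K" "K \<noteq> {}" and usc: "usc_on K u"
  shows "\<exists>y\<in>K. \<forall>z\<in>K. u z \<le> u y"
proof (rule ccontr)
  define s where "s = (SUP z\<in>K. u z)"
  assume no: "\<not> ?thesis"
  have lt: "u y < s" if yK: "y \<in> K" for y
  proof -
    obtain z where "z \<in> K" "u y < u z" using no yK by (meson not_le)
    moreover have "u z \<le> s" unfolding s_def using \<open>z \<in> K\<close> by (rule SUP_upper)
    ultimately show ?thesis by simp
  qed
  have "\<exists>c e. c < s \<and> e > 0 \<and> (\<forall>z\<in>K. dist z y < e \<longrightarrow> u z < c)" if yK: "y \<in> K" for y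
  proof -
    obtain c where "u y < c" "c < s" using lt[OF yK] dense by blast
    moreover obtain e where "e > 0" "\<forall>z\<in>K. dist z y < e \<longrightarrow> u z < c"
      using usc yK \<open>u y < c\<close> unfolding usc_on_def by meson
    ultimately show ?thesis by blast
  qed
  then obtain c e where ce: "\<And>y. y \<in> K \<Longrightarrow> c y < s" "\<And>y. y \<in> K \<Longrightarrow> e y > 0"
    "\<And>y z. y \<in> K \<Longrightarrow> z \<in> K \<Longrightarrow> dist z y < e y \<Longrightarrow> u z < c y" by metis
  have "K \<subseteq> (\<Union>y\<in>K. ball y (e y))" using ce(2) by force
  then obtain F where F: "F \<subseteq> K" "finite F" "K \<subseteq> (\<Union>y\<in>F. ball y (e y))"
    by (rule compactE_image[OF K(1), rotated]) auto
  have Fne: "F \<noteq> {}" using F K by auto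
  have "u z \<le> Max (c ` F)" if zK: "z \<in> K" for z
  proof -
    obtain y where y: "y \<in> F" "dist z y < e y" using F(3) zK by (auto simp: dist_commute)
    then have "u z < c y" using ce(3) F(1) zK by blast
    also have "c y \<le> Max (c ` F)" using F(2) y by simp
    finally show ?thesis by simp
  qed
  then have "s \<le> Max (c ` F)" unfolding s_def by (rule SUP_least)
  moreover have "Max (c ` F) < s" using F(1,2) Fne ce(1) by auto
  ultimately show False by simp
qed

text \<open>The two convolutions take their maxima at different points, while the bound on u + v is
  known only at a common one. Semicontinuity gives the bound near each point, and a Lebesgue number
  of the resulting cover makes the distance uniform.\<close>

lemma usc_doubling:
  fixes u v :: "real^'n \<Rightarrow> ereal" and \<phi> :: "real^'n \<Rightarrow> real"
  assumes K: "compact K" and usc: "usc_on K u" "usc_on K v" and cont: "continuous_on K \<phi>"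
    and le: "\<And>x. x \<in> K \<Longrightarrow> u x + v x \<le> ereal (\<phi> x)" and "\<kappa> > 0"
  obtains \<delta> where "\<delta> > 0" "\<And>y z. y \<in> K \<Longrightarrow> z \<in> K \<Longrightarrow> dist y z < \<delta> \<Longrightarrow> u y + v z \<le> ereal (\<phi> y + \<kappa>)"
proof -
  have "\<exists>e>0. \<forall>y\<in>K. \<forall>z\<in>K. dist y x < e \<longrightarrow> dist z x < e \<longrightarrow> u y + v z \<le> ereal (\<phi> y + \<kappa>)" if x: "x \<in> K" for x
  proof -
    have fin: "u x < \<infinity>" "v x < \<infinity>" using usc x unfolding usc_on_def by auto
    have "u x + v x < ereal (\<phi> x + \<kappa> / 2)"
      by (rule order_le_less_trans[OF le[OF x]]) (use \<open>\<kappa> > 0\<close> in simp)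
    then obtain a b :: real where ab: "u x < ereal a" "v x < ereal b" "ereal (a + b) \<le> ereal (\<phi> x + \<kappa> / 2)"
      using ereal_sum_less_split[OF fin] by blast
    obtain e1 where e1: "e1 > 0" "\<And>y. y \<in> K \<Longrightarrow> dist y x < e1 \<Longrightarrow> u y < ereal a"
      using usc(1) x ab unfolding usc_on_def by meson
    obtain e2 where e2: "e2 > 0" "\<And>y. y \<in> K \<Longrightarrow> dist y x < e2 \<Longrightarrow> v y < ereal b"
      using usc(2) x ab unfolding usc_on_def by meson
    obtain e3 where e3: "e3 > 0" "\<And>y. y \<in> K \<Longrightarrow> dist y x < e3 \<Longrightarrow> \<bar>\<phi> y - \<phi> x\<bar> < \<kappa> / 2"
      using cont x \<open>\<kappa> > 0\<close> unfolding continuous_on_iff dist_real_def by (metis half_gt_zero)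
    show ?thesis
    proof (intro exI[of _ "min e1 (min e2 e3)"] conjI ballI impI)
      fix y z assume yz: "y \<in> K" "z \<in> K" "dist y x < min e1 (min e2 e3)" "dist z x < min e1 (min e2 e3)"
      then have "u y + v z \<le> ereal a + ereal b" using e1(2)[of y] e2(2)[of z] by (intro add_mono) auto
      also have "\<dots> \<le> ereal (\<phi> x + \<kappa> / 2)" using ab(3) by simp
      also have "\<phi> x + \<kappa> / 2 \<le> \<phi> y + \<kappa>"
      proof -
        have "\<bar>\<phi> y - \<phi> x\<bar> < \<kappa> / 2" using e3(2) yz by simp
        then show ?thesis by linarith
      qed
      finally show "u y + v z \<le> ereal (\<phi> y + \<kappa>)" by simp
    qed (use e1 e2 e3 in simp)
  qed
  then obtain e where e: "\<And>x. x \<in> K \<Longrightarrow> e x > 0"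
    "\<And>x y z. x \<in> K \<Longrightarrow> y \<in> K \<Longrightarrow> z \<in> K \<Longrightarrow> dist y x < e x \<Longrightarrow> dist z x < e x \<Longrightarrow> u y + v z \<le> ereal (\<phi> y + \<kappa>)"
    by metis
  have "K \<subseteq> \<Union> ((\<lambda>x. ball x (e x)) ` K)" using e(1) by force
  then obtain d where d: "0 < d" "\<And>y. y \<in> K \<Longrightarrow> \<exists>G\<in>(\<lambda>x. ball x (e x)) ` K. ball y d \<subseteq> G"
    using Heine_Borel_lemma[OF K, of "(\<lambda>x. ball x (e x)) ` K"] by (metis (no_types, lifting) imageE open_ball)
  show thesis
  proof (rule that[OF d(1)])
    fix y z assume yz: "y \<in> K" "z \<in> K" "dist y z < d"
    obtain x where x: "x \<in> K" "ball y d \<subseteq> ball x (e x)" using d(2)[OF yz(1)] by blast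
    then have "y \<in> ball x (e x)" "z \<in> ball x (e x)" using yz d(1) by (auto simp: subset_iff)
    then show "u y + v z \<le> ereal (\<phi> y + \<kappa>)" using e(2)[OF x(1) yz(1,2)] by (simp add: dist_commute)
  qed
qed

text \<open>Here f x - |x|^2/(2 \<epsilon>) is the sup-convolution, the maximum over y in K of u y -
  |x - y|^2/(2 \<epsilon>), attained at Y x. Adding |x|^2/(2 \<epsilon>) leaves a maximum of
  functions affine in x, so Y x / \<epsilon> is a subgradient, bounded because K is. Finiteness of u
  at x0 keeps the maximum away from -infinity.\<close>

lemma sup_convolution:
  fixes u :: "real^'n \<Rightarrow> ereal"
  assumes K: "compact K" and usc: "usc_on K u" and x0: "x0 \<in> K" "u x0 \<noteq> - \<infinity>" and eps: "\<epsilon> > 0"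
  obtains f Y \<alpha> R where "convex_lip R f" "\<And>x. Y x \<in> K" "\<And>x. u (Y x) = ereal (\<alpha> x)"
    "\<And>x. f x - (norm x)\<^sup>2 / (2*\<epsilon>) = \<alpha> x - (norm (x - Y x))\<^sup>2 / (2*\<epsilon>)"
    "\<And>x y. y \<in> K \<Longrightarrow> u y \<le> ereal (f x - (norm x)\<^sup>2 / (2*\<epsilon>) + (norm (x - y))\<^sup>2 / (2*\<epsilon>))"
proof -
  define c where "c x y = - (norm (x - y))\<^sup>2 / (2*\<epsilon>)" for x y :: "real^'n"
  have "\<exists>y\<in>K. \<forall>z\<in>K. u z + ereal (c x z) \<le> u y + ereal (c x y)" for x
  proof (rule usc_attains_max[OF K])
    show "usc_on K (\<lambda>y. u y + ereal (c x y))"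
      unfolding c_def using eps by (intro usc_on_add usc usc_on_continuous continuous_intros) auto
  qed (use x0 in auto)
  then obtain Y where Y: "\<And>x. Y x \<in> K" "\<And>x z. z \<in> K \<Longrightarrow> u z + ereal (c x z) \<le> u (Y x) + ereal (c x (Y x))"
    by metis
  have "\<exists>a. u (Y x) = ereal a" for x
  proof -
    have "u (Y x) < \<infinity>" using usc Y(1) unfolding usc_on_def by blast
    moreover have "u (Y x) \<noteq> - \<infinity>" using Y(2)[OF x0(1), of x] x0(2) by auto
    ultimately show ?thesis by (cases "u (Y x)") auto
  qed
  then obtain \<alpha> where \<alpha>: "\<And>x. u (Y x) = ereal (\<alpha> x)" by metis
  define f where "f x = \<alpha> x + c x (Y x) + (norm x)\<^sup>2 / (2*\<epsilon>)" for x
  have up: "u y \<le> ereal (f x - (norm x)\<^sup>2 / (2*\<epsilon>) + (norm (x - y))\<^sup>2 / (2*\<epsilon>))" if "y \<in> K" for x y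
  proof -
    have "u y + ereal (c x y) \<le> ereal (\<alpha> x + c x (Y x))" using Y(2)[OF that, of x] \<alpha> by simp
    then show ?thesis by (cases "u y") (auto simp: f_def c_def)
  qed
  obtain R0 where R0: "\<And>y. y \<in> K \<Longrightarrow> norm y \<le> R0" using compact_imp_bounded[OF K] unfolding bounded_iff by blast
  have sq: "(norm (x - y))\<^sup>2 = (norm x)\<^sup>2 - 2 * (x \<bullet> y) + (norm y)\<^sup>2" for x y :: "real^'n"
    by (simp add: power2_norm_eq_inner inner_diff_left inner_diff_right inner_commute)
  have "convex_lip (R0 / \<epsilon>) f"
    unfolding convex_lip_def
  proof (intro allI bexI[of _ "(1/\<epsilon>) *\<^sub>R Y _"])
    fix x
    show "norm ((1/\<epsilon>) *\<^sub>R Y x) \<le> R0 / \<epsilon>" using R0[OF Y(1)] eps by (simp add: divide_right_mono)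
    show "(1/\<epsilon>) *\<^sub>R Y x \<in> subgrad f x"
      unfolding subgrad_def
    proof (clarify)
      fix y
      have "\<alpha> x \<le> f y - (norm y)\<^sup>2 / (2*\<epsilon>) + (norm (y - Y x))\<^sup>2 / (2*\<epsilon>)" using up[OF Y(1)[of x], of y] \<alpha> by simp
      moreover have "f x + (1/\<epsilon>) *\<^sub>R Y x \<bullet> (y - x) = \<alpha> x + (norm y)\<^sup>2 / (2*\<epsilon>) - (norm (y - Y x))\<^sup>2 / (2*\<epsilon>)"
        using eps unfolding f_def c_def sq by (simp add: inner_diff_right inner_commute field_simps)
      ultimately show "f x + (1/\<epsilon>) *\<^sub>R Y x \<bullet> (y - x) \<le> f y" by simp
    qed
  qed
  then show thesis by (rule that[OF _ Y(1) \<alpha> _ up]) (simp_all add: f_def c_def)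
qed

section \<open>Jensen's lemma and the theorem on sums\<close>

text \<open>
  Every small slope q is attained at some contact point, and the slope is a locally Lipschitz
  function of the contact point; hence the contact set cannot be contained in a null set.
\<close>
theorem Jensen_contact_point:
  fixes F g :: "'a::euclidean_space \<Rightarrow> real"
  assumes F: "convex_lip R F" and N: "negligible N" and cg: "continuous_on UNIV g"
    and exg: "\<And>x h. g (x + h) = g x + G x \<bullet> h + \<gamma> * (norm h)\<^sup>2"
    and lipG: "LG-lipschitz_on UNIV G" and rho: "\<rho> > 0"
    and bdry: "\<And>x. dist x0 x = \<rho> \<Longrightarrow> F x + g x \<le> F x0 + g x0 - m"
    and del: "\<delta> > 0" "\<delta> * \<rho> < m"
  obtains x q where "x \<notin> N" "dist x0 x < \<rho>" "norm q < \<delta>"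
    "\<And>x'. x' \<in> cball x0 \<rho> \<Longrightarrow> F x' + g x' \<le> F x + g x + q \<bullet> (x' - x)"
proof -
  define W where "W x = F x + g x" for x
  define E where "E = {x \<in> ball x0 \<rho>. \<exists>q\<in>ball 0 \<delta>. \<forall>x'\<in>cball x0 \<rho>. W x' \<le> W x + q \<bullet> (x' - x)}"
  obtain S where S: "\<And>x. S x \<in> subgrad F x" using F unfolding convex_lip_def by metis
  \<comment> \<open>S is an arbitrary choice of subgradients, but at a contact point the subgradient
    is unique, so Q maps a contact point to its slope q.\<close>
  define Q where "Q x = S x + G x" for x
  have lipF: "R-lipschitz_on UNIV F" by (rule convex_lip_lipschitz[OF F])
  have cW: "continuous_on UNIV W"
    unfolding W_def using lipschitz_on_continuous_on[OF lipF] cg by (intro continuous_intros)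
  have ex: "\<exists>x\<in>ball x0 \<rho>. \<forall>x'\<in>cball x0 \<rho>. W x' \<le> W x + q \<bullet> (x' - x)" if q: "norm q < \<delta>" for q
  proof -
    have "continuous_on (cball x0 \<rho>) (\<lambda>x. W x - q \<bullet> (x - x0))"
      by (intro continuous_intros continuous_on_subset[OF cW]) auto
    then obtain x where x: "x \<in> cball x0 \<rho>" "\<And>x'. x' \<in> cball x0 \<rho> \<Longrightarrow> W x' - q \<bullet> (x' - x0) \<le> W x - q \<bullet> (x - x0)"
      using continuous_attains_sup[OF compact_cball, of x0 \<rho> "\<lambda>x. W x - q \<bullet> (x - x0)"] rho by auto
    \<comment> \<open>On the sphere the function lies lower by m than at x0, and tilting by q
      recovers at most \<delta> * \<rho>, which is less than m.\<close>
    have "dist x0 x \<noteq> \<rho>"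
    proof
      assume d: "dist x0 x = \<rho>"
      have "W x0 \<le> W x - q \<bullet> (x - x0)" using x(2)[of x0] rho by simp
      moreover have "W x \<le> W x0 - m" using bdry[OF d] by (simp add: W_def)
      moreover have "\<bar>q \<bullet> (x - x0)\<bar> \<le> \<delta> * \<rho>"
      proof -
        have "\<bar>q \<bullet> (x - x0)\<bar> \<le> norm q * \<rho>"
          using Cauchy_Schwarz_ineq2[of q "x - x0"] d by (simp add: dist_norm norm_minus_commute)
        also have "\<dots> \<le> \<delta> * \<rho>" using q rho by (intro mult_right_mono) auto
        finally show ?thesis .
      qed
      ultimately show False using del by linarith
    qed
    then have "x \<in> ball x0 \<rho>" using x(1) by simp
    moreover have "W x' \<le> W x + q \<bullet> (x' - x)" if "x' \<in> cball x0 \<rho>" for x'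
      using x(2)[OF that] by (simp add: inner_diff_right)
    ultimately show ?thesis by blast
  qed
  have up: "F (x + h) \<le> F x + (q - G x) \<bullet> h + \<bar>\<gamma>\<bar> * (norm h)\<^sup>2"
    if x: "x \<in> ball x0 \<rho>" and c: "\<forall>x'\<in>cball x0 \<rho>. W x' \<le> W x + q \<bullet> (x' - x)"
      and h: "norm h < \<rho> - dist x0 x" for x q h
  proof -
    have "dist x0 (x + h) \<le> \<rho>"
      using h norm_triangle_ineq4[of "x0 - x" h] by (simp add: dist_norm algebra_simps)
    then have "W (x + h) \<le> W x + q \<bullet> h" using c[rule_format, of "x + h"] by simp
    then have "F (x + h) \<le> F x + (q - G x) \<bullet> h - \<gamma> * (norm h)\<^sup>2"
      unfolding W_def exg by (simp add: inner_diff_left)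
    moreover have "- \<gamma> * (norm h)\<^sup>2 \<le> \<bar>\<gamma>\<bar> * (norm h)\<^sup>2" by (intro mult_right_mono) auto
    ultimately show ?thesis by simp
  qed
  have slope: "q - G x = S x" if x: "x \<in> ball x0 \<rho>" and c: "\<forall>x'\<in>cball x0 \<rho>. W x' \<le> W x + q \<bullet> (x' - x)" for x q
    using upper_paraboloid_slope_eq_subgrad[OF S up[OF x c], of "\<rho> - dist x0 x"] x by simp
  have "ball 0 \<delta> \<subseteq> Q ` E"
  proof
    fix q :: 'a assume "q \<in> ball 0 \<delta>"
    then have "norm q < \<delta>" by simp
    then obtain x where x: "x \<in> ball x0 \<rho>" "\<forall>x'\<in>cball x0 \<rho>. W x' \<le> W x + q \<bullet> (x' - x)" using ex by blast
    then have "q = Q x" using slope unfolding Q_def by (metis diff_add_cancel)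
    moreover have "x \<in> E" using x \<open>q \<in> ball 0 \<delta>\<close> unfolding E_def by blast
    ultimately show "q \<in> Q ` E" by blast
  qed
  moreover have "\<not> negligible (ball (0::'a) \<delta>)" using del(1) by (intro open_not_negligible) auto
  ultimately have nn: "\<not> negligible (Q ` E)" using negligible_subset by blast
  have "\<not> E \<subseteq> N"
  proof
    assume "E \<subseteq> N"
    then have "negligible E" using N negligible_subset by blast
    then have "negligible (Q ` E)"
    proof (rule negligible_locally_Lipschitz_image[OF order_refl])
      fix x assume xE: "x \<in> E"
      then obtain q where x: "x \<in> ball x0 \<rho>" "\<forall>x'\<in>cball x0 \<rho>. W x' \<le> W x + q \<bullet> (x' - x)" unfolding E_def by blast
      have sl: "q - G x = S x" using slope[OF x] .
      define T where "T = ball x ((\<rho> - dist x0 x) / 2)"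
      have "norm (Q y - Q x) \<le> (4 * \<bar>\<gamma>\<bar> + LG) * norm (y - x)" if "y \<in> T" for y
      proof -
        have d: "norm (y - x) < (\<rho> - dist x0 x) / 2" using that by (simp add: T_def dist_norm norm_minus_commute)
        have "norm (S y - S x) \<le> 4 * \<bar>\<gamma>\<bar> * norm (y - x)"
          by (rule subgrad_near_upper_paraboloid[OF S _ _ d]) (use up[OF x] sl S in auto)
        moreover have "norm (G y - G x) \<le> LG * norm (y - x)" using lipschitz_onD[OF lipG, of y x] by (simp add: dist_norm)
        moreover have "norm (Q y - Q x) \<le> norm (S y - S x) + norm (G y - G x)"
          unfolding Q_def by (metis add_diff_add norm_triangle_ineq)
        ultimately show ?thesis by (simp add: distrib_right)
      qed
      moreover have "open T" "x \<in> T" using x(1) by (simp_all add: T_def)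
      ultimately show "\<exists>T B. open T \<and> x \<in> T \<and> (\<forall>y\<in>E \<inter> T. norm (Q y - Q x) \<le> B * norm (y - x))" by blast
    qed
    then show False using nn by simp
  qed
  then obtain x where "x \<in> E" "x \<notin> N" by blast
  then show thesis using that unfolding E_def W_def by auto
qed

lemma subgrad_add:
  assumes "s \<in> subgrad f x" "t \<in> subgrad g x"
  shows "s + t \<in> subgrad (\<lambda>x. f x + g x) x"
proof -
  have "f x + g x + (s + t) \<bullet> (y - x) \<le> f y + g y" for y
    using subgradD[OF assms(1), of y] subgradD[OF assms(2), of y] by (simp add: inner_add_left)
  then show ?thesis by (simp add: subgrad_def)
qed

lemma convex_lip_add:
  assumes "convex_lip R f" "convex_lip S g"
  shows "convex_lip (R + S) (\<lambda>x. f x + g x)"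
  unfolding convex_lip_def
proof
  fix x
  obtain s where s: "s \<in> subgrad f x" "norm s \<le> R" using assms(1) unfolding convex_lip_def by blast
  obtain t where t: "t \<in> subgrad g x" "norm t \<le> S" using assms(2) unfolding convex_lip_def by blast
  have "s + t \<in> subgrad (\<lambda>x. f x + g x) x" using s(1) t(1) by (rule subgrad_add)
  moreover have "norm (s + t) \<le> R + S" using s(2) t(2) norm_triangle_ineq[of s t] by linarith
  ultimately show "\<exists>s\<in>subgrad (\<lambda>x. f x + g x) x. norm s \<le> R + S" by blast
qed

lemma quadratic_form_bound_global:
  fixes A :: "'a::real_inner \<Rightarrow> 'a"
  assumes lin: "linear A" and "\<delta> > 0"
    and loc: "\<And>h. norm h < \<delta> \<Longrightarrow> h \<bullet> A h \<le> C * (norm h)\<^sup>2"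
  shows "h \<bullet> A h \<le> C * (norm h)\<^sup>2"
proof (cases "h = 0")
  case False
  define t where "t = \<delta> / (2 * norm h)"
  have t: "t > 0" using False \<open>\<delta> > 0\<close> by (simp add: t_def)
  have "norm (t *\<^sub>R h) = \<delta> / 2" using False \<open>\<delta> > 0\<close> by (simp add: t_def)
  then have "norm (t *\<^sub>R h) < \<delta>" using \<open>\<delta> > 0\<close> by simp
  from loc[OF this] have "t\<^sup>2 * (h \<bullet> A h) \<le> t\<^sup>2 * (C * (norm h)\<^sup>2)"
    using lin by (simp add: linear_scale power_mult_distrib) (simp add: power2_eq_square mult_ac)
  then show ?thesis using t by simp
qed (use lin in \<open>simp add: linear_0\<close>)

text \<open>Moving x and y by the same h leaves the penalty |x - y|^2 unchanged, so an upper
  expansion of the convolution at x is one of u at the maximizing point y, with the same slope and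
  Hessian. The remainder \<eta> |h|^2 is put into the matrix as 2 \<eta>, which leaves an exact
  quadratic bound.\<close>

lemma expansion_transfer:
  fixes u :: "'a::real_inner \<Rightarrow> ereal"
  assumes ex: "\<And>h. norm h < \<delta> \<Longrightarrow> \<bar>f (x + h) - f x - s \<bullet> h - (h \<bullet> A h) / 2\<bar> \<le> \<eta> * (norm h)\<^sup>2"
    and val: "f x - (norm x)\<^sup>2 / (2*\<epsilon>) = \<alpha> - (norm (x - y))\<^sup>2 / (2*\<epsilon>)"
    and up: "\<And>x y. y \<in> K \<Longrightarrow> u y \<le> ereal (f x - (norm x)\<^sup>2 / (2*\<epsilon>) + (norm (x - y))\<^sup>2 / (2*\<epsilon>))"
    and h: "norm h < \<delta>" "y + h \<in> K" and "\<epsilon> > 0"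
  shows "u (y + h) \<le> ereal (\<alpha> + (s - (1/\<epsilon>) *\<^sub>R x) \<bullet> h + (h \<bullet> (A h - (1/\<epsilon>) *\<^sub>R h + (2*\<eta>) *\<^sub>R h)) / 2)"
proof -
  have "u (y + h) \<le> ereal (f (x + h) - (norm (x + h))\<^sup>2 / (2*\<epsilon>) + (norm ((x + h) - (y + h)))\<^sup>2 / (2*\<epsilon>))"
    using up[OF h(2)] .
  also have "f (x + h) - (norm (x + h))\<^sup>2 / (2*\<epsilon>) + (norm ((x + h) - (y + h)))\<^sup>2 / (2*\<epsilon>)
    \<le> \<alpha> + (s - (1/\<epsilon>) *\<^sub>R x) \<bullet> h + (h \<bullet> (A h - (1/\<epsilon>) *\<^sub>R h + (2*\<eta>) *\<^sub>R h)) / 2"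
  proof -
    have "(norm (x + h))\<^sup>2 / (2*\<epsilon>) = (norm x)\<^sup>2 / (2*\<epsilon>) + (1/\<epsilon>) * (x \<bullet> h) + (1/\<epsilon>) * (norm h)\<^sup>2 / 2"
      using \<open>\<epsilon> > 0\<close> by (simp add: power2_norm_eq_inner inner_add_left inner_add_right inner_commute field_simps)
    moreover have "(h \<bullet> (A h - (1/\<epsilon>) *\<^sub>R h + (2*\<eta>) *\<^sub>R h)) / 2 = (h \<bullet> A h) / 2 - (1/\<epsilon>) * (norm h)\<^sup>2 / 2 + \<eta> * (norm h)\<^sup>2"
      by (simp add: power2_norm_eq_inner inner_add_right inner_diff_right field_simps)
    moreover have "(s - (1/\<epsilon>) *\<^sub>R x) \<bullet> h = s \<bullet> h - (1/\<epsilon>) * (x \<bullet> h)" by (simp add: inner_diff_left)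
    moreover have "(x + h) - (y + h) = x - y" by simp
    ultimately show ?thesis using abs_le_D1[OF ex[OF h(1)]] val by (simp only:)
  qed
  finally show ?thesis by simp
qed

text \<open>Contact with a strictly concave paraboloid pays for everything. Of the Hessian margin
  2c, one half localizes the perturbed contact point near x0, and half of the remaining c absorbs
  the errors of the second-order expansions, which leaves c/2.\<close>

theorem usc_theorem_on_sums:
  fixes u v :: "real^'n \<Rightarrow> ereal"
  assumes c: "c > 0" and rho: "\<rho> > 0" and usc: "usc_on (cball x0 \<rho>) u" "usc_on (cball x0 \<rho>) v"
    and a: "u x0 = ereal a" and b: "v x0 = ereal b"
    and le: "\<forall>x\<in>cball x0 \<rho>. u x + v x \<le> ereal (a + b + p \<bullet> (x - x0) - c * (norm (x - x0))\<^sup>2)"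
    and th: "\<theta> > 0"
  obtains y z A B \<alpha> \<beta> d s t where "dist x0 y < \<rho>" "dist x0 z < \<rho>" "dist y z < \<theta>" "linear A" "linear B"
    "\<And>h. h \<bullet> (A h + B h) \<le> - (c/2) * (norm h)\<^sup>2" "u y = ereal \<alpha>" "v z = ereal \<beta>" "\<alpha> + \<beta> \<ge> a + b - \<theta>"
    "d > 0" "\<And>h. norm h < d \<Longrightarrow> u (y + h) \<le> ereal (\<alpha> + s \<bullet> h + (h \<bullet> A h) / 2)"
    "\<And>h. norm h < d \<Longrightarrow> v (z + h) \<le> ereal (\<beta> + t \<bullet> h + (h \<bullet> B h) / 2)"
proof -
  let ?K = "cball x0 \<rho>"
  define \<phi> where "\<phi> x = a + b + p \<bullet> (x - x0) - c * (norm (x - x0))\<^sup>2" for x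
  have K: "compact ?K" "x0 \<in> ?K" using rho by auto
  have c\<phi>: "continuous_on S \<phi>" for S unfolding \<phi>_def by (intro continuous_intros)
  \<comment> \<open>Moving from x0 to a contact point within r, with tilt at most 1, costs at most
    this much in value. The bound \<rho> / 2 leaves room for the further shift, below \<sigma>, to
    the base points.\<close>
  obtain r where r: "0 < r" "r \<le> \<rho> / 2" "(norm p + 1) * r + c * r\<^sup>2 \<le> \<theta>"
  proof -
    define r where "r = min (\<rho> / 2) (min 1 (\<theta> / (norm p + 1 + c)))"
    have pos: "norm p + 1 + c > 0" using c by (simp add: add_nonneg_pos)
    have "\<theta> / (norm p + 1 + c) > 0" using th pos by simp
    then have r: "0 < r" "r \<le> \<rho> / 2" "r \<le> 1" using rho unfolding r_def by linarith+
    have "(norm p + 1) * r + c * r\<^sup>2 \<le> (norm p + 1) * r + c * r"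
      using r c by (simp add: power2_eq_square mult_left_le)
    also have "\<dots> = (norm p + 1 + c) * r" by (simp add: algebra_simps)
    also have "\<dots> \<le> (norm p + 1 + c) * (\<theta> / (norm p + 1 + c))" using pos by (intro mult_left_mono) (auto simp: r_def)
    also have "\<dots> = \<theta>" using pos by simp
    finally show thesis using that r by blast
  qed
  \<comment> \<open>Half of the paraboloid drops by c * r^2 / 2 = 4 \<kappa> on the sphere of radius
    r. One \<kappa> is lost to doubling, and of the 2 \<kappa> used afterwards the tilt \<delta>0 *
    r takes at most one.\<close>
  define \<kappa> where "\<kappa> = c * r\<^sup>2 / 8"
  have kap: "\<kappa> > 0" using c r by (simp add: \<kappa>_def)
  define \<delta>0 where "\<delta>0 = min 1 (c * r / 8)"
  have del0: "\<delta>0 > 0" "\<delta>0 \<le> 1" "\<delta>0 * r \<le> \<kappa>"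
  proof -
    show "\<delta>0 > 0" "\<delta>0 \<le> 1" using c r by (auto simp: \<delta>0_def)
    have "\<delta>0 * r \<le> (c * r / 8) * r" using r by (intro mult_right_mono) (auto simp: \<delta>0_def)
    then show "\<delta>0 * r \<le> \<kappa>" by (simp add: \<kappa>_def power2_eq_square)
  qed
  obtain \<delta>1 where d1: "\<delta>1 > 0" "\<And>y z. y \<in> ?K \<Longrightarrow> z \<in> ?K \<Longrightarrow> dist y z < \<delta>1 \<Longrightarrow> u y + v z \<le> ereal (\<phi> y + \<kappa> / 2)"
    using usc_doubling[OF K(1) usc c\<phi>, of "\<kappa> / 2"] le kap unfolding \<phi>_def by auto
  obtain \<delta>2 where d2: "\<delta>2 > 0" "\<And>x y. x \<in> ?K \<Longrightarrow> y \<in> ?K \<Longrightarrow> dist x y < \<delta>2 \<Longrightarrow> dist (\<phi> x) (\<phi> y) < \<kappa> / 2"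
    using compact_uniformly_continuous[OF c\<phi> K(1)] kap unfolding uniformly_continuous_on_def
    by (metis dist_commute half_gt_zero)
  have "\<exists>M. \<forall>x\<in>?K. w x \<le> ereal M" if w: "usc_on ?K w" for w :: "real^'n \<Rightarrow> ereal"
  proof -
    obtain y where y: "y \<in> ?K" "\<forall>z\<in>?K. w z \<le> w y" using usc_attains_max[OF K(1) _ w] K(2) by blast
    have "w y < \<infinity>" using w y(1) unfolding usc_on_def by blast
    then obtain M :: real where "w y \<le> ereal M" by (metis ereal_dense2 less_imp_le)
    then show ?thesis using y(2) order_trans by blast
  qed
  then obtain Mu Mv where Mu: "\<And>x. x \<in> ?K \<Longrightarrow> u x \<le> ereal Mu" and Mv: "\<And>x. x \<in> ?K \<Longrightarrow> v x \<le> ereal Mv"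
    using usc by metis
  obtain m where m: "\<And>x. x \<in> ?K \<Longrightarrow> m \<le> \<phi> x"
    using continuous_attains_inf[OF K(1) _ c\<phi>] K(2) by blast
  \<comment> \<open>T bounds the penalties wherever U + V is not too negative. The summands cover
    both later uses: points with U + V at least m, and the contact point with U + V at least a + b -
    \<theta>.\<close>
  define T where "T = \<bar>Mu\<bar> + \<bar>Mv\<bar> + \<bar>m\<bar> + \<bar>a + b\<bar> + \<theta> + 1"
  have T: "T > 0" using th by (simp add: T_def add_nonneg_pos)
  define \<sigma> where "\<sigma> = min (min (\<delta>1 / 2) \<delta>2) (min (\<rho> / 2) (\<theta> / 2))"
  have sig: "\<sigma> > 0" "2 * \<sigma> \<le> \<delta>1" "\<sigma> \<le> \<delta>2" "\<sigma> \<le> \<rho> / 2" "2 * \<sigma> \<le> \<theta>"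
    using d1(1) d2(1) rho th unfolding \<sigma>_def by linarith+
  \<comment> \<open>A penalty of at most T then means a squared distance of at most \<sigma>^2 / 2,
    so the base points lie within \<sigma> of x.\<close>
  define \<epsilon> where "\<epsilon> = \<sigma>\<^sup>2 / (4 * T)"
  have eps: "\<epsilon> > 0" using sig T by (simp add: \<epsilon>_def)
  have close: "n < \<sigma>" if "n\<^sup>2 / (2*\<epsilon>) \<le> T" "n \<ge> 0" for n
  proof -
    have "n\<^sup>2 \<le> 2 * \<epsilon> * T" using that eps by (simp add: field_simps)
    also have "\<dots> = \<sigma>\<^sup>2 / 2" using T by (simp add: \<epsilon>_def)
    also have "\<dots> < \<sigma>\<^sup>2" using sig by simp
    finally show ?thesis using sig by (meson less_imp_le power_less_imp_less_base)
  qed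
  obtain f Y \<alpha> Ru where f: "convex_lip Ru f" "\<And>x. Y x \<in> ?K" "\<And>x. u (Y x) = ereal (\<alpha> x)"
    "\<And>x. f x - (norm x)\<^sup>2 / (2*\<epsilon>) = \<alpha> x - (norm (x - Y x))\<^sup>2 / (2*\<epsilon>)"
    "\<And>x y. y \<in> ?K \<Longrightarrow> u y \<le> ereal (f x - (norm x)\<^sup>2 / (2*\<epsilon>) + (norm (x - y))\<^sup>2 / (2*\<epsilon>))"
    using sup_convolution[OF K(1) usc(1) K(2) _ eps] a by (metis MInfty_neq_ereal(1))
  obtain g Z \<beta> Rv where g: "convex_lip Rv g" "\<And>x. Z x \<in> ?K" "\<And>x. v (Z x) = ereal (\<beta> x)"
    "\<And>x. g x - (norm x)\<^sup>2 / (2*\<epsilon>) = \<beta> x - (norm (x - Z x))\<^sup>2 / (2*\<epsilon>)"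
    "\<And>x y. y \<in> ?K \<Longrightarrow> v y \<le> ereal (g x - (norm x)\<^sup>2 / (2*\<epsilon>) + (norm (x - y))\<^sup>2 / (2*\<epsilon>))"
    using sup_convolution[OF K(1) usc(2) K(2) _ eps] b by (metis MInfty_neq_ereal(1))
  define U where "U x = f x - (norm x)\<^sup>2 / (2*\<epsilon>)" for x
  define V where "V x = g x - (norm x)\<^sup>2 / (2*\<epsilon>)" for x
  have aM: "\<alpha> x \<le> Mu" "\<beta> x \<le> Mv" for x using Mu[OF f(2)[of x]] Mv[OF g(2)[of x]] f(3) g(3) by auto
  have nn: "n\<^sup>2 / (2*\<epsilon>) \<ge> 0" for n using eps by simp
  have near: "norm (x - Y x) < \<sigma>" "norm (x - Z x) < \<sigma>" if "U x + V x \<ge> - (T - \<bar>Mu\<bar> - \<bar>Mv\<bar>)" for x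
  proof -
    have "(norm (x - Y x))\<^sup>2 / (2*\<epsilon>) \<le> T" "(norm (x - Z x))\<^sup>2 / (2*\<epsilon>) \<le> T"
      using that f(4)[of x] g(4)[of x] aM[of x] nn[of "norm (x - Y x)"] nn[of "norm (x - Z x)"]
      unfolding U_def V_def by linarith+
    then show "norm (x - Y x) < \<sigma>" "norm (x - Z x) < \<sigma>" using close by auto
  qed
  \<comment> \<open>If U + V is at least the minimum m of \<phi>, the base points are close and the
    doubling bound applies; if it is below m, the inequality is immediate.\<close>
  have UV: "U x + V x \<le> \<phi> x + \<kappa>" if x: "x \<in> ?K" for x
  proof (cases "U x + V x \<ge> m")
    case True
    then have "U x + V x \<ge> - (T - \<bar>Mu\<bar> - \<bar>Mv\<bar>)" using th unfolding T_def by linarith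
    note n = near[OF this]
    have "dist (Y x) (Z x) < \<delta>1"
      using dist_triangle[of "Y x" "Z x" x] n sig(2) by (simp add: dist_norm norm_minus_commute)
    then have "\<alpha> x + \<beta> x \<le> \<phi> (Y x) + \<kappa> / 2" using d1(2)[OF f(2) g(2)] f(3) g(3) by (metis ereal_less_eq(3) plus_ereal.simps(1))
    moreover have "dist (\<phi> x) (\<phi> (Y x)) < \<kappa> / 2" using n(1) sig(3) by (intro d2(2) x f(2)) (simp add: dist_norm)
    ultimately show ?thesis
      using f(4)[of x] g(4)[of x] nn[of "norm (x - Y x)"] nn[of "norm (x - Z x)"]
      unfolding U_def V_def dist_real_def by linarith
  next
    case False
    then show ?thesis using m[OF x] kap by linarith
  qed
  have UVx0: "U x0 \<ge> a" "V x0 \<ge> b" using f(5)[OF K(2), of x0] g(5)[OF K(2), of x0] a b by (simp_all add: U_def V_def)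
  define F where "F x = f x + g x" for x
  \<comment> \<open>w restores the two quadratics removed from f and g, subtracts the slope p and
    gives back half of the paraboloid. Contact of F + w with an affine function thus means that U +
    V is touched from above by a paraboloid of Hessian -c, while the other half still provides the
    drop on the sphere.\<close>
  define w where "w x = - (norm x)\<^sup>2 / \<epsilon> - p \<bullet> (x - x0) + (c/2) * (norm (x - x0))\<^sup>2" for x
  define G where "G x = - (2/\<epsilon>) *\<^sub>R x - p + c *\<^sub>R (x - x0)" for x
  define \<gamma> where "\<gamma> = c/2 - 1/\<epsilon>"
  have W: "F x + w x = U x + V x - p \<bullet> (x - x0) + (c/2) * (norm (x - x0))\<^sup>2" for x
    using eps by (simp add: F_def w_def U_def V_def field_simps)
  have exw: "w (x + h) = w x + G x \<bullet> h + \<gamma> * (norm h)\<^sup>2" for x h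
    using eps unfolding w_def G_def \<gamma>_def power2_norm_eq_inner
    by (simp add: inner_add_left inner_add_right inner_diff_left inner_diff_right inner_commute field_simps)
  obtain N1 where N1: "negligible N1"
    "\<And>x s \<rho> \<Lambda>. \<lbrakk>x \<notin> N1; \<rho> > 0; \<Lambda> \<ge> 0; s \<in> subgrad f x;
        \<And>h. norm h < \<rho> \<Longrightarrow> f (x + h) \<le> f x + s \<bullet> h + \<Lambda> * (norm h)\<^sup>2\<rbrakk> \<Longrightarrow>
      \<exists>A. linear A \<and> (\<forall>\<eta>>0. \<exists>\<delta>>0. \<forall>h. norm h < \<delta> \<longrightarrow>
         \<bar>f (x + h) - f x - s \<bullet> h - (h \<bullet> A h) / 2\<bar> \<le> \<eta> * (norm h)\<^sup>2)"
    by (fact Alexandrov_at_upper_paraboloids[OF f(1)])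
  obtain N2 where N2: "negligible N2"
    "\<And>x s \<rho> \<Lambda>. \<lbrakk>x \<notin> N2; \<rho> > 0; \<Lambda> \<ge> 0; s \<in> subgrad g x;
        \<And>h. norm h < \<rho> \<Longrightarrow> g (x + h) \<le> g x + s \<bullet> h + \<Lambda> * (norm h)\<^sup>2\<rbrakk> \<Longrightarrow>
      \<exists>A. linear A \<and> (\<forall>\<eta>>0. \<exists>\<delta>>0. \<forall>h. norm h < \<delta> \<longrightarrow>
         \<bar>g (x + h) - g x - s \<bullet> h - (h \<bullet> A h) / 2\<bar> \<le> \<eta> * (norm h)\<^sup>2)"
    by (fact Alexandrov_at_upper_paraboloids[OF g(1)])
  obtain x q where x: "x \<notin> N1 \<union> N2" "dist x0 x < r" "norm q < \<delta>0"
    "\<And>x'. x' \<in> cball x0 r \<Longrightarrow> F x' + w x' \<le> F x + w x + q \<bullet> (x' - x)"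
  proof (rule Jensen_contact_point[of "Ru + Rv" F "N1 \<union> N2" w G \<gamma> "2/\<epsilon> + c" r x0 "2 * \<kappa>" \<delta>0])
    show "convex_lip (Ru + Rv) F" unfolding F_def using f(1) g(1) by (rule convex_lip_add)
    show "negligible (N1 \<union> N2)" using N1(1) N2(1) by simp
    show "continuous_on UNIV w" unfolding w_def using eps by (intro continuous_intros) auto
    show "(2/\<epsilon> + c)-lipschitz_on UNIV G"
    proof (rule lipschitz_onI)
      fix x y
      have "G x - G y = (c - 2/\<epsilon>) *\<^sub>R (x - y)" by (simp add: G_def algebra_simps)
      then have "norm (G x - G y) = \<bar>c - 2/\<epsilon>\<bar> * norm (x - y)" by simp
      also have "\<dots> \<le> (2/\<epsilon> + c) * norm (x - y)" using c eps by (intro mult_right_mono) (auto simp: abs_le_iff)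
      finally show "dist (G x) (G y) \<le> (2/\<epsilon> + c) * dist x y" by (simp add: dist_norm)
    qed (use c eps in simp)
    show "F x + w x \<le> F x0 + w x0 - 2 * \<kappa>" if "dist x0 x = r" for x
    proof -
      have nr: "norm (x - x0) = r" using that by (simp add: dist_norm norm_minus_commute)
      have "x \<in> ?K" using that r rho by simp
      from UV[OF this] have "F x + w x \<le> a + b - c * r\<^sup>2 / 2 + \<kappa>" unfolding W \<phi>_def nr by simp
      moreover have "a + b \<le> F x0 + w x0" using UVx0 unfolding W by simp
      moreover have "c * r\<^sup>2 / 2 = 4 * \<kappa>" by (simp add: \<kappa>_def)
      ultimately show ?thesis using kap by linarith
    qed
    show "\<delta>0 * r < 2 * \<kappa>" using del0 kap by linarith
  qed (use exw r del0 in auto)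
  have xr: "norm (x - x0) < r" using x(2) by (simp add: dist_norm norm_minus_commute)
  \<comment> \<open>The contact inequality is tested at x0, where the convolutions are at least a
    and b. Passing from U x and V x to the values at the base points later adds the penalties and
    only helps.\<close>
  have low: "U x + V x \<ge> a + b - \<theta>"
  proof -
    have "F x0 + w x0 \<le> F x + w x + q \<bullet> (x0 - x)" using x(4)[of x0] r by simp
    then have "a + b \<le> U x + V x - p \<bullet> (x - x0) + (c/2) * (norm (x - x0))\<^sup>2 - q \<bullet> (x - x0)"
      using UVx0 unfolding W by (simp add: inner_diff_right)
    moreover have "\<bar>p \<bullet> (x - x0)\<bar> \<le> norm p * r"
      using Cauchy_Schwarz_ineq2[of p "x - x0"] xr by (meson less_imp_le mult_left_mono norm_ge_zero order_trans)
    moreover have "\<bar>q \<bullet> (x - x0)\<bar> \<le> 1 * r"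
      using Cauchy_Schwarz_ineq2[of q "x - x0"] mult_mono[of "norm q" 1 "norm (x - x0)" r] xr x(3) del0(2) by simp
    moreover have "(c/2) * (norm (x - x0))\<^sup>2 \<le> c * r\<^sup>2"
      using c xr by (intro mult_mono power_mono) auto
    ultimately show ?thesis using r(3) by (simp add: distrib_right)
  qed
  have "U x + V x \<ge> - (T - \<bar>Mu\<bar> - \<bar>Mv\<bar>)" using low unfolding T_def by linarith
  note n = near[OF this]
  obtain s where s: "s \<in> subgrad f x" using f(1) unfolding convex_lip_def by blast
  obtain t where t: "t \<in> subgrad g x" using g(1) unfolding convex_lip_def by blast
  have st: "s + t \<in> subgrad F x" unfolding F_def[abs_def] using s t by (rule subgrad_add)
  define d0 where "d0 = r - dist x0 x"
  have d0: "d0 > 0" using x(2) by (simp add: d0_def)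
  have upF: "F (x + h) \<le> F x + (q - G x) \<bullet> h - \<gamma> * (norm h)\<^sup>2" if "norm h < d0" for h
  proof -
    have "dist x0 (x + h) \<le> r"
      using that norm_triangle_ineq4[of "x0 - x" h] by (simp add: d0_def dist_norm algebra_simps)
    then have "F (x + h) + w (x + h) \<le> F x + w x + q \<bullet> h" using x(4)[of "x + h"] by simp
    then show ?thesis unfolding exw by (simp add: inner_diff_left)
  qed
  have upF': "F (x + h) \<le> F x + (q - G x) \<bullet> h + \<bar>\<gamma>\<bar> * (norm h)\<^sup>2" if "norm h < d0" for h
  proof -
    have "- \<gamma> * (norm h)\<^sup>2 \<le> \<bar>\<gamma>\<bar> * (norm h)\<^sup>2" by (intro mult_right_mono) auto
    then show ?thesis using upF[OF that] by simp
  qed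
  have qG: "q - G x = s + t" using upper_paraboloid_slope_eq_subgrad[OF st upF' _ d0] by simp
  \<comment> \<open>Subtracting the affine lower bound of one convex summand from the paraboloid of
    the sum gives a paraboloid for the other. This supplies the hypothesis of
    \<open>Alexandrov_at_upper_paraboloids\<close> for f and g separately.\<close>
  have upf: "f (x + h) \<le> f x + s \<bullet> h + \<bar>\<gamma>\<bar> * (norm h)\<^sup>2" if "norm h < d0" for h
    using upF'[OF that] subgradD[OF t, of "x + h"] unfolding qG by (simp add: F_def inner_add_left)
  have upg: "g (x + h) \<le> g x + t \<bullet> h + \<bar>\<gamma>\<bar> * (norm h)\<^sup>2" if "norm h < d0" for h
    using upF'[OF that] subgradD[OF s, of "x + h"] unfolding qG by (simp add: F_def inner_add_left)
  obtain A0 where A0: "linear A0" "\<And>\<eta>. \<eta> > 0 \<Longrightarrow> \<exists>\<delta>>0. \<forall>h. norm h < \<delta> \<longrightarrow>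
         \<bar>f (x + h) - f x - s \<bullet> h - (h \<bullet> A0 h) / 2\<bar> \<le> \<eta> * (norm h)\<^sup>2"
    using N1(2)[of x d0 "\<bar>\<gamma>\<bar>" s] x(1) d0 s upf by auto
  obtain B0 where B0: "linear B0" "\<And>\<eta>. \<eta> > 0 \<Longrightarrow> \<exists>\<delta>>0. \<forall>h. norm h < \<delta> \<longrightarrow>
         \<bar>g (x + h) - g x - t \<bullet> h - (h \<bullet> B0 h) / 2\<bar> \<le> \<eta> * (norm h)\<^sup>2"
    using N2(2)[of x d0 "\<bar>\<gamma>\<bar>" t] x(1) d0 t upg by auto
  \<comment> \<open>The remainders enter eight times: 4 \<eta> when the expansions are compared with
    the contact paraboloid and 4 \<eta> when they are moved into A and B. Together they use
    c/2.\<close>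
  define \<eta> where "\<eta> = c / 16"
  have eta: "\<eta> > 0" using c by (simp add: \<eta>_def)
  obtain dA where dA: "dA > 0" "\<And>h. norm h < dA \<Longrightarrow> \<bar>f (x + h) - f x - s \<bullet> h - (h \<bullet> A0 h) / 2\<bar> \<le> \<eta> * (norm h)\<^sup>2"
    using A0(2)[OF eta] by blast
  obtain dB where dB: "dB > 0" "\<And>h. norm h < dB \<Longrightarrow> \<bar>g (x + h) - g x - t \<bullet> h - (h \<bullet> B0 h) / 2\<bar> \<le> \<eta> * (norm h)\<^sup>2"
    using B0(2)[OF eta] by blast
  have quad: "h \<bullet> (A0 h + B0 h) \<le> (4 * \<eta> - 2 * \<gamma>) * (norm h)\<^sup>2" for h
  proof (rule quadratic_form_bound_global[where A="\<lambda>h. A0 h + B0 h" and \<delta>="min d0 (min dA dB)"])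
    show "linear (\<lambda>h. A0 h + B0 h)" using A0(1) B0(1) by (rule linear_compose_add)
    show "min d0 (min dA dB) > 0" using d0 dA(1) dB(1) by simp
    fix h :: "real^'n" assume h: "norm h < min d0 (min dA dB)"
    have "F (x + h) \<le> F x + (s + t) \<bullet> h - \<gamma> * (norm h)\<^sup>2" using upF[of h] h unfolding qG by simp
    moreover have "\<bar>f (x + h) - f x - s \<bullet> h - (h \<bullet> A0 h) / 2\<bar> \<le> \<eta> * (norm h)\<^sup>2" using dA(2) h by simp
    moreover have "\<bar>g (x + h) - g x - t \<bullet> h - (h \<bullet> B0 h) / 2\<bar> \<le> \<eta> * (norm h)\<^sup>2" using dB(2) h by simp
    ultimately have "(h \<bullet> A0 h) / 2 + (h \<bullet> B0 h) / 2 \<le> 2 * (\<eta> * (norm h)\<^sup>2) - \<gamma> * (norm h)\<^sup>2"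
      unfolding F_def inner_add_left by linarith
    then show "h \<bullet> (A0 h + B0 h) \<le> (4 * \<eta> - 2 * \<gamma>) * (norm h)\<^sup>2"
      by (simp add: inner_add_right algebra_simps)
  qed
  define A where "A h = A0 h - (1/\<epsilon>) *\<^sub>R h + (2*\<eta>) *\<^sub>R h" for h
  define B where "B h = B0 h - (1/\<epsilon>) *\<^sub>R h + (2*\<eta>) *\<^sub>R h" for h
  have dy: "dist x0 (Y x) < \<rho>" "dist x0 (Z x) < \<rho>"
    using dist_triangle[of x0 "Y x" x] dist_triangle[of x0 "Z x" x] n x(2) r(2) sig(4)
    by (simp_all add: dist_norm norm_minus_commute)
  define d where "d = min (min dA dB) (min (\<rho> - dist x0 (Y x)) (\<rho> - dist x0 (Z x)))"
  have inK: "y + h \<in> ?K" if "norm h < \<rho> - dist x0 y" for y h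
    using that norm_triangle_ineq4[of "x0 - y" h] by (simp add: dist_norm algebra_simps)
  show thesis
  proof (rule that[of "Y x" "Z x" A B "\<alpha> x" "\<beta> x" d "s - (1/\<epsilon>) *\<^sub>R x" "t - (1/\<epsilon>) *\<^sub>R x"])
    show "dist (Y x) (Z x) < \<theta>"
      using dist_triangle[of "Y x" "Z x" x] n sig(5) by (simp add: dist_norm norm_minus_commute)
    show "linear A" unfolding A_def
      by (intro linear_compose_add linear_compose_sub linear_compose_scale_right linear_ident A0(1))
    show "linear B" unfolding B_def
      by (intro linear_compose_add linear_compose_sub linear_compose_scale_right linear_ident B0(1))
    show "h \<bullet> (A h + B h) \<le> - (c/2) * (norm h)\<^sup>2" for h
    proof -
      have "h \<bullet> A h = h \<bullet> A0 h + (2 * \<eta> - 1/\<epsilon>) * (norm h)\<^sup>2"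
        "h \<bullet> B h = h \<bullet> B0 h + (2 * \<eta> - 1/\<epsilon>) * (norm h)\<^sup>2"
        unfolding A_def B_def power2_norm_eq_inner inner_add_right inner_diff_right inner_scaleR_right left_diff_distrib by simp_all
      then have "h \<bullet> (A h + B h) = h \<bullet> (A0 h + B0 h) + (4 * \<eta> - 2/\<epsilon>) * (norm h)\<^sup>2"
        unfolding inner_add_right left_diff_distrib by simp
      also have "\<dots> \<le> (4 * \<eta> - 2 * \<gamma>) * (norm h)\<^sup>2 + (4 * \<eta> - 2/\<epsilon>) * (norm h)\<^sup>2" using quad by simp
      also have "\<dots> = ((4 * \<eta> - 2 * \<gamma>) + (4 * \<eta> - 2/\<epsilon>)) * (norm h)\<^sup>2" by (simp only: distrib_right)
      also have "(4 * \<eta> - 2 * \<gamma>) + (4 * \<eta> - 2/\<epsilon>) = - (c/2)" by (simp add: \<eta>_def \<gamma>_def)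
      finally show ?thesis .
    qed
    show "a + b - \<theta> \<le> \<alpha> x + \<beta> x"
      using low f(4)[of x] g(4)[of x] nn[of "norm (x - Y x)"] nn[of "norm (x - Z x)"]
      unfolding U_def V_def by linarith
    show "d > 0" using dA(1) dB(1) dy by (simp add: d_def)
    show "u (Y x + h) \<le> ereal (\<alpha> x + (s - (1/\<epsilon>) *\<^sub>R x) \<bullet> h + (h \<bullet> A h) / 2)" if "norm h < d" for h
      unfolding A_def by (rule expansion_transfer[OF dA(2) f(4) f(5) _ inK eps]) (use that in \<open>auto simp: d_def\<close>)
    show "v (Z x + h) \<le> ereal (\<beta> x + (t - (1/\<epsilon>) *\<^sub>R x) \<bullet> h + (h \<bullet> B h) / 2)" if "norm h < d" for h
      unfolding B_def by (rule expansion_transfer[OF dB(2) g(4) g(5) _ inK eps]) (use that in \<open>auto simp: d_def\<close>)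
  qed (use dy f(3) g(3) in auto)
qed

section \<open>Symmetric matrices and second derivatives\<close>

lemma symmetric_mat_inner:
  fixes S :: "real^'n^'n"
  assumes "symmetric_mat S"
  shows "v \<bullet> (S *v w) = (S *v v) \<bullet> w"
  using assms unfolding symmetric_mat_def by (metis dot_lmul_matrix transpose_matrix_vector)

lemma symmetric_matI:
  fixes S :: "real^'n^'n"
  assumes "\<And>v w. v \<bullet> (S *v w) = (S *v v) \<bullet> w"
  shows "symmetric_mat S"
proof -
  have entry: "S $ i $ j = axis i 1 \<bullet> (S *v axis j 1)" for i j
    by (simp add: inner_axis' matrix_vector_mult_basis column_def)
  have "S $ i $ j = S $ j $ i" for i j
    unfolding entry using assms[of "axis i 1" "axis j 1"] by (simp add: inner_commute)
  then show ?thesis unfolding symmetric_mat_def transpose_def by (simp add: vec_eq_iff)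
qed

text \<open>The second-order expansion yields a linear map without a claim of symmetry, whereas jets
  in \<Theta> are symmetric. Only the quadratic form matters, so the symmetric part does.\<close>

lemma symmetric_mat_of_linear:
  fixes A :: "real^'n \<Rightarrow> real^'n"
  assumes "linear A"
  obtains S where "symmetric_mat S" "\<And>h. h \<bullet> (S *v h) = h \<bullet> A h"
proof -
  define M where "M = matrix A"
  have M: "M *v h = A h" for h using assms by (simp add: M_def matrix_works)
  define S where "S = (1/2) *\<^sub>R (M + transpose M)"
  have "symmetric_mat S" unfolding symmetric_mat_def S_def by (simp add: transpose_def vec_eq_iff)
  moreover have "h \<bullet> (S *v h) = h \<bullet> A h" for h
  proof -
    have "h \<bullet> (transpose M *v h) = h \<bullet> (M *v h)"
      by (metis dot_lmul_matrix inner_commute transpose_matrix_vector)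
    then show ?thesis
      by (simp add: S_def scaleR_matrix_vector_assoc[symmetric] matrix_vector_mult_add_rdistrib inner_add_right M)
  qed
  ultimately show thesis by (rule that)
qed

section \<open>Quadratic forms, eigenvalues and the jet norm\<close>

lemma norm_matrix_vector_mult_le:
  fixes M :: "real^'n^'m"
  shows "norm (M *v v) \<le> norm M * norm v"
proof -
  have sq: "(norm x)\<^sup>2 = (\<Sum>i\<in>UNIV. (norm (x $ i))\<^sup>2)" for x :: "'b::real_inner^'k"
    by (simp add: power2_norm_eq_inner inner_vec_def)
  have "(norm (M *v v))\<^sup>2 = (\<Sum>i\<in>UNIV. (norm (M $ i \<bullet> v))\<^sup>2)"
    unfolding sq by (simp add: matrix_vector_mult_def inner_vec_def)
  also have "\<dots> \<le> (\<Sum>i\<in>UNIV. (norm (M $ i))\<^sup>2 * (norm v)\<^sup>2)"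
  proof (rule sum_mono)
    fix i
    have "(norm (M $ i \<bullet> v))\<^sup>2 \<le> (norm (M $ i) * norm v)\<^sup>2"
      using Cauchy_Schwarz_ineq2[of "M $ i" v] by (intro power_mono) auto
    then show "(norm (M $ i \<bullet> v))\<^sup>2 \<le> (norm (M $ i))\<^sup>2 * (norm v)\<^sup>2" by (simp add: power_mult_distrib)
  qed
  also have "\<dots> = (norm M * norm v)\<^sup>2" by (simp add: sq[of M] power_mult_distrib sum_distrib_right)
  finally show ?thesis by (rule power2_le_imp_le) simp
qed

lemma abs_quadratic_form_le_norm:
  fixes M :: "real^'n^'n"
  shows "\<bar>v \<bullet> (M *v v)\<bar> \<le> norm M * (norm v)\<^sup>2"
proof -
  have "\<bar>v \<bullet> (M *v v)\<bar> \<le> norm v * norm (M *v v)" by (rule Cauchy_Schwarz_ineq2)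
  also have "\<dots> \<le> norm v * (norm M * norm v)" by (intro mult_left_mono norm_matrix_vector_mult_le) auto
  finally show ?thesis by (simp add: power2_eq_square mult_ac)
qed

text \<open>A maximizer of the quadratic form on the unit sphere is an eigenvector. This also shows
  that \<open>eigvals\<close> is nonempty, so that with finiteness \<open>Max\<close> in
  \<open>lam_max\<close> and \<open>jnorm\<close> has its intended meaning.\<close>

lemma Rayleigh_maximum_eigenvalue:
  fixes S :: "real^'n^'n"
  assumes sym: "symmetric_mat S"
  shows "\<exists>c\<in>eigvals S. \<forall>v. v \<bullet> (S *v v) \<le> c * (norm v)\<^sup>2"
proof -
  have "continuous_on (sphere 0 1) (\<lambda>v. v \<bullet> (S *v v))"
    by (intro continuous_intros linear_continuous_on linear_conv_bounded_linear[THEN iffD1] matrix_vector_mul_linear)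
  moreover have "sphere (0::real^'n) 1 \<noteq> {}" by simp
  ultimately obtain v0 where v0: "v0 \<in> sphere 0 1" "\<And>v. v \<in> sphere 0 1 \<Longrightarrow> v \<bullet> (S *v v) \<le> v0 \<bullet> (S *v v0)"
    using continuous_attains_sup[OF compact_sphere] by blast
  define c where "c = v0 \<bullet> (S *v v0)"
  have n0: "norm v0 = 1" using v0(1) by simp
  have le: "v \<bullet> (S *v v) \<le> c * (norm v)\<^sup>2" for v
  proof (cases "v = 0")
    case False
    define w where "w = (1 / norm v) *\<^sub>R v"
    have w: "v = norm v *\<^sub>R w" "norm w = 1" using False by (simp_all add: w_def)
    have "v \<bullet> (S *v v) = (norm v)\<^sup>2 * (w \<bullet> (S *v w))"
      by (subst (1 2) w(1)) (simp add: matrix_vector_mult_scaleR power2_eq_square)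
    also have "\<dots> \<le> (norm v)\<^sup>2 * c" using v0(2)[of w] w(2) by (intro mult_left_mono) (auto simp: c_def)
    finally show ?thesis by (simp add: mult.commute)
  qed simp
  \<comment> \<open>The residual of the eigenvalue equation at v0. Moving from v0 along w raises the
    quadratic form to first order in t, relative to c times the squared norm, by 2 t (norm w)^2;
    maximality therefore forces w = 0.\<close>
  define w where "w = S *v v0 - c *\<^sub>R v0"
  define k where "k = w \<bullet> (S *v w) - c * (norm w)\<^sup>2"
  have ineq: "2 * t * (norm w)\<^sup>2 + t\<^sup>2 * k \<le> 0" for t
  proof -
    have "(v0 + t *\<^sub>R w) \<bullet> (S *v (v0 + t *\<^sub>R w)) = c + 2 * t * (w \<bullet> (S *v v0)) + t\<^sup>2 * (w \<bullet> (S *v w))"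
      using symmetric_mat_inner[OF sym, of v0 w]
      by (simp add: matrix_vector_right_distrib matrix_vector_mult_scaleR inner_add_left inner_add_right c_def
          inner_commute power2_eq_square algebra_simps)
    moreover have "(norm (v0 + t *\<^sub>R w))\<^sup>2 = 1 + 2 * t * (w \<bullet> v0) + t\<^sup>2 * (norm w)\<^sup>2"
    proof -
      have "v0 \<bullet> v0 = 1" using n0 by (metis norm_eq_1)
      then show ?thesis unfolding power2_norm_eq_inner
        by (simp add: inner_add_left inner_add_right inner_commute power2_eq_square algebra_simps)
    qed
    ultimately have 1: "c + 2 * t * (w \<bullet> (S *v v0)) + t\<^sup>2 * (w \<bullet> (S *v w))
        \<le> c * (1 + 2 * t * (w \<bullet> v0) + t\<^sup>2 * (norm w)\<^sup>2)"
      using le[of "v0 + t *\<^sub>R w"] by (simp only:)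
    have 2: "(norm w)\<^sup>2 = w \<bullet> (S *v v0) - c * (w \<bullet> v0)"
    proof -
      have "w \<bullet> w = w \<bullet> (S *v v0 - c *\<^sub>R v0)" by (simp add: w_def)
      then show ?thesis unfolding power2_norm_eq_inner by (simp only: inner_diff_right inner_scaleR_right)
    qed
    have "2 * t * (norm w)\<^sup>2 = 2 * t * (w \<bullet> (S *v v0)) - c * (2 * t * (w \<bullet> v0))"
      unfolding 2 by (simp add: algebra_simps)
    moreover have "t\<^sup>2 * k = t\<^sup>2 * (w \<bullet> (S *v w)) - c * (t\<^sup>2 * (norm w)\<^sup>2)"
      by (simp add: k_def algebra_simps)
    ultimately show ?thesis using 1 by (simp only: distrib_left mult_1_right)
  qed
  have "w = 0"
  proof (rule ccontr)
    assume "w \<noteq> 0"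
    then have n: "(norm w)\<^sup>2 > 0" by simp
    define t where "t = (norm w)\<^sup>2 / (\<bar>k\<bar> + 1)"
    have t: "t > 0" using n by (simp add: t_def)
    have "t * \<bar>k\<bar> \<le> (norm w)\<^sup>2" using n by (simp add: t_def field_simps)
    moreover have "2 * (norm w)\<^sup>2 + t * k \<le> 0"
    proof -
      have "t * (2 * (norm w)\<^sup>2 + t * k) \<le> 0" using ineq[of t] by (simp add: power2_eq_square algebra_simps)
      then show ?thesis using t by (simp add: mult_le_0_iff)
    qed
    moreover have "- (t * \<bar>k\<bar>) \<le> t * k" using mult_left_mono[of "- \<bar>k\<bar>" k t] t by simp
    ultimately show False using n by linarith
  qed
  then have "S *v v0 = c *s v0" by (simp add: w_def scalar_mult_eq_scaleR)
  moreover have "v0 \<noteq> 0" using n0 by auto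
  ultimately have "c \<in> eigvals S" unfolding eigvals_def by blast
  then show ?thesis using le by blast
qed

text \<open>Eigenvectors for distinct eigenvalues are orthogonal, hence independent, so there are
  only finitely many.\<close>

lemma finite_eigvals:
  fixes S :: "real^'n^'n"
  assumes sym: "symmetric_mat S"
  shows "finite (eigvals S)"
proof -
  obtain e where e: "\<And>c. c \<in> eigvals S \<Longrightarrow> e c \<noteq> 0 \<and> S *v e c = c *s e c"
  proof -
    have "\<forall>c. \<exists>v. c \<in> eigvals S \<longrightarrow> v \<noteq> 0 \<and> S *v v = c *s v" unfolding eigvals_def by blast
    then obtain e where "\<forall>c. c \<in> eigvals S \<longrightarrow> e c \<noteq> 0 \<and> S *v e c = c *s e c" by (rule choice[THEN exE])
    then show thesis using that by blast
  qed
  have orth: "e c \<bullet> e d = 0" if "c \<in> eigvals S" "d \<in> eigvals S" "c \<noteq> d" for c d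
  proof -
    have "e c \<bullet> (S *v e d) = (S *v e c) \<bullet> e d" by (rule symmetric_mat_inner[OF sym])
    then have "d * (e c \<bullet> e d) = c * (e c \<bullet> e d)" using e that by (simp add: scalar_mult_eq_scaleR)
    then show ?thesis using that by simp
  qed
  have inj: "inj_on e (eigvals S)"
    by (rule inj_onI) (metis e orth inner_eq_zero_iff)
  have "pairwise orthogonal (e ` eigvals S)"
    unfolding pairwise_def orthogonal_def using orth by auto
  moreover have "0 \<notin> e ` eigvals S" using e by force
  ultimately have "independent (e ` eigvals S)" by (rule pairwise_orthogonal_independent)
  then have "finite (e ` eigvals S)" by (rule independent_imp_finite)
  then show ?thesis using inj by (rule finite_imageD)
qed

lemma quadratic_form_le_lam_max:
  fixes S :: "real^'n^'n"
  assumes sym: "symmetric_mat S"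
  shows "v \<bullet> (S *v v) \<le> lam_max S * (norm v)\<^sup>2"
proof -
  obtain c where c: "c \<in> eigvals S" "\<And>v. v \<bullet> (S *v v) \<le> c * (norm v)\<^sup>2"
    using Rayleigh_maximum_eigenvalue[OF sym] by blast
  have "c \<le> lam_max S" unfolding lam_max_def using finite_eigvals[OF sym] c(1) by (rule Max_ge)
  then have "c * (norm v)\<^sup>2 \<le> lam_max S * (norm v)\<^sup>2" by (intro mult_right_mono) auto
  then show ?thesis using c(2)[of v] by linarith
qed

text \<open>The Rayleigh maximum c of the negated matrix is minus an eigenvalue of the matrix, so it
  is bounded by the largest absolute eigenvalue.\<close>

lemma quadratic_form_ge_jnorm:
  fixes p :: "real \<times> (real^'n^'n)"
  assumes sym: "symmetric_mat (snd p)"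
  shows "- (jnorm p * (norm v)\<^sup>2) \<le> v \<bullet> (snd p *v v)"
proof -
  have neg: "(- snd p) *v w = - (snd p *v w)" for w by (simp add: matrix_vector_mult_def vec_eq_iff sum_negf)
  have "symmetric_mat (- snd p)" using sym unfolding symmetric_mat_def by (simp add: transpose_def vec_eq_iff)
  then obtain c where c: "c \<in> eigvals (- snd p)" "\<And>v. v \<bullet> ((- snd p) *v v) \<le> c * (norm v)\<^sup>2"
    using Rayleigh_maximum_eigenvalue by blast
  have "- c \<in> eigvals (snd p)"
  proof -
    obtain w where "w \<noteq> 0" "- (snd p *v w) = c *s w" using c(1) unfolding eigvals_def neg by blast
    then have "snd p *v w = (- c) *s w" by (simp add: scalar_mult_eq_scaleR) (metis minus_minus)
    then show ?thesis using \<open>w \<noteq> 0\<close> unfolding eigvals_def by blast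
  qed
  then have "\<bar>c\<bar> \<in> abs ` eigvals (snd p)" by (metis abs_minus_cancel image_eqI)
  then have "\<bar>c\<bar> \<le> Max (abs ` eigvals (snd p))" using finite_eigvals[OF sym] by (intro Max_ge) auto
  then have "c \<le> jnorm p" unfolding jnorm_def by linarith
  then have "c * (norm v)\<^sup>2 \<le> jnorm p * (norm v)\<^sup>2" by (intro mult_right_mono) auto
  then show ?thesis using c(2)[of v] unfolding neg by simp
qed

section \<open>Second-order calculus of the test function\<close>

lemma DERIV_along_line:
  fixes \<phi> :: "'a::real_inner \<Rightarrow> real"
  assumes "(\<phi> has_derivative (\<lambda>h. G \<bullet> h)) (at (p + s *\<^sub>R k))"
  shows "((\<lambda>s. \<phi> (p + s *\<^sub>R k)) has_real_derivative G \<bullet> k) (at s)"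
proof -
  have "((\<lambda>s. \<phi> (p + s *\<^sub>R k)) has_derivative (\<lambda>r. G \<bullet> (r *\<^sub>R k))) (at s)"
    by (rule has_derivative_compose[of "\<lambda>s. p + s *\<^sub>R k" _ s UNIV \<phi>])
       (use assms in \<open>auto intro!: derivative_eq_intros\<close>)
  moreover have "(\<lambda>r. G \<bullet> (r *\<^sub>R k)) = (*) (G \<bullet> k)" by (simp add: fun_eq_iff mult.commute)
  ultimately show ?thesis by (simp add: has_field_derivative_def)
qed

text \<open>\<open>C2_near\<close> does not ask the Hessian to be symmetric, while
  \<open>Qtilde\<close> does. The second difference of \<phi> over the parallelogram with sides t h
  and t k is symmetric in h and k, and by the mean value theorem it is t^2 (G k \<bullet> h) up to a
  small error.\<close>

lemma second_derivative_symmetric: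
  fixes \<phi> :: "'a::real_inner \<Rightarrow> real" and g :: "'a \<Rightarrow> 'a"
  assumes "e > 0" and d1: "\<And>x. x \<in> ball x0 e \<Longrightarrow> (\<phi> has_derivative (\<lambda>h. g x \<bullet> h)) (at x)"
    and d2: "(g has_derivative G) (at x0)"
  shows "G k \<bullet> h = G h \<bullet> k"
proof -
  have lin: "linear G" using d2 has_derivative_linear by blast
  define n where "n = norm h + norm k + 1"
  have n: "n > 0" "norm h \<le> n" "norm k \<le> n" "norm h + norm k \<le> n" by (auto simp: n_def add_nonneg_pos)
  have "\<bar>G k \<bullet> h - G h \<bullet> k\<bar> \<le> \<eta>" if eta: "\<eta> > 0" for \<eta>
  proof -
    \<comment> \<open>Two gradient remainders of size \<eta>' * t * n, paired with a vector of
      length at most t * n, add up to t^2 * \<eta> / 2.\<close>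
    define \<eta>' where "\<eta>' = \<eta> / (4 * n\<^sup>2)"
    have eta': "\<eta>' > 0" using eta n by (simp add: \<eta>'_def)
    obtain d where d: "d > 0" "\<And>y. norm (y - x0) < d \<Longrightarrow> norm (g y - g x0 - G (y - x0)) \<le> \<eta>' * norm (y - x0)"
      using d2 eta' unfolding has_derivative_at_alt by blast
    define t where "t = min d e / (2 * n)"
    have t: "t > 0" "t * n < d" "t * n < e" using d(1) \<open>e > 0\<close> n by (auto simp: t_def field_simps min_def)
    define \<Delta> where "\<Delta> = \<phi> (x0 + t *\<^sub>R h + t *\<^sub>R k) - \<phi> (x0 + t *\<^sub>R h) - \<phi> (x0 + t *\<^sub>R k) + \<phi> x0"
    have main: "\<bar>\<phi> (x0 + t *\<^sub>R h + t *\<^sub>R k) - \<phi> (x0 + t *\<^sub>R h) - \<phi> (x0 + t *\<^sub>R k) + \<phi> x0 - t\<^sup>2 * (G k \<bullet> h)\<bar> \<le> t\<^sup>2 * (\<eta> / 2)"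
      if hk: "norm h + norm k \<le> n" for h k
    proof -
      define \<psi> where "\<psi> s = \<phi> (x0 + t *\<^sub>R k + s *\<^sub>R (t *\<^sub>R h)) - \<phi> (x0 + s *\<^sub>R (t *\<^sub>R h))" for s
      have in_ball: "norm (a *\<^sub>R (t *\<^sub>R k) + s *\<^sub>R (t *\<^sub>R h)) \<le> t * n" if "0 \<le> s" "s \<le> 1" "0 \<le> a" "a \<le> 1" for s a
      proof -
        have "norm (a *\<^sub>R (t *\<^sub>R k) + s *\<^sub>R (t *\<^sub>R h)) \<le> a * (t * norm k) + s * (t * norm h)"
          using norm_triangle_ineq[of "a *\<^sub>R (t *\<^sub>R k)" "s *\<^sub>R (t *\<^sub>R h)"] that t(1) by simp
        also have "\<dots> \<le> t * norm k + t * norm h" using that t(1) by (intro add_mono mult_left_le_one_le) auto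
        also have "\<dots> \<le> t * n" using hk t(1) by (simp flip: distrib_left add: add.commute)
        finally show ?thesis .
      qed
      have der: "(\<psi> has_real_derivative (g (x0 + t *\<^sub>R k + s *\<^sub>R (t *\<^sub>R h)) - g (x0 + s *\<^sub>R (t *\<^sub>R h))) \<bullet> (t *\<^sub>R h)) (at s)"
        if "0 \<le> s" "s \<le> 1" for s
      proof -
        have "x0 + t *\<^sub>R k + s *\<^sub>R (t *\<^sub>R h) \<in> ball x0 e" "x0 + s *\<^sub>R (t *\<^sub>R h) \<in> ball x0 e"
        proof -
          have b: "x0 + y \<in> ball x0 e" if "norm y \<le> t * n" for y using that t(3) by (simp add: dist_norm)
          show "x0 + t *\<^sub>R k + s *\<^sub>R (t *\<^sub>R h) \<in> ball x0 e"
            using b[OF in_ball[OF that, of 1]] by (simp add: add.assoc)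
          show "x0 + s *\<^sub>R (t *\<^sub>R h) \<in> ball x0 e" using b[OF in_ball[OF that, of 0]] by simp
        qed
        then show ?thesis unfolding \<psi>_def inner_diff_left by (intro DERIV_diff DERIV_along_line d1)
      qed
      have "\<exists>s. 0 < s \<and> s < 1 \<and> \<psi> 1 - \<psi> 0 = (1 - 0) * ((g (x0 + t *\<^sub>R k + s *\<^sub>R (t *\<^sub>R h)) - g (x0 + s *\<^sub>R (t *\<^sub>R h))) \<bullet> (t *\<^sub>R h))"
        by (rule MVT2) (use der in auto)
      then obtain s where s: "0 < s" "s < 1" "\<psi> 1 - \<psi> 0 = (g (x0 + t *\<^sub>R k + s *\<^sub>R (t *\<^sub>R h)) - g (x0 + s *\<^sub>R (t *\<^sub>R h))) \<bullet> (t *\<^sub>R h)"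
        by auto
      define y1 where "y1 = t *\<^sub>R k + s *\<^sub>R (t *\<^sub>R h)"
      define y2 where "y2 = s *\<^sub>R (t *\<^sub>R h)"
      have ny: "norm y1 \<le> t * n" "norm y2 \<le> t * n" using in_ball[of s 1] in_ball[of s 0] s by (simp_all add: y1_def y2_def)
      have r: "norm (g (x0 + y) - g x0 - G y) \<le> \<eta>' * (t * n)" if "norm y \<le> t * n" for y
      proof -
        have "norm (g (x0 + y) - g x0 - G y) \<le> \<eta>' * norm y" using d(2)[of "x0 + y"] that t(2) by simp
        also have "\<dots> \<le> \<eta>' * (t * n)" using that eta' by (intro mult_left_mono) auto
        finally show ?thesis .
      qed
      have "G y1 - G y2 = t *\<^sub>R G k" using lin by (simp add: y1_def y2_def linear_add linear_scale)
      then have eq: "g (x0 + y1) - g (x0 + y2) - t *\<^sub>R G k = (g (x0 + y1) - g x0 - G y1) - (g (x0 + y2) - g x0 - G y2)"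
        by (simp add: algebra_simps)
      have nr: "norm (g (x0 + y1) - g (x0 + y2) - t *\<^sub>R G k) \<le> 2 * (\<eta>' * (t * n))"
        unfolding eq using norm_triangle_ineq4[of "g (x0 + y1) - g x0 - G y1" "g (x0 + y2) - g x0 - G y2"] r[OF ny(1)] r[OF ny(2)]
        by linarith
      have "\<phi> (x0 + t *\<^sub>R h + t *\<^sub>R k) - \<phi> (x0 + t *\<^sub>R h) - \<phi> (x0 + t *\<^sub>R k) + \<phi> x0 = \<psi> 1 - \<psi> 0"
        by (simp add: \<psi>_def add_ac)
      also have "\<dots> - t\<^sup>2 * (G k \<bullet> h) = (g (x0 + y1) - g (x0 + y2) - t *\<^sub>R G k) \<bullet> (t *\<^sub>R h)"
        unfolding s(3) y1_def y2_def by (simp add: inner_diff_left power2_eq_square add.assoc right_diff_distrib)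
      also have "\<bar>\<dots>\<bar> \<le> norm (g (x0 + y1) - g (x0 + y2) - t *\<^sub>R G k) * norm (t *\<^sub>R h)" by (rule Cauchy_Schwarz_ineq2)
      also have "\<dots> \<le> (2 * (\<eta>' * (t * n))) * (t * n)"
      proof (rule mult_mono[OF nr])
        have "norm h \<le> n" using hk norm_ge_zero[of k] by linarith
        then show "norm (t *\<^sub>R h) \<le> t * n" using t(1) by simp
      qed (use eta' t n in auto)
      also have "\<dots> = t\<^sup>2 * (\<eta> / 2)" using n by (simp add: \<eta>'_def power2_eq_square field_simps)
      finally show ?thesis by simp
    qed
    have "\<bar>\<Delta> - t\<^sup>2 * (G k \<bullet> h)\<bar> \<le> t\<^sup>2 * (\<eta> / 2)" unfolding \<Delta>_def using main[OF n(4)] .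
    moreover have "\<bar>\<Delta> - t\<^sup>2 * (G h \<bullet> k)\<bar> \<le> t\<^sup>2 * (\<eta> / 2)"
      using main[of k h] n(4) unfolding \<Delta>_def by (simp add: add_ac algebra_simps)
    ultimately have "\<bar>t\<^sup>2 * (G k \<bullet> h) - t\<^sup>2 * (G h \<bullet> k)\<bar> \<le> t\<^sup>2 * \<eta>" by linarith
    then have "t\<^sup>2 * \<bar>G k \<bullet> h - G h \<bullet> k\<bar> \<le> t\<^sup>2 * \<eta>" by (simp add: abs_mult flip: right_diff_distrib)
    then show ?thesis using t(1) by simp
  qed
  then have "\<bar>G k \<bullet> h - G h \<bullet> k\<bar> \<le> 0" by (metis field_le_epsilon add_0)
  then show ?thesis by simp
qed

text \<open>In the derivative along a ray, of the available -4c the paraboloid uses 2c and the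
  gradient remainder at most c, so the comparison function is nonincreasing.\<close>

lemma Taylor_upper_bound:
  fixes \<phi> :: "'a::real_inner \<Rightarrow> real" and g :: "'a \<Rightarrow> 'a"
  assumes "e > 0" and d1: "\<And>x. x \<in> ball x0 e \<Longrightarrow> (\<phi> has_derivative (\<lambda>h. g x \<bullet> h)) (at x)"
    and d2: "(g has_derivative G) (at x0)" and "c > 0" and neg: "\<And>h. h \<bullet> G h \<le> - (4 * c) * (norm h)\<^sup>2"
  obtains d where "d > 0" "\<And>h. norm h < d \<Longrightarrow> \<phi> (x0 + h) \<le> \<phi> x0 + g x0 \<bullet> h - c * (norm h)\<^sup>2"
proof -
  obtain d where d: "d > 0" "\<And>y. norm (y - x0) < d \<Longrightarrow> norm (g y - g x0 - G (y - x0)) \<le> c * norm (y - x0)"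
    using d2 \<open>c > 0\<close> unfolding has_derivative_at_alt by blast
  show thesis
  proof (rule that[of "min d e"])
    fix h :: 'a assume h: "norm h < min d e"
    define \<psi> where "\<psi> t = \<phi> (x0 + t *\<^sub>R h) - t * (g x0 \<bullet> h) + c * t\<^sup>2 * (norm h)\<^sup>2" for t
    have "\<psi> 1 \<le> \<psi> 0"
    proof (rule DERIV_nonpos_imp_nonincreasing[of 0 1 \<psi>])
      fix t :: real assume t: "0 \<le> t" "t \<le> 1"
      have th: "norm (t *\<^sub>R h) < min d e" using h t mult_left_le_one_le[of "norm h" t] by simp
      then have "x0 + t *\<^sub>R h \<in> ball x0 e" by (simp add: dist_norm)
      from DERIV_along_line[OF d1[OF this]]
      have "(\<psi> has_real_derivative g (x0 + t *\<^sub>R h) \<bullet> h - g x0 \<bullet> h + 2 * c * t * (norm h)\<^sup>2) (at t)"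
        unfolding \<psi>_def by (auto intro!: derivative_eq_intros)
      moreover have "g (x0 + t *\<^sub>R h) \<bullet> h - g x0 \<bullet> h + 2 * c * t * (norm h)\<^sup>2 \<le> 0"
      proof -
        have lin: "linear G" using d2 has_derivative_linear by blast
        have "g (x0 + t *\<^sub>R h) \<bullet> h - g x0 \<bullet> h = (g (x0 + t *\<^sub>R h) - g x0 - t *\<^sub>R G h) \<bullet> h + t * (h \<bullet> G h)"
          by (simp add: inner_diff_left inner_commute[of h])
        moreover have "(g (x0 + t *\<^sub>R h) - g x0 - t *\<^sub>R G h) \<bullet> h \<le> c * t * (norm h)\<^sup>2"
        proof -
          have "norm (g (x0 + t *\<^sub>R h) - g x0 - t *\<^sub>R G h) \<le> c * (t * norm h)"
            using d(2)[of "x0 + t *\<^sub>R h"] th t lin by (simp add: linear_scale)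
          then have "norm (g (x0 + t *\<^sub>R h) - g x0 - t *\<^sub>R G h) * norm h \<le> c * (t * norm h) * norm h"
            by (rule mult_right_mono) simp
          then show ?thesis
            using norm_cauchy_schwarz[of "g (x0 + t *\<^sub>R h) - g x0 - t *\<^sub>R G h" h] by (simp add: power2_eq_square mult_ac)
        qed
        moreover have "t * (h \<bullet> G h) \<le> t * (- (4 * c) * (norm h)\<^sup>2)" using neg t by (intro mult_left_mono) auto
        moreover have "c * t * (norm h)\<^sup>2 \<ge> 0" using \<open>c > 0\<close> t by simp
        ultimately show ?thesis by (simp add: mult_ac)
      qed
      ultimately show "\<exists>y. (\<psi> has_real_derivative y) (at t) \<and> y \<le> 0" by blast
    qed simp
    then show "\<phi> (x0 + h) \<le> \<phi> x0 + g x0 \<bullet> h - c * (norm h)\<^sup>2" by (simp add: \<psi>_def)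
  qed (use d \<open>e > 0\<close> in simp)
qed

section \<open>Jets, duality and the main theorem\<close>

lemma quadratic_upper_jet:
  fixes u :: "real^'n \<Rightarrow> ereal"
  assumes sym: "symmetric_mat S" and val: "u y = ereal \<alpha>" and "d > 0"
    and up: "\<And>h. norm h < d \<Longrightarrow> u (y + h) \<le> ereal (\<alpha> + s \<bullet> h + (h \<bullet> (S *v h)) / 2)"
  shows "(\<alpha>, S) \<in> upper_jets u y"
proof -
  define \<phi> where "\<phi> x = \<alpha> + s \<bullet> (x - y) + ((x - y) \<bullet> (S *v (x - y))) / 2" for x
  define g where "g x = s + S *v (x - y)" for x
  have bl: "bounded_linear ((*v) S)" by (simp add: matrix_vector_mul_bounded_linear)
  have dS: "((\<lambda>x. S *v (x - y)) has_derivative (\<lambda>h. S *v h)) (at x)" for x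
    by (rule bounded_linear.has_derivative[OF bl]) (auto intro!: derivative_eq_intros)
  have "C2_near \<phi> y g (\<lambda>_. S)"
    unfolding C2_near_def
  proof (intro exI[of _ 1] conjI ballI)
    fix x
    show "(g has_derivative (\<lambda>h. S *v h)) (at x)"
      unfolding g_def using dS by (auto intro!: derivative_eq_intros)
    have "(\<phi> has_derivative (\<lambda>h. s \<bullet> h + ((x - y) \<bullet> (S *v h) + h \<bullet> (S *v (x - y))) / 2)) (at x)"
      unfolding \<phi>_def by (auto intro!: derivative_eq_intros dS)
    moreover have "(\<lambda>h. s \<bullet> h + ((x - y) \<bullet> (S *v h) + h \<bullet> (S *v (x - y))) / 2) = (\<lambda>h. g x \<bullet> h)"
    proof
      fix h
      have "(x - y) \<bullet> (S *v h) = (S *v (x - y)) \<bullet> h" by (rule symmetric_mat_inner[OF sym])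
      moreover have "h \<bullet> (S *v (x - y)) = (S *v (x - y)) \<bullet> h" by (rule inner_commute)
      ultimately show "s \<bullet> h + ((x - y) \<bullet> (S *v h) + h \<bullet> (S *v (x - y))) / 2 = g x \<bullet> h"
        by (simp add: g_def inner_add_left)
    qed
    ultimately show "(\<phi> has_derivative (\<lambda>h. g x \<bullet> h)) (at x)" by simp
  qed auto
  moreover have "\<forall>x\<in>ball y d. u x \<le> ereal (\<phi> x)"
  proof
    fix x assume "x \<in> ball y d"
    then show "u x \<le> ereal (\<phi> x)" using up[of "x - y"] by (simp add: \<phi>_def dist_norm norm_minus_commute)
  qed
  moreover have "u y = ereal (\<phi> y)" "\<phi> y = \<alpha>" by (simp_all add: \<phi>_def val)
  ultimately show ?thesis unfolding upper_jets_def using \<open>d > 0\<close>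
    by (intro CollectI exI[of _ \<phi>] exI[of _ g] exI[of _ "\<lambda>_. S"]) auto
qed

text \<open>
  Otherwise the point (-b, -B) would lie in (a, A) plus the interior of the cone, hence in the
  interior of the fibre.
\<close>
lemma dual_map_incompatible:
  fixes \<Theta> :: "real^'n \<Rightarrow> (real \<times> (real^'n^'n)) set"
  assumes sub: "\<Theta> z \<subseteq> SymSpace" and ell: "\<And>p q. p \<in> \<Theta> z \<Longrightarrow> q \<in> Qcone \<Longrightarrow> p + q \<in> \<Theta> z"
    and A: "(a, A) \<in> \<Theta> z" and B: "(b, B) \<in> dual_map \<Theta> z"
    and sig: "\<sigma> > 0" "a + b \<ge> \<sigma>" "\<And>v. v \<bullet> (A *v v) + v \<bullet> (B *v v) \<le> - \<sigma> * (norm v)\<^sup>2"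
  shows False
proof -
  let ?q = "(- b, - B)"
  have q: "?q \<in> SymSpace" "?q \<notin> (subtopology euclidean SymSpace) interior_of (\<Theta> z)"
    using B unfolding dual_map_def by force+
  have symA: "symmetric_mat A" using A sub by (auto simp: SymSpace_def)
  have "SymSpace \<inter> ball ?q \<sigma> \<subseteq> \<Theta> z"
  proof
    fix m assume m: "m \<in> SymSpace \<inter> ball ?q \<sigma>"
    obtain r M where rM: "m = (r, M)" by (cases m)
    have symM: "symmetric_mat M" using m rM by (simp add: SymSpace_def)
    have "dist r (- b) < \<sigma>" "dist M (- B) < \<sigma>"
      using m dist_fst_le[of m ?q] dist_snd_le[of m ?q] by (auto simp: rM dist_commute)
    then have r: "r \<le> a" and nM: "norm (M + B) < \<sigma>" using sig(2) by (auto simp: dist_norm)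
    \<comment> \<open>\<sigma> serves twice: it covers the distance of r from -b, and the change of
      the quadratic form caused by M + B.\<close>
    have "(r - a, M - A) \<in> Qcone"
    proof -
      have "symmetric_mat (M - A)" using symM symA unfolding symmetric_mat_def by (simp add: transpose_def vec_eq_iff)
      moreover have "v \<bullet> ((M - A) *v v) \<ge> 0" for v
      proof -
        have "v \<bullet> ((M - A) *v v) = v \<bullet> ((M + B) *v v) - (v \<bullet> (A *v v) + v \<bullet> (B *v v))"
          by (simp add: matrix_vector_mult_diff_rdistrib matrix_vector_mult_add_rdistrib inner_diff_right inner_add_right)
        moreover have "norm (M + B) * (norm v)\<^sup>2 \<le> \<sigma> * (norm v)\<^sup>2" using nM by (intro mult_right_mono) auto
        ultimately show ?thesis using abs_quadratic_form_le_norm[of v "M + B"] sig(3)[of v] by simp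
      qed
      ultimately show ?thesis using r by (simp add: Qcone_def psd_def)
    qed
    from ell[OF A this] show "m \<in> \<Theta> z" by (simp add: rM)
  qed
  moreover have "openin (subtopology euclidean SymSpace) (SymSpace \<inter> ball ?q \<sigma>)"
    by (simp add: openin_open_Int)
  moreover have "?q \<in> SymSpace \<inter> ball ?q \<sigma>" using q(1) sig(1) by simp
  ultimately have "?q \<in> (subtopology euclidean SymSpace) interior_of (\<Theta> z)" unfolding interior_of_def by blast
  then show False using q(2) by simp
qed

lemma hdist_less_obtain:
  assumes "hdist S T < ereal \<eta>" "p \<in> S"
  obtains q where "q \<in> T" "jnorm (p - q) < \<eta>"
proof -
  have "(INF q\<in>T. ereal (jnorm (p - q))) \<le> (SUP p\<in>S. INF q\<in>T. ereal (jnorm (p - q)))"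
    using assms(2) by (rule SUP_upper)
  also have "\<dots> \<le> hdist S T" unfolding hdist_def by simp
  finally have "(INF q\<in>T. ereal (jnorm (p - q))) < ereal \<eta>" using assms(1) by simp
  then obtain q where "q \<in> T" "ereal (jnorm (p - q)) < ereal \<eta>" unfolding INF_less_iff by blast
  then show thesis using that by simp
qed

theorem theorem5p2:
  fixes X :: "(real^'n) set"
    and \<Theta> :: "real^'n \<Rightarrow> (real \<times> (real^'n^'n)) set"
    and u ut :: "real^'n \<Rightarrow> ereal"
  assumes "bounded X" and "open X"
    and "proper_elliptic_map X \<Theta>"
    and "unif_cont_map X \<Theta>"
    and "usc_on (closure X) u" and "usc_on (closure X) ut"
    and "subharmonic \<Theta> X u"
    and "subharmonic (dual_map \<Theta>) X ut"
  shows "subharmonic (\<lambda>_. Qtilde) X (\<lambda>x. u x + ut x)"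
  unfolding subharmonic_def
proof (intro conjI ballI)
  have usc: "usc_on X u" "usc_on X ut" using assms(7,8) unfolding subharmonic_def by auto
  then show "usc_on X (\<lambda>x. u x + ut x)" by (rule usc_on_add)
  fix x0 assume x0: "x0 \<in> X"
  show "upper_jets (\<lambda>x. u x + ut x) x0 \<subseteq> Qtilde"
  proof
    fix j assume "j \<in> upper_jets (\<lambda>x. u x + ut x) x0"
    then obtain \<phi> g H e1 where j: "j = (\<phi> x0, H x0)" and C2: "C2_near \<phi> x0 g H"
      and e1: "e1 > 0" "\<And>x. x \<in> ball x0 e1 \<Longrightarrow> u x + ut x \<le> ereal (\<phi> x)" and val: "u x0 + ut x0 = ereal (\<phi> x0)"
      unfolding upper_jets_def by auto
    obtain e2 where e2: "e2 > 0" "\<And>x. x \<in> ball x0 e2 \<Longrightarrow> (\<phi> has_derivative (\<lambda>h. g x \<bullet> h)) (at x)"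
      "\<And>x. x \<in> ball x0 e2 \<Longrightarrow> (g has_derivative (\<lambda>h. H x *v h)) (at x)"
      using C2 unfolding C2_near_def by blast
    have dg: "(g has_derivative (\<lambda>h. H x0 *v h)) (at x0)" using e2 by simp
    have sym: "symmetric_mat (H x0)"
      by (rule symmetric_matI) (metis second_derivative_symmetric[OF e2(1,2) dg] inner_commute)
    have "\<phi> x0 \<le> 0 \<or> 0 \<le> lam_max (H x0)"
    proof (rule ccontr)
      assume "\<not> ?thesis"
      then have r: "\<phi> x0 > 0" and lam: "lam_max (H x0) < 0" by auto
      \<comment> \<open>A quarter, to match the hypothesis -4c of
        \<open>Taylor_upper_bound\<close>.\<close>
      define c where "c = - lam_max (H x0) / 4"
      have c: "c > 0" using lam by (simp add: c_def)
      have neg: "h \<bullet> (H x0 *v h) \<le> - (4 * c) * (norm h)\<^sup>2" for h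
        using quadratic_form_le_lam_max[OF sym, of h] by (simp add: c_def)
      obtain d where d: "d > 0" "\<And>h. norm h < d \<Longrightarrow> \<phi> (x0 + h) \<le> \<phi> x0 + g x0 \<bullet> h - c * (norm h)\<^sup>2"
        using Taylor_upper_bound[OF e2(1,2) dg c neg] by blast
      \<comment> \<open>A real sum forces both summands to be real; these finite values are what the
        sup-convolutions start from.\<close>
      obtain a where a: "u x0 = ereal a" and b: "\<exists>b. ut x0 = ereal b"
        using val by (cases "u x0"; cases "ut x0") auto
      then obtain b where b: "ut x0 = ereal b" by blast
      have ab: "a + b = \<phi> x0" using val a b by simp
      obtain e3 where e3: "e3 > 0" "ball x0 e3 \<subseteq> X" using \<open>open X\<close> x0 openE by blast
      define \<rho> where "\<rho> = min (min e1 d) e3 / 2"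
      have rho: "\<rho> > 0" "\<rho> < e1" "\<rho> < d" "\<rho> < e3" using e1(1) d(1) e3(1) by (auto simp: \<rho>_def)
      have KX: "cball x0 \<rho> \<subseteq> X" using rho e3 by (auto simp: subset_iff)
      have le: "\<forall>x\<in>cball x0 \<rho>. u x + ut x \<le> ereal (a + b + g x0 \<bullet> (x - x0) - c * (norm (x - x0))\<^sup>2)"
      proof
        fix x assume x: "x \<in> cball x0 \<rho>"
        have "u x + ut x \<le> ereal (\<phi> x)" using e1(2) x rho by simp
        also have "\<phi> x \<le> a + b + g x0 \<bullet> (x - x0) - c * (norm (x - x0))\<^sup>2"
          using d(2)[of "x - x0"] x rho by (simp add: ab dist_norm norm_minus_commute)
        finally show "u x + ut x \<le> ereal (a + b + g x0 \<bullet> (x - x0) - c * (norm (x - x0))\<^sup>2)" by simp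
      qed
      \<comment> \<open>The Hessian sum -c/2 loses \<eta> and stays at most -c/4; the value \<phi>
        x0 loses \<theta> and \<eta>, at most a quarter each, and stays at least \<phi> x0 /
        2.\<close>
      define \<eta> where "\<eta> = min (\<phi> x0 / 4) (c / 4)"
      have eta: "\<eta> > 0" "\<eta> \<le> \<phi> x0 / 4" "\<eta> \<le> c / 4" using r c unfolding \<eta>_def by linarith+
      obtain \<delta> where \<delta>: "\<delta> > 0" "\<And>x y. x \<in> X \<Longrightarrow> y \<in> X \<Longrightarrow> dist x y < \<delta> \<Longrightarrow> hdist (\<Theta> x) (\<Theta> y) < ereal \<eta>"
        using assms(4) eta(1) unfolding unif_cont_map_def by blast
      define \<theta> where "\<theta> = min \<delta> (\<phi> x0 / 4)"
      have theta: "\<theta> > 0" "\<theta> \<le> \<delta>" "\<theta> \<le> \<phi> x0 / 4" using \<delta>(1) r unfolding \<theta>_def by linarith+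
      obtain y z A B \<alpha> \<beta> d' s t where yz: "dist x0 y < \<rho>" "dist x0 z < \<rho>" "dist y z < \<theta>" "linear A" "linear B"
        "\<And>h. h \<bullet> (A h + B h) \<le> - (c/2) * (norm h)\<^sup>2" "u y = ereal \<alpha>" "ut z = ereal \<beta>" "\<alpha> + \<beta> \<ge> a + b - \<theta>"
        "d' > 0" "\<And>h. norm h < d' \<Longrightarrow> u (y + h) \<le> ereal (\<alpha> + s \<bullet> h + (h \<bullet> A h) / 2)"
        "\<And>h. norm h < d' \<Longrightarrow> ut (z + h) \<le> ereal (\<beta> + t \<bullet> h + (h \<bullet> B h) / 2)"
        by (fact usc_theorem_on_sums[OF c rho(1) usc_on_subset[OF usc(1) KX] usc_on_subset[OF usc(2) KX] a b le theta(1)])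
      have yX: "y \<in> X" "z \<in> X" using yz(1,2) KX by (auto simp: subset_iff)
      obtain SA where SA: "symmetric_mat SA" "\<And>h. h \<bullet> (SA *v h) = h \<bullet> A h" using symmetric_mat_of_linear[OF yz(4)] by blast
      obtain SB where SB: "symmetric_mat SB" "\<And>h. h \<bullet> (SB *v h) = h \<bullet> B h" using symmetric_mat_of_linear[OF yz(5)] by blast
      have "(\<alpha>, SA) \<in> upper_jets u y"
        by (rule quadratic_upper_jet[where u=u and y=y and s=s, OF SA(1) yz(7,10)]) (use yz(11) SA(2) in auto)
      then have jA: "(\<alpha>, SA) \<in> \<Theta> y" using assms(7) yX unfolding subharmonic_def by blast
      have "(\<beta>, SB) \<in> upper_jets ut z"
        by (rule quadratic_upper_jet[where u=ut and y=z and s=t, OF SB(1) yz(8,10)]) (use yz(12) SB(2) in auto)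
      then have jB: "(\<beta>, SB) \<in> dual_map \<Theta> z" using assms(8) yX unfolding subharmonic_def by blast
      have "hdist (\<Theta> y) (\<Theta> z) < ereal \<eta>" using \<delta>(2) yX yz(3) theta(2) by simp
      \<comment> \<open>The jet of u lives at y and the dual jet of ut at z. Replacing the former by
        a nearby element of the fibre at z puts both over the same point, where duality
        applies.\<close>
      then obtain m where m: "m \<in> \<Theta> z" "jnorm ((\<alpha>, SA) - m) < \<eta>" using jA by (rule hdist_less_obtain)
      obtain a' A' where m': "m = (a', A')" by (cases m)
      have \<Theta>z: "\<Theta> z \<subseteq> SymSpace" "\<And>p q. p \<in> \<Theta> z \<Longrightarrow> q \<in> Qcone \<Longrightarrow> p + q \<in> \<Theta> z"
        using assms(3) yX(2) unfolding proper_elliptic_map_def by blast+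
      have symA': "symmetric_mat A'" using m(1) \<Theta>z(1) m' by (auto simp: SymSpace_def)
      have "symmetric_mat (SA - A')" using SA(1) symA' unfolding symmetric_mat_def by (simp add: transpose_def vec_eq_iff)
      then have quad: "- (\<eta> * (norm v)\<^sup>2) \<le> v \<bullet> ((SA - A') *v v)" for v
        using quadratic_form_ge_jnorm[of "(\<alpha>, SA) - m" v] m(2) mult_right_mono[of "jnorm ((\<alpha>, SA) - m)" \<eta> "(norm v)\<^sup>2"]
        by (simp add: m')
      have "\<bar>\<alpha> - a'\<bar> < \<eta>" using m(2) unfolding jnorm_def m' by simp
      show False
      proof (rule dual_map_incompatible[OF \<Theta>z m(1)[unfolded m'] jB])
        show "min (\<phi> x0 / 2) (c / 4) > 0" using r c by simp
        show "a' + \<beta> \<ge> min (\<phi> x0 / 2) (c / 4)"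
          using \<open>\<bar>\<alpha> - a'\<bar> < \<eta>\<close> yz(9) theta(3) eta(2) ab by linarith
        show "v \<bullet> (A' *v v) + v \<bullet> (SB *v v) \<le> - min (\<phi> x0 / 2) (c / 4) * (norm v)\<^sup>2" for v
        proof -
          have "v \<bullet> (A' *v v) + v \<bullet> (SB *v v) = v \<bullet> (A v + B v) - v \<bullet> ((SA - A') *v v)"
            by (simp add: matrix_vector_mult_diff_rdistrib inner_diff_right inner_add_right SA(2) SB(2))
          also have "\<dots> \<le> - (c/2) * (norm v)\<^sup>2 + \<eta> * (norm v)\<^sup>2" using yz(6)[of v] quad[of v] by simp
          also have "\<dots> = (\<eta> - c/2) * (norm v)\<^sup>2" by (simp add: algebra_simps)
          also have "\<dots> \<le> - min (\<phi> x0 / 2) (c / 4) * (norm v)\<^sup>2"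
            using eta(3) by (intro mult_right_mono) (linarith, simp)
          finally show ?thesis .
        qed
      qed
    qed
    then show "j \<in> Qtilde" using sym by (simp add: j Qtilde_def)
  qed
qed

end
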